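(* Let $\mathfrak g$ be a complete left-symmetric algebra over $\mathbb F$. Then $\mathfrak g$ admits a unique canonical decomposition; that is, there exists exactly one Cartan subalgebra $\mathfrak h$ of the Lie algebra $\mathfrak g$ such that $\mathfrak h^{\lambda}=\mathfrak g^{\lambda}$ for all $\lambda$.
   Context: All algebras are finite dimensional over $\mathbb F=\mathbb R$ or $\mathbb F=\mathbb C$. A left-symmetric algebra is a vector space $\mathfrak g$ with a bilinear product such that $x(yz)-(xy)z=y(xz)-(yx)z$ for all $x,y,z$. Then $[x,y]=xy-yx$ is a Lie bracket, making $\mathfrak g$ also a Lie algebra with $\operatorname{ad}(x)y=[x,y]$, and $L(x)y=xy$ defines a representation $L$ of this Lie algebra in the space $\mathfrak g$. Completeness: each $x\in\mathfrak g$ defines the affine vector field $F_x(y)=xy+x$ on the vector space $\mathfrak g$; these fields form a Lie algebra of affine vector fields. Let $G$ be the corresponding connected Lie group of affine transformations of $\mathfrak g$ (generated by the flows of the fields $F_x$). The algebra $\mathfrak g$ is complete if $G$ acts transitively on $\mathfrak g$. Root subspaces: let $\mathfrak h$ be a Cartan subalgebra (nilpotent, self-normalizing) of the Lie algebra $\mathfrak g$. If $\mathbb F=\mathbb C$ and $\lambda$ is a linear functional on $\mathfrak h$, then $\mathfrak h^\lambda$ (respectively $\mathfrak g^\lambda$) denotes the root subspace (generalized weight space) of $\lambda$ in $\mathfrak g$ for the restriction to $\mathfrak h$ of the representation $\operatorname{ad}$ (respectively $L$), i.e. the set of $v$ such that for each $h\in\mathfrak h$ the vector $v$ is annihilated by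 some power of $\operatorname{ad}(h)-\lambda(h)$ (respectively $L(h)-\lambda(h)$). If $\mathbb F=\mathbb R$, then $\lambda$ is a complex linear functional on $\mathfrak h^{\mathbb C}=\mathfrak h+i\mathfrak h$, and $\mathfrak h^\lambda,\mathfrak g^\lambda\subseteq\mathfrak g$ are the sets of real parts of the vectors of the corresponding root subspaces in $\mathfrak g\otimes\mathbb C$. One has decompositions $\mathfrak g=\bigoplus_\lambda\mathfrak h^\lambda$ and $\mathfrak g=\bigoplus_\lambda\mathfrak g^\lambda$ (for $\mathbb F=\mathbb R$, complex conjugate functionals give the same summand, which is counted once). The decomposition is canonical if the two coincide, i.e. $\mathfrak h^\lambda=\mathfrak g^\lambda$ for all $\lambda$. *)

theory Defs
  imports "HOL-Analysis.Analysis"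
begin

section \<open>Left-symmetric algebras\<close>

locale left_symmetric_algebra = vector_space scl
  for scl :: "'f::field \<Rightarrow> 'v::ab_group_add \<Rightarrow> 'v" +
  fixes mul :: "'v \<Rightarrow> 'v \<Rightarrow> 'v"
  assumes finite_dimensional: "\<exists>B. finite B \<and> span B = UNIV"
    and linear_right: "Vector_Spaces.linear scl scl (\<lambda>y. mul x y)"
    and linear_left: "Vector_Spaces.linear scl scl (\<lambda>x. mul x y)"
    and left_symmetric:
      "mul x (mul y z) - mul (mul x y) z = mul y (mul x z) - mul (mul y x) z"

definition lie_bracket :: "('v::ab_group_add \<Rightarrow> 'v \<Rightarrow> 'v) \<Rightarrow> 'v \<Rightarrow> 'v \<Rightarrow> 'v" where
  "lie_bracket mul x y = mul x y - mul y x"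


section \<open>Completeness\<close>

text \<open>The topology of a complex algebra, needed for the flows, comes from its
  underlying real vector space. Every finite-dimensional real vector space carries a complete norm,
  and all its norms define the same topology, so working in types of class \<open>banach\<close>
  is no restriction; unlike \<open>euclidean_space\<close>, this class allows dimension zero.\<close>

definition extends_scaleR :: "(complex \<Rightarrow> 'v::real_vector \<Rightarrow> 'v) \<Rightarrow> bool" where
  "extends_scaleR scl \<longleftrightarrow> (\<forall>r v. scl (of_real r) v = r *\<^sub>R v)"

text \<open>Flows are taken with real time, also for complex algebras: the fields
  \<open>F\<^sub>x\<close> depend linearly on \<open>x\<close>, so the complex-time flow of \<open>F\<^sub>x\<close> at time
  \<open>c\<close> is the real-time flow of the field of \<open>c x\<close> at time \<open>1\<close>.\<close>

definition affine_field :: "('v::ab_group_add \<Rightarrow> 'v \<Rightarrow> 'v) \<Rightarrow> 'v \<Rightarrow> 'v \<Rightarrow> 'v" where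
  "affine_field mul x y = mul x y + x"

definition is_flow :: "('v::real_normed_vector \<Rightarrow> 'v) \<Rightarrow> (real \<Rightarrow> 'v \<Rightarrow> 'v) \<Rightarrow> bool" where
  "is_flow X \<phi> \<longleftrightarrow>
    (\<forall>y. \<phi> 0 y = y \<and>
         (\<forall>t. ((\<lambda>s. \<phi> s y) has_vector_derivative X (\<phi> t y)) (at t)))"

inductive_set affine_group ::
    "('v::real_normed_vector \<Rightarrow> 'v \<Rightarrow> 'v) \<Rightarrow> ('v \<Rightarrow> 'v) set"
  for mul where
    one: "id \<in> affine_group mul"
  | flow: "is_flow (affine_field mul x) \<phi> \<Longrightarrow> \<phi> t \<in> affine_group mul"
  | comp: "g \<in> affine_group mul \<Longrightarrow> k \<in> affine_group mul \<Longrightarrow> g \<circ> k \<in> affine_group mul"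
  | inverse: "g \<in> affine_group mul \<Longrightarrow> inv g \<in> affine_group mul"

definition complete_algebra :: "('v::real_normed_vector \<Rightarrow> 'v \<Rightarrow> 'v) \<Rightarrow> bool" where
  "complete_algebra mul \<longleftrightarrow> (\<forall>y z. \<exists>g\<in>affine_group mul. g y = z)"


section \<open>Cartan subalgebras\<close>

primrec lower_central ::
    "('f::field \<Rightarrow> 'v::ab_group_add \<Rightarrow> 'v) \<Rightarrow> ('v \<Rightarrow> 'v \<Rightarrow> 'v) \<Rightarrow> 'v set \<Rightarrow> nat \<Rightarrow> 'v set" where
  "lower_central scl br h 0 = h"
| "lower_central scl br h (Suc n) =
    module.span scl {br x y | x y. x \<in> h \<and> y \<in> lower_central scl br h n}"

definition cartan_subalgebra ::
    "('f::field \<Rightarrow> 'v::ab_group_add \<Rightarrow> 'v) \<Rightarrow> ('v \<Rightarrow> 'v \<Rightarrow> 'v) \<Rightarrow> 'v set \<Rightarrow> bool" where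
  "cartan_subalgebra scl br h \<longleftrightarrow>
     module.subspace scl h \<and> (\<forall>x\<in>h. \<forall>y\<in>h. br x y \<in> h) \<and>
     (\<exists>n. lower_central scl br h n = {0}) \<and>
     {x. \<forall>y\<in>h. br x y \<in> h} = h"


section \<open>Root subspaces and canonical decompositions over the complex numbers\<close>

text \<open>Functionals on a subspace \<open>h\<close> are functions on the whole type; their values
  outside \<open>h\<close> play no role.\<close>

definition linear_functional_on ::
    "('f::field \<Rightarrow> 'v::ab_group_add \<Rightarrow> 'v) \<Rightarrow> 'v set \<Rightarrow> ('v \<Rightarrow> 'f) \<Rightarrow> bool" where
  "linear_functional_on scl h l \<longleftrightarrow>
     (\<forall>x\<in>h. \<forall>y\<in>h. l (x + y) = l x + l y) \<and> (\<forall>c. \<forall>x\<in>h. l (scl c x) = c * l x)"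

definition root_subspace ::
    "('f::field \<Rightarrow> 'v::ab_group_add \<Rightarrow> 'v) \<Rightarrow> ('v \<Rightarrow> 'v \<Rightarrow> 'v) \<Rightarrow> 'v set \<Rightarrow> ('v \<Rightarrow> 'f) \<Rightarrow> 'v set" where
  "root_subspace scl \<rho> h l =
     {v. \<forall>x\<in>h. \<exists>n. ((\<lambda>w. \<rho> x w - scl (l x) w) ^^ n) v = 0}"

definition canonical_complex ::
    "(complex \<Rightarrow> 'v::ab_group_add \<Rightarrow> 'v) \<Rightarrow> ('v \<Rightarrow> 'v \<Rightarrow> 'v) \<Rightarrow> 'v set \<Rightarrow> bool" where
  "canonical_complex scl mul h \<longleftrightarrow>
     (\<forall>l. linear_functional_on scl h l \<longrightarrow>
        root_subspace scl (lie_bracket mul) h l = root_subspace scl mul h l)"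


section \<open>Root subspaces and canonical decompositions over the real numbers\<close>

text \<open>The complexification of a real space is realised on pairs, \<open>(u, v)\<close> standing
  for \<open>u + i v\<close>; thus \<open>h + i h\<close> is \<open>h \<times> h\<close> and the real part is \<open>fst\<close>.\<close>

definition scale_cx :: "complex \<Rightarrow> 'v::real_vector \<times> 'v \<Rightarrow> 'v \<times> 'v" where
  "scale_cx c p = (Re c *\<^sub>R fst p - Im c *\<^sub>R snd p, Re c *\<^sub>R snd p + Im c *\<^sub>R fst p)"

definition mul_cx ::
    "('v::real_vector \<Rightarrow> 'v \<Rightarrow> 'v) \<Rightarrow> 'v \<times> 'v \<Rightarrow> 'v \<times> 'v \<Rightarrow> 'v \<times> 'v" where
  "mul_cx mul p q =
     (mul (fst p) (fst q) - mul (snd p) (snd q), mul (fst p) (snd q) + mul (snd p) (fst q))"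

definition real_root_subspace ::
    "('v::real_vector \<times> 'v \<Rightarrow> 'v \<times> 'v \<Rightarrow> 'v \<times> 'v) \<Rightarrow> 'v set \<Rightarrow> ('v \<times> 'v \<Rightarrow> complex) \<Rightarrow> 'v set" where
  "real_root_subspace \<rho> h l = fst ` root_subspace scale_cx \<rho> (h \<times> h) l"

definition canonical_real :: "('v::real_vector \<Rightarrow> 'v \<Rightarrow> 'v) \<Rightarrow> 'v set \<Rightarrow> bool" where
  "canonical_real mul h \<longleftrightarrow>
     (\<forall>l. linear_functional_on scale_cx (h \<times> h) l \<longrightarrow>
        real_root_subspace (lie_bracket (mul_cx mul)) h l =
        real_root_subspace (mul_cx mul) h l)"

end

theory Submission
  imports Defs "HOL-Computational_Algebra.Fundamental_Theorem_Algebra"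
begin

text \<open>
  Write \<open>L(x)\<close> for left multiplication and let \<open>x\<close> act on \<open>g + F\<close> by the affine field \<open>F\<^sub>x\<close>.

  If \<open>x\<close> lies in the generalized null space of \<open>L(x)\<close> (the origin has weight \<open>0\<close> under \<open>x\<close>), applying weight
  vectors of \<open>ad x\<close> to the origin shows that \<open>ad x\<close> and \<open>L(x)\<close> have the same generalized eigenspaces. Hence a
  Cartan subalgebra is canonical iff this holds for all its elements.

  Uniqueness needs no completeness. Over the complex numbers, let \<open>h\<close> and \<open>k\<close> be canonical. The semisimple part
  \<open>D\<close> of \<open>L(y)\<close>, \<open>y \<in> k\<close>, is a derivation of the product, and it preserves the weight spaces of every \<open>x \<in> h\<close>;
  so \<open>h\<close> contains the \<open>k\<close>-weight components of its elements \<open>x\<close>. Those of nonzero weight act nilpotently, so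
  every weight of \<open>h\<close> takes on \<open>x\<close> the value that it takes on the component of weight \<open>0\<close>, which lies in
  \<open>h \<inter> k\<close>. This forces \<open>k \<subseteq> h\<close>. The real case follows by complexification.

  For existence, choose \<open>x\<close> such that the null spaces of \<open>ad x\<close> and of \<open>F\<^sub>x\<close> are minimal. All elements of the
  null space \<open>h\<close> of \<open>ad x\<close> are then nilpotent on both, and the null space of \<open>F\<^sub>x\<close> contains some point \<open>v\<close>.
  The affine group acts on \<open>g\<close> by automorphisms, and by completeness some element of it moves \<open>v\<close> to the
  origin; after this conjugation \<open>h\<close> is the canonical Cartan subalgebra.
\<close>

section \<open>Fitting null components and generalized eigenspaces\<close>

text \<open>The notion \<open>null_part\<close> mentions no scalars, and this lets the two halves of
  the proof change fields in opposite directions. Existence rests on flows with real time and is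
  proved for real algebras; its outcome speaks only of null parts of \<open>br\<close> and
  \<open>mul\<close>, so it can be read in a complex algebra regarded as a real one. Uniqueness
  rests on eigenvalues and is proved over the complex numbers; a real algebra reaches it through
  pairs.

  The affine representation on g + F is used because the product, unlike the bracket, depends on
  which point is called the origin. Fitting's decomposition gives every \<open>x\<close> a point of
  weight 0 under its affine field, but in general not the origin; completeness closes this gap. Two
  null spaces are minimized together because they do different work: the one of \<open>br x\<close>
  becomes the Cartan subalgebra, the one of the affine field makes all elements of that subalgebra
  act nilpotently around one common point.\<close>

definition null_part :: "('v::zero \<Rightarrow> 'v) \<Rightarrow> 'v set" where
  "null_part T = {v. \<exists>n. (T ^^ n) v = 0}"

lemma null_partI: "(T ^^ n) v = 0 \<Longrightarrow> v \<in> null_part T"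
  by (auto simp: null_part_def)

lemma zero_in_null_part: "0 \<in> null_part T"
  by (rule null_partI[where n = 0]) simp

lemma null_part_back: "T v \<in> null_part T \<Longrightarrow> v \<in> null_part T"
  unfolding null_part_def by (auto simp: funpow_swap1 intro: exI[where x = "Suc _"])

text \<open>Induction on a power of \<open>T\<close> that kills \<open>v\<close>, phrased as descent
  along \<open>T\<close>: later proofs pull a property back from \<open>T v\<close> to
  \<open>v\<close> and handle no exponents.\<close>

lemma null_part_induct [consumes 1, case_names zero step]:
  assumes "v \<in> null_part T" and "P 0"
    and "\<And>v. T v \<in> null_part T \<Longrightarrow> P (T v) \<Longrightarrow> P v"
  shows "P v"
proof -
  obtain n where "(T ^^ n) v = 0"
    using assms(1) by (auto simp: null_part_def)
  then show ?thesis
  proof (induction n arbitrary: v)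
    case 0
    then show ?case using assms(2) by simp
  next
    case (Suc n)
    then have "(T ^^ n) (T v) = 0"
      by (simp add: funpow_swap1)
    then show ?case
      using Suc.IH assms(3) null_partI by blast
  qed
qed

lemma funpow_at_zero: "T 0 = 0 \<Longrightarrow> (T ^^ n) 0 = 0" for T :: "'v::zero \<Rightarrow> 'v"
  by (induction n) auto

lemma funpow_zero_mono:
  fixes T :: "'v::zero \<Rightarrow> 'v"
  assumes "T 0 = 0" and "(T ^^ m) v = 0" and "m \<le> n"
  shows "(T ^^ n) v = 0"
proof -
  have "(T ^^ n) v = (T ^^ (n - m)) ((T ^^ m) v)"
    using assms(3) by (metis funpow_add le_add_diff_inverse2 o_apply)
  then show ?thesis
    using assms by (simp add: funpow_at_zero)
qed

lemma null_part_image: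
  assumes "T 0 = 0" and "v \<in> null_part T"
  shows "T v \<in> null_part T"
proof -
  obtain n where "(T ^^ n) v = 0"
    using assms(2) by (auto simp: null_part_def)
  then have "(T ^^ n) (T v) = 0"
    using assms(1) by (simp add: funpow_swap1[symmetric])
  then show ?thesis by (rule null_partI)
qed

lemma funpow_additive:
  fixes T :: "'v::ab_group_add \<Rightarrow> 'v"
  assumes "\<And>v w. T (v + w) = T v + T w"
  shows "(T ^^ n) (v + w) = (T ^^ n) v + (T ^^ n) w"
  by (induction n) (auto simp: assms)

lemma null_part_add:
  fixes T :: "'v::ab_group_add \<Rightarrow> 'v"
  assumes add: "\<And>v w. T (v + w) = T v + T w"
    and v: "v \<in> null_part T" and w: "w \<in> null_part T"
  shows "v + w \<in> null_part T"
proof -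
  have T0: "T 0 = 0"
    using add[of 0 0] by simp
  obtain m n where "(T ^^ m) v = 0" "(T ^^ n) w = 0"
    using v w by (auto simp: null_part_def)
  then have "(T ^^ (max m n)) v = 0" "(T ^^ (max m n)) w = 0"
    using funpow_zero_mono[of T m v "max m n", OF T0] funpow_zero_mono[of T n w "max m n", OF T0] by auto
  then show ?thesis
    by (intro null_partI[where n = "max m n"]) (simp add: funpow_additive[OF add])
qed

text \<open>The common source of all inclusions between weight spaces below: \<open>\<beta>\<close> is a bracket, a product,
  or the action of operators on vectors.\<close>

lemma null_part_leibniz:
  fixes \<beta> :: "'u::zero \<Rightarrow> 'v::zero \<Rightarrow> 'w::ab_group_add"
  assumes add: "\<And>w w'. C (w + w') = C w + C w'"
    and leib: "\<And>u v. C (\<beta> u v) = \<beta> (A u) v + \<beta> u (B v)"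
    and zero: "\<And>v. \<beta> 0 v = 0" "\<And>u. \<beta> u 0 = 0"
    and u: "u \<in> null_part A" and v: "v \<in> null_part B"
  shows "\<beta> u v \<in> null_part C"
  using u v
proof (induction u arbitrary: v rule: null_part_induct)
  case zero
  then show ?case by (simp add: assms(3) zero_in_null_part)
next
  case (step u)
  note outer = step.IH
  from step.prems show ?case
  proof (induction v rule: null_part_induct)
    case zero
    then show ?case by (simp add: assms(4) zero_in_null_part)
  next
    case (step v)
    have "C (\<beta> u v) \<in> null_part C"
      unfolding leib using outer[OF null_part_back[OF step.hyps]] step.IH
      by (intro null_part_add[OF add]) auto
    then show ?case by (rule null_part_back)
  qed
qed


locale linear_space = vector_space scl
  for scl :: "'f::field \<Rightarrow> 'v::ab_group_add \<Rightarrow> 'v"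
begin

abbreviation endo :: "('v \<Rightarrow> 'v) \<Rightarrow> bool" where
  "endo T \<equiv> Vector_Spaces.linear scl scl T"

lemma endoI:
  assumes "\<And>v w. T (v + w) = T v + T w" and "\<And>c v. T (scl c v) = scl c (T v)"
  shows "endo T"
  using assms by (simp add: Vector_Spaces.linear_iff vector_space_axioms)

lemma endo_add: "endo T \<Longrightarrow> T (v + w) = T v + T w"
  by (simp add: Vector_Spaces.linear_iff)

lemma endo_scale: "endo T \<Longrightarrow> T (scl c v) = scl c (T v)"
  by (simp add: Vector_Spaces.linear_iff)

lemma endo_0: "endo T \<Longrightarrow> T 0 = 0"
  using endo_scale[of T 0 0] by simp

lemma endo_neg: "endo T \<Longrightarrow> T (- v) = - T v"
  using endo_add[of T v "- v"] endo_0[of T] by (simp add: eq_neg_iff_add_eq_0 add.commute)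

lemma endo_diff: "endo T \<Longrightarrow> T (v - w) = T v - T w"
  using endo_add[of T v "- w"] endo_neg[of T w] by simp

lemma endo_sum: "endo T \<Longrightarrow> T (sum f I) = (\<Sum>i\<in>I. T (f i))"
  by (induction I rule: infinite_finite_induct) (auto simp: endo_0 endo_add)

lemma endo_shift: "endo T \<Longrightarrow> endo (\<lambda>w. T w - scl c w)"
  by (rule endoI) (auto simp: endo_add endo_scale algebra_simps)

lemma endo_funpow: "endo T \<Longrightarrow> endo (T ^^ n)"
  by (rule endoI; induction n) (auto simp: endo_add endo_scale)

lemma subspace_null_part:
  assumes "endo T"
  shows "subspace (null_part T)"
proof (rule subspaceI)
  fix v c
  assume "v \<in> null_part T"
  then show "scl c v \<in> null_part T"
    by (auto simp: null_part_def endo_scale[OF endo_funpow[OF assms]])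
qed (auto simp: zero_in_null_part intro: null_part_add endo_add[OF assms])

definition gen_eig :: "('v \<Rightarrow> 'v) \<Rightarrow> 'f \<Rightarrow> 'v set" where
  "gen_eig T c = null_part (\<lambda>w. T w - scl c w)"

lemma subspace_gen_eig: "endo T \<Longrightarrow> subspace (gen_eig T c)"
  unfolding gen_eig_def by (intro subspace_null_part endo_shift)

lemma gen_eig_0: "gen_eig T 0 = null_part T"
  by (simp add: gen_eig_def)

lemma gen_eig_image:
  assumes "endo T" and "v \<in> gen_eig T c"
  shows "T v \<in> gen_eig T c"
proof -
  have "T v - scl c v \<in> gen_eig T c"
    using assms endo_0[OF endo_shift[OF assms(1)]] null_part_image[of "\<lambda>w. T w - scl c w"]
    unfolding gen_eig_def by blast
  then have "(T v - scl c v) + scl c v \<in> gen_eig T c"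
    by (intro subspace_add subspace_scale subspace_gen_eig assms)
  then show ?thesis by simp
qed

lemma gen_eig_induct [consumes 2, case_names zero step]:
  assumes "endo T" and "v \<in> gen_eig T c" and "P 0"
    and "\<And>v. v \<in> gen_eig T c \<Longrightarrow> T v - scl c v \<in> gen_eig T c \<Longrightarrow> P (T v - scl c v) \<Longrightarrow> P v"
  shows "P v"
  using assms(2) unfolding gen_eig_def
proof (induction v rule: null_part_induct)
  case zero
  then show ?case by fact
next
  case (step v)
  then show ?case
    using assms(4)[of v] null_part_back[OF step.hyps] by (simp add: gen_eig_def)
qed

text \<open>By descent \<open>T v - scl a v\<close> is already 0, so \<open>v\<close> is an honest
  eigenvector for \<open>a\<close>, and powers of \<open>T - b\<close> multiply it by powers of
  \<open>a - b\<close>.\<close>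

lemma gen_eig_disjoint:
  assumes T: "endo T" and v: "v \<in> gen_eig T a" "v \<in> gen_eig T b" and ab: "a \<noteq> b"
  shows "v = 0"
  using T v
proof (induction v rule: gen_eig_induct)
  case zero
  then show ?case by simp
next
  case (step v)
  have "T v - scl a v \<in> gen_eig T b"
    by (intro subspace_diff subspace_scale subspace_gen_eig gen_eig_image T step.prems)
  then have Tv: "T v = scl a v"
    using step.IH by simp
  have "\<exists>n. ((\<lambda>w. T w - scl b w) ^^ n) v = 0"
    using step.prems by (simp add: gen_eig_def null_part_def)
  then obtain n where n: "((\<lambda>w. T w - scl b w) ^^ n) v = 0" by blast
  have "((\<lambda>w. T w - scl b w) ^^ n) v = scl ((a - b) ^ n) v"
    by (induction n) (auto simp: endo_scale[OF T] Tv scale_left_diff_distrib algebra_simps)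
  then show ?case
    using n ab by simp
qed

text \<open>A power of \<open>T - a\<close> that kills \<open>f a\<close> keeps the other components
  in their own spaces, so by induction it kills them all; each then lies in two generalized
  eigenspaces at once.\<close>

lemma gen_eig_independent:
  assumes T: "endo T" and "finite I" and "\<And>c. c \<in> I \<Longrightarrow> f c \<in> gen_eig T c"
    and "(\<Sum>c\<in>I. f c) = 0"
  shows "\<forall>c\<in>I. f c = 0"
  using assms(2-)
proof (induction I arbitrary: f rule: finite_induct)
  case empty
  then show ?case by simp
next
  case (insert a I)
  let ?S = "\<lambda>w. T w - scl a w"
  obtain n where n: "(?S ^^ n) (f a) = 0"
    using insert.prems(1)[of a] by (auto simp: gen_eig_def null_part_def)
  have S: "endo (?S ^^ n)"
    by (intro endo_funpow endo_shift T)
  have stay: "(?S ^^ m) v \<in> gen_eig T c" if "v \<in> gen_eig T c" for m v c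
  proof (induction m)
    case (Suc m)
    then show ?case
      by (auto intro!: subspace_diff subspace_scale subspace_gen_eig gen_eig_image T)
  qed (use that in simp)
  have "(?S ^^ n) (\<Sum>c\<in>insert a I. f c) = 0"
    using insert.prems(2) endo_0[OF S] by simp
  then have "(\<Sum>c\<in>I. (?S ^^ n) (f c)) = 0"
    using n insert.hyps by (simp add: endo_add[OF S] endo_sum[OF S])
  then have *: "\<forall>c\<in>I. (?S ^^ n) (f c) = 0"
    by (intro insert.IH) (auto intro: stay insert.prems(1))
  have I0: "\<forall>c\<in>I. f c = 0"
  proof
    fix c assume c: "c \<in> I"
    have "f c \<in> gen_eig T a"
      unfolding gen_eig_def using * c by (intro null_partI) auto
    then show "f c = 0"
      using gen_eig_disjoint[OF T, of "f c" a c] insert.prems(1)[of c] insert.hyps c by auto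
  qed
  then show ?case
    using insert.prems(2) insert.hyps by simp
qed

text \<open>On the generalized eigenspace of \<open>d\<close>, \<open>T - c\<close> is the nonzero
  scalar \<open>d - c\<close> plus the locally nilpotent \<open>T - d\<close>. Once descent provides
  \<open>w'\<close> with \<open>(T - c) w' = (T - d) w\<close>, the difference \<open>w - w'\<close>
  is mapped to \<open>(d - c) w\<close>.\<close>

lemma gen_eig_solve:
  assumes T: "endo T" and U: "subspace U" "\<And>u. u \<in> U \<Longrightarrow> T u \<in> U"
    and w: "w \<in> gen_eig T d" "w \<in> U" and cd: "d \<noteq> c"
  shows "\<exists>w'\<in>U \<inter> gen_eig T d. T w' - scl c w' = w"
  using T w
proof (induction w rule: gen_eig_induct)
  case zero
  show ?case
    using U(1) subspace_gen_eig[OF T, of d] by (intro bexI[of _ 0]) (auto simp: endo_0[OF T] subspace_0)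
next
  case (step w)
  have "T w - scl d w \<in> U"
    by (intro subspace_diff subspace_scale U step.prems)
  then obtain w' where w': "w' \<in> U" "w' \<in> gen_eig T d" "T w' - scl c w' = T w - scl d w"
    using step.IH by auto
  let ?k = "inverse (d - c)"
  have k: "?k * (d - c) = 1" using cd by simp
  show ?case
  proof (rule bexI)
    have "T (scl ?k (w - w')) - scl c (scl ?k (w - w'))
        = scl ?k ((T w - scl c w) - (T w' - scl c w'))"
      by (simp add: endo_scale[OF T] endo_diff[OF T] algebra_simps)
    also have "\<dots> = scl ?k (scl (d - c) w)"
      unfolding w'(3) by (simp add: algebra_simps)
    also have "\<dots> = w" using k by simp
    finally show "T (scl ?k (w - w')) - scl c (scl ?k (w - w')) = w" .
    show "scl ?k (w - w') \<in> U \<inter> gen_eig T d"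
      using w' step by (auto intro!: subspace_scale subspace_diff U subspace_gen_eig T)
  qed
qed

lemma span_UN_sum:
  assumes "v \<in> span (\<Union>i\<in>J. W i)" and "\<And>i. i \<in> J \<Longrightarrow> subspace (W i)"
  shows "\<exists>I f. finite I \<and> I \<subseteq> J \<and> (\<forall>i\<in>I. f i \<in> W i) \<and> v = (\<Sum>i\<in>I. f i)"
  using assms(1)
proof (induction rule: span_induct_alt)
  case base
  show ?case by (rule exI[of _ "{}"]) auto
next
  case (step c x y)
  obtain j where j: "j \<in> J" "x \<in> W j" using step.hyps by blast
  obtain I f where I: "finite I" "I \<subseteq> J" "\<forall>i\<in>I. f i \<in> W i" "y = (\<Sum>i\<in>I. f i)"
    using step.IH by blast
  have x: "scl c x \<in> W j"
    using j assms(2) by (simp add: subspace_scale)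
  let ?f = "\<lambda>i. (if i = j then scl c x else 0) + (if i \<in> I then f i else 0)"
  have "(\<Sum>i\<in>insert j I. ?f i) = scl c x + y"
    using I by (auto simp: sum.distrib sum.insert_if sum.If_cases Int_absorb1 Int_commute intro!: sum.cong)
  moreover have "\<forall>i\<in>insert j I. ?f i \<in> W i"
    using I j x assms(2) by (auto simp: subspace_0 subspace_add subsetD)
  ultimately show ?case
    using I j by (intro exI[of _ "insert j I"] exI[of _ ?f]) auto
qed

end


section \<open>Finite-dimensional spaces\<close>

locale fd_space = linear_space scl for scl :: "'f::field \<Rightarrow> 'v::ab_group_add \<Rightarrow> 'v" +
  assumes finite_span: "\<exists>B. finite B \<and> span B = UNIV"
begin

lemma finite_basis:
  obtains B where "finite_dimensional_vector_space scl B"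
proof -
  obtain A where A: "finite A" "span A = UNIV"
    using finite_span by blast
  obtain B where B: "B \<subseteq> A" "independent B" "A \<subseteq> span B"
    using maximal_independent_subset[of A] by blast
  have "span B = UNIV"
    using A(2) B(3) span_minimal[of A "span B"] by auto
  then have "finite_dimensional_vector_space scl B"
    using A(1) B by unfold_locales (auto intro: finite_subset)
  then show ?thesis by (rule that)
qed

lemma dim_less:
  assumes "subspace S" "subspace S'" "S \<subset> S'"
  shows "dim S < dim S'"
proof -
  obtain B where "finite_dimensional_vector_space scl B" by (rule finite_basis)
  then interpret B: finite_dimensional_vector_space scl B .
  have "span S \<subset> span S'"
    using assms span_eq_iff by metis
  then show ?thesis by (rule B.dim_psubset)
qed

lemma dim_le_UNIV: "dim S \<le> dim UNIV"
proof -
  obtain B where "finite_dimensional_vector_space scl B" by (rule finite_basis)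
  then interpret B: finite_dimensional_vector_space scl B .
  show ?thesis by (rule B.dim_subset) simp
qed

lemma finite_independent: "independent S \<Longrightarrow> finite S"
proof -
  obtain B where "finite_dimensional_vector_space scl B" by (rule finite_basis)
  then interpret B: finite_dimensional_vector_space scl B .
  show "independent S \<Longrightarrow> finite S" by (rule B.finiteI_independent)
qed

lemma minimal_subspace:
  assumes "P S\<^sub>0" and "\<And>S. P S \<Longrightarrow> subspace S"
  obtains S where "P S" and "\<And>S'. P S' \<Longrightarrow> S' \<subseteq> S \<Longrightarrow> S' = S"
proof -
  obtain S where S: "P S" "\<And>S'. P S' \<Longrightarrow> dim S \<le> dim S'"
    using ex_has_least_nat[of P S\<^sub>0 dim] assms(1) by blast
  show ?thesis
  proof (rule that[OF S(1)])
    fix S' assume S': "P S'" "S' \<subseteq> S"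
    show "S' = S"
    proof (rule ccontr)
      assume "S' \<noteq> S"
      then have "dim S' < dim S"
        using S' S(1) assms(2) by (intro dim_less) auto
      then show False using S(2)[OF S'(1)] by simp
    qed
  qed
qed

lemma maximal_subspace:
  assumes "P S\<^sub>0" and "\<And>S. P S \<Longrightarrow> subspace S"
  obtains S where "P S" and "\<And>S'. P S' \<Longrightarrow> S \<subseteq> S' \<Longrightarrow> S' = S"
proof -
  obtain S where S: "P S" "\<And>S'. P S' \<Longrightarrow> dim S' \<le> dim S"
    using ex_has_greatest_nat[of P S\<^sub>0 dim "Suc (dim UNIV)"] assms(1) dim_le_UNIV
    by (auto simp: less_Suc_eq_le)
  show ?thesis
  proof (rule that[OF S(1)])
    fix S' assume S': "P S'" "S \<subseteq> S'"
    show "S' = S"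
    proof (rule ccontr)
      assume "S' \<noteq> S"
      then have "dim S < dim S'"
        using S' S(1) assms(2) by (intro dim_less) auto
      then show False using S(2)[OF S'(1)] by simp
    qed
  qed
qed

lemma subspace_induct [consumes 1, case_names less]:
  assumes "subspace S"
    and "\<And>S. subspace S \<Longrightarrow> (\<And>S'. subspace S' \<Longrightarrow> S' \<subset> S \<Longrightarrow> P S') \<Longrightarrow> P S"
  shows "P S"
  using assms(1)
proof (induction S rule: measure_induct_rule[where f = dim])
  case (less S)
  then show ?case using assms(2) dim_less by blast
qed

text \<open>The ranges of the powers of \<open>T\<close> decrease and hence stabilize, at
  \<open>n\<close> say; then \<open>T^n w = T^(n+1) u\<close> for some \<open>u\<close>, and
  \<open>T^n\<close> kills \<open>w - T u\<close>. This holds over any field.\<close>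

lemma fitting:
  assumes T: "endo T"
  shows "\<exists>u. w - T u \<in> null_part T"
proof -
  let ?P = "\<lambda>S. \<exists>n. S = range (T ^^ n)"
  have sub: "subspace S" if "?P S" for S
  proof -
    from that obtain n where S: "S = range (T ^^ n)" by blast
    note E = endo_funpow[OF T, of n]
    show ?thesis unfolding S
      by (rule subspaceI)
        (auto simp: endo_0[OF E] endo_add[OF E, symmetric] endo_scale[OF E, symmetric]
          intro: range_eqI[of _ _ 0])
  qed
  obtain S where S: "?P S" "\<And>S'. ?P S' \<Longrightarrow> S' \<subseteq> S \<Longrightarrow> S' = S"
    using minimal_subspace[of ?P "range (T ^^ 0)"] sub by blast
  then obtain n where n: "S = range (T ^^ n)" by blast
  have "range (T ^^ Suc n) \<subseteq> S"
    unfolding n by (auto simp: funpow_swap1)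
  then have "range (T ^^ Suc n) = S"
    using S(2) by blast
  then obtain u where "(T ^^ n) w = (T ^^ Suc n) u"
    using n by blast
  then have "(T ^^ n) (w - T u) = 0"
    by (simp add: endo_diff[OF endo_funpow[OF T]] funpow_swap1)
  then show ?thesis using null_partI by blast
qed

end


locale complex_space = fd_space scl for scl :: "complex \<Rightarrow> 'v::ab_group_add \<Rightarrow> 'v"
begin

definition poly_act :: "('v \<Rightarrow> 'v) \<Rightarrow> complex poly \<Rightarrow> 'v \<Rightarrow> 'v" where
  "poly_act T p v = (\<Sum>i\<le>degree p. scl (coeff p i) ((T ^^ i) v))"

lemma poly_act_bound:
  "degree p \<le> N \<Longrightarrow> poly_act T p v = (\<Sum>i\<le>N. scl (coeff p i) ((T ^^ i) v))"
  unfolding poly_act_def by (rule sum.mono_neutral_left) (auto simp: coeff_eq_0)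

lemma poly_act_add: "poly_act T (p + q) v = poly_act T p v + poly_act T q v"
  by (simp add: poly_act_bound[of _ "max (degree p) (degree q)"] degree_add_le
      scale_left_distrib sum.distrib)

lemma poly_act_smult: "poly_act T (smult c p) v = scl c (poly_act T p v)"
  by (simp add: poly_act_bound[of _ "degree p"] degree_smult_le scale_sum_right)

lemma poly_act_diff: "poly_act T (p - q) v = poly_act T p v - poly_act T q v"
  using poly_act_add[of T p "smult (-1) q" v] by (simp only: poly_act_smult) simp

lemma poly_act_pCons: "poly_act T (pCons a p) v = scl a v + poly_act T p (T v)"
proof -
  have "poly_act T (pCons a p) v
      = (\<Sum>i\<le>Suc (degree p). scl (coeff (pCons a p) i) ((T ^^ i) v))"
    by (rule poly_act_bound[OF degree_pCons_le])
  also have "\<dots> = scl a v + (\<Sum>i\<le>degree p. scl (coeff p i) ((T ^^ i) (T v)))"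
    by (subst sum.atMost_Suc_shift) (simp add: funpow_swap1)
  finally show ?thesis by (simp add: poly_act_def)
qed

lemma poly_act_monom: "poly_act T (monom 1 n) v = (T ^^ n) v"
  by (induction n arbitrary: v)
    (simp_all add: monom_0 monom_Suc poly_act_pCons funpow_swap1, simp add: poly_act_def)

text \<open>The spans of \<open>u, T u, ..., T^(n-1) u\<close> cannot grow for ever, so some
  \<open>T^n u\<close> is a combination of lower powers. The polynomial annihilates the single
  vector \<open>u\<close>, not \<open>T\<close>.\<close>

lemma annihilating_poly:
  assumes T: "endo T"
  shows "\<exists>p. p \<noteq> 0 \<and> poly_act T p u = 0"
proof -
  let ?S = "\<lambda>n. span ((\<lambda>i. (T ^^ i) u) ` {..<n})"
  obtain S where S: "\<exists>n. S = ?S n" "\<And>S'. \<exists>n. S' = ?S n \<Longrightarrow> S \<subseteq> S' \<Longrightarrow> S' = S"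
    using maximal_subspace[of "\<lambda>S. \<exists>n. S = ?S n" "?S 0"] by blast
  then obtain n where n: "S = ?S n" by blast
  have "?S n \<subseteq> ?S (Suc n)"
    by (intro span_mono) auto
  then have "?S (Suc n) = ?S n"
    using S(2) n by blast
  then have mem: "(T ^^ n) u \<in> ?S n"
    using span_base[of "(T ^^ n) u" "(\<lambda>i. (T ^^ i) u) ` {..<Suc n}"] by auto
  let ?Q = "{poly_act T q u | q. \<forall>i\<ge>n. coeff q i = 0}"
  have "subspace ?Q"
  proof (rule subspaceI)
    show "0 \<in> ?Q" by (auto intro!: exI[of _ 0] simp: poly_act_def)
  next
    fix x y assume "x \<in> ?Q" "y \<in> ?Q"
    then obtain p q where "x = poly_act T p u" "y = poly_act T q u"
      "\<forall>i\<ge>n. coeff p i = 0" "\<forall>i\<ge>n. coeff q i = 0" by blast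
    then show "x + y \<in> ?Q"
      by (auto intro!: exI[of _ "p + q"] simp: poly_act_add)
  next
    fix c x assume "x \<in> ?Q"
    then obtain p where "x = poly_act T p u" "\<forall>i\<ge>n. coeff p i = 0" by blast
    then show "scl c x \<in> ?Q"
      by (auto intro!: exI[of _ "smult c p"] simp: poly_act_smult)
  qed
  moreover have "(\<lambda>i. (T ^^ i) u) ` {..<n} \<subseteq> ?Q"
    by (auto intro!: exI[of _ "monom 1 _"] simp: poly_act_monom)
  ultimately have "?S n \<subseteq> ?Q"
    by (intro span_minimal)
  then obtain q where q: "(T ^^ n) u = poly_act T q u" "\<forall>i\<ge>n. coeff q i = 0"
    using mem by blast
  have "coeff (monom 1 n - q) n = 1" using q(2) by simp
  then have "monom 1 n - q \<noteq> 0" by (metis coeff_0 zero_neq_one)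
  moreover have "poly_act T (monom 1 n - q) u = 0"
    using q(1) by (simp add: poly_act_diff poly_act_monom)
  ultimately show ?thesis by blast
qed

text \<open>Induction on the degree of a polynomial annihilating \<open>u\<close>: for a root
  \<open>c\<close>, the vector \<open>(T - c) u\<close> decomposes by induction, its components at
  \<open>d \<noteq> c\<close> can be divided by \<open>T - c\<close>, and what then remains of
  \<open>u\<close> lies in the generalized eigenspace of \<open>c\<close>. The invariant
  \<open>U\<close> is carried along so that subspaces can be cut up, as in
  \<open>root_span\<close>.\<close>

lemma gen_eig_span:
  assumes T: "endo T" and U: "subspace U" "\<And>u. u \<in> U \<Longrightarrow> T u \<in> U" and u: "u \<in> U"
  shows "u \<in> span (\<Union>c. U \<inter> gen_eig T c)"
proof -
  let ?R = "span (\<Union>c. U \<inter> gen_eig T c)"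
  have claim: "u \<in> ?R" if "p \<noteq> 0" "poly_act T p u = 0" "u \<in> U" for p u
    using that
  proof (induction "degree p" arbitrary: p u)
    case 0
    then obtain a where "p = [:a:]" "a \<noteq> 0"
      by (metis degree_eq_zeroE pCons_0_0)
    then have "u = 0"
      using 0 by (simp add: poly_act_def)
    then show ?case by (simp add: span_zero)
  next
    case (Suc n)
    obtain c where c: "poly p c = 0"
      using alg_closed_imp_poly_has_root[of p] Suc.hyps(2) by auto
    then obtain q where q: "p = [:-c, 1:] * q"
      by (auto simp: poly_eq_0_iff_dvd)
    have q0: "q \<noteq> 0" using q Suc.prems(1) by auto
    have deg: "degree q = n"
    proof -
      have "degree p = degree [:-c, 1:] + degree q"
        unfolding q using q0 by (intro degree_mult_eq) auto
      then show ?thesis using Suc.hyps(2) by simp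
    qed
    have add: "poly_act T q (v + w) = poly_act T q v + poly_act T q w" for v w
      by (simp add: poly_act_def endo_add[OF endo_funpow[OF T]] scale_right_distrib sum.distrib)
    have sca: "poly_act T q (scl a v) = scl a (poly_act T q v)" for a v
      by (simp add: poly_act_def endo_scale[OF endo_funpow[OF T]] scale_sum_right mult.commute)
    have "p = smult (-c) q + pCons 0 q"
      by (simp add: q)
    then have "poly_act T p u = scl (-c) (poly_act T q u) + poly_act T q (T u)"
      by (simp only: poly_act_add poly_act_smult poly_act_pCons) simp
    also have "\<dots> = poly_act T q (scl (-c) u + T u)"
      by (simp only: add sca)
    finally have "poly_act T q (T u - scl c u) = 0"
      using Suc.prems(2) by (simp add: algebra_simps)
    then have "T u - scl c u \<in> ?R"
      using Suc.hyps(1)[of q] deg q0 Suc.prems(3) U by (simp add: subspace_diff subspace_scale)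
    then obtain I f where I: "finite I" "\<forall>d\<in>I. f d \<in> U \<inter> gen_eig T d"
        "T u - scl c u = (\<Sum>d\<in>I. f d)"
      using span_UN_sum[of "T u - scl c u" "\<lambda>c. U \<inter> gen_eig T c" UNIV]
        subspace_inter[OF U(1) subspace_gen_eig[OF T]] by auto
    have "\<forall>d\<in>I - {c}. \<exists>w\<in>U \<inter> gen_eig T d. T w - scl c w = f d"
      using I(2) gen_eig_solve[OF T U] by blast
    then obtain g where g: "\<And>d. d \<in> I - {c} \<Longrightarrow> g d \<in> U \<inter> gen_eig T d \<and> T (g d) - scl c (g d) = f d"
      by metis
    let ?v = "u - (\<Sum>d\<in>I - {c}. g d)"
    have "T ?v - scl c ?v = (T u - scl c u) - (\<Sum>d\<in>I - {c}. T (g d) - scl c (g d))"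
      by (simp add: endo_diff[OF T] endo_sum[OF T] scale_right_diff_distrib scale_sum_right
          sum_subtractf)
    also have "\<dots> = (\<Sum>d\<in>I. f d) - (\<Sum>d\<in>I - {c}. f d)"
      using g I(3) by (metis (no_types, lifting) sum.cong)
    also have "\<dots> = (if c \<in> I then f c else 0)"
      using I(1) by (simp add: sum_diff1)
    finally have "T ?v - scl c ?v \<in> gen_eig T c"
      using I(2) subspace_0[OF subspace_gen_eig[OF T]] by auto
    then have v1: "?v \<in> gen_eig T c"
      unfolding gen_eig_def by (rule null_part_back)
    have "?v \<in> U"
      using g Suc.prems(3) by (intro subspace_diff subspace_sum U) auto
    then have "?v \<in> ?R"
      using v1 by (intro span_base) blast
    moreover have "(\<Sum>d\<in>I - {c}. g d) \<in> ?R"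
      using g by (intro span_sum span_base) blast
    ultimately show ?case
      using span_add by fastforce
  qed
  then show ?thesis using annihilating_poly[OF T] u by blast
qed

lemma gen_eig_sum:
  assumes "endo T" and "subspace U" "\<And>u. u \<in> U \<Longrightarrow> T u \<in> U" and "u \<in> U"
  obtains I f where "finite I" "\<And>c. c \<in> I \<Longrightarrow> f c \<in> U \<inter> gen_eig T c" "u = (\<Sum>c\<in>I. f c)"
  using span_UN_sum[of u "\<lambda>c. U \<inter> gen_eig T c" UNIV]
    gen_eig_span[OF assms] subspace_inter[OF assms(2) subspace_gen_eig[OF assms(1)]]
  by auto

text \<open>\<open>C\<close> collects the values that occur when the members of a finite spanning
  set are decomposed; independence excludes all others.\<close>

lemma eigenvalues:
  assumes T: "endo T"
  obtains C where "finite C" "\<And>v. \<exists>f. (\<forall>c\<in>C. f c \<in> gen_eig T c) \<and> v = (\<Sum>c\<in>C. f c)"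
    "\<And>c. c \<notin> C \<Longrightarrow> gen_eig T c = {0}"
proof -
  obtain B where B: "finite B" "span B = UNIV"
    using finite_span by blast
  have "\<forall>b. \<exists>I. finite I \<and> (\<exists>f. (\<forall>c\<in>I. f c \<in> gen_eig T c) \<and> b = (\<Sum>c\<in>I. f c))"
    by (metis gen_eig_sum[OF T, of UNIV] subspace_UNIV UNIV_I Int_UNIV_left)
  then obtain I where I: "\<And>b. finite (I b)"
      "\<And>b. \<exists>f. (\<forall>c\<in>I b. f c \<in> gen_eig T c) \<and> b = (\<Sum>c\<in>I b. f c)"
    by metis
  define C where "C = (\<Union>b\<in>B. I b)"
  have fin: "finite C"
    using B(1) I(1) by (simp add: C_def)
  have dec: "\<exists>f. (\<forall>c\<in>C. f c \<in> gen_eig T c) \<and> v = (\<Sum>c\<in>C. f c)" for v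
  proof -
    let ?V = "{v. \<exists>f. (\<forall>c\<in>C. f c \<in> gen_eig T c) \<and> v = (\<Sum>c\<in>C. f c)}"
    have "subspace ?V"
    proof (rule subspaceI)
      show "0 \<in> ?V"
        by (auto intro!: exI[of _ "\<lambda>_. 0"] subspace_0 subspace_gen_eig T)
    next
      fix x y assume "x \<in> ?V" "y \<in> ?V"
      then obtain f g where "\<forall>c\<in>C. f c \<in> gen_eig T c" "x = (\<Sum>c\<in>C. f c)"
        "\<forall>c\<in>C. g c \<in> gen_eig T c" "y = (\<Sum>c\<in>C. g c)" by auto
      then show "x + y \<in> ?V"
        by (auto intro!: exI[of _ "\<lambda>c. f c + g c"] subspace_add subspace_gen_eig T simp: sum.distrib)
    next
      fix a x assume "x \<in> ?V"
      then obtain f where "\<forall>c\<in>C. f c \<in> gen_eig T c" "x = (\<Sum>c\<in>C. f c)" by auto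
      then show "scl a x \<in> ?V"
        by (auto intro!: exI[of _ "\<lambda>c. scl a (f c)"] subspace_scale subspace_gen_eig T
            simp: scale_sum_right)
    qed
    moreover have "B \<subseteq> ?V"
    proof
      fix b assume b: "b \<in> B"
      obtain f where f: "\<forall>c\<in>I b. f c \<in> gen_eig T c" "b = (\<Sum>c\<in>I b. f c)"
        using I(2) by blast
      have "b = (\<Sum>c\<in>C. if c \<in> I b then f c else 0)"
        using fin b f(2) by (subst sum.inter_restrict[symmetric]) (auto simp: C_def Int_absorb1 UN_upper)
      then show "b \<in> ?V"
        using f(1) subspace_0[OF subspace_gen_eig[OF T]]
        by (auto intro!: exI[of _ "\<lambda>c. if c \<in> I b then f c else 0"])
    qed
    ultimately show ?thesis
      using span_minimal[of B ?V] B(2) by blast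
  qed
  show ?thesis
  proof (rule that[OF fin dec])
    fix c assume c: "c \<notin> C"
    have "v = 0" if v: "v \<in> gen_eig T c" for v
    proof -
      obtain f where f: "\<forall>c\<in>C. f c \<in> gen_eig T c" "v = (\<Sum>c\<in>C. f c)"
        using dec by blast
      have "\<forall>d\<in>insert c C. (f(c := - v)) d = 0"
      proof (rule gen_eig_independent[OF T])
        have "(\<Sum>d\<in>C. (f(c := - v)) d) = v"
          unfolding f(2) using c by (intro sum.cong) auto
        then show "(\<Sum>d\<in>insert c C. (f(c := - v)) d) = 0"
          using fin c by simp
        show "(f(c := - v)) d \<in> gen_eig T d" if "d \<in> insert c C" for d
          using that f(1) v subspace_gen_eig[OF T] subspace_neg by auto
      qed (use fin in simp)
      then show ?thesis by simp
    qed
    then show "gen_eig T c = {0}"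
      using subspace_0[OF subspace_gen_eig[OF T]] by auto
  qed
qed

text \<open>This is the semisimple part of the Jordan decomposition. Linearity of \<open>D\<close>
  comes from \<open>unique\<close>: the chosen components of a vector are the only ones
  possible.\<close>

lemma semisimple_part:
  assumes T: "endo T"
  obtains D where "endo D" "\<And>c v. v \<in> gen_eig T c \<Longrightarrow> D v = scl c v"
proof -
  obtain C where C: "finite C" "\<And>v. \<exists>f. (\<forall>c\<in>C. f c \<in> gen_eig T c) \<and> v = (\<Sum>c\<in>C. f c)"
    "\<And>c. c \<notin> C \<Longrightarrow> gen_eig T c = {0}"
    using eigenvalues[OF T] by blast
  then obtain f where f: "\<And>v. \<forall>c\<in>C. f v c \<in> gen_eig T c" "\<And>v. v = (\<Sum>c\<in>C. f v c)"
    by metis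
  have unique: "f v c = g c"
    if "\<And>c. c \<in> C \<Longrightarrow> g c \<in> gen_eig T c" "v = (\<Sum>c\<in>C. g c)" "c \<in> C" for v g c
  proof -
    have "\<forall>c\<in>C. f v c - g c = 0"
      using f(1)[of v] f(2)[of v] that
      by (intro gen_eig_independent[OF T C(1)])
        (auto intro!: subspace_diff subspace_gen_eig T simp: sum_subtractf)
    then show ?thesis using that(3) by simp
  qed
  let ?D = "\<lambda>v. \<Sum>c\<in>C. scl c (f v c)"
  show ?thesis
  proof (rule that[of ?D])
    show "endo ?D"
    proof (rule endoI)
      fix v w
      have "f (v + w) c = f v c + f w c" if "c \<in> C" for c
        using f(1) f(2)[of v] f(2)[of w] that
        by (intro unique) (auto intro!: subspace_add subspace_gen_eig T simp: sum.distrib)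
      then show "?D (v + w) = ?D v + ?D w"
        by (simp add: scale_right_distrib sum.distrib)
    next
      fix a v
      have "f (scl a v) c = scl a (f v c)" if "c \<in> C" for c
        using f(1) f(2)[of v] that
        by (intro unique) (auto intro!: subspace_scale subspace_gen_eig T simp flip: scale_sum_right)
      then show "?D (scl a v) = scl a (?D v)"
        by (simp add: scale_sum_right mult.commute)
    qed
  next
    fix d v assume v: "v \<in> gen_eig T d"
    show "?D v = scl d v"
    proof (cases "d \<in> C")
      case True
      have "f v c = (if c = d then v else 0)" if "c \<in> C" for c
        using that v True C(1) subspace_0[OF subspace_gen_eig[OF T]] by (intro unique) auto
      then have "?D v = (\<Sum>c\<in>C. if c = d then scl c v else 0)"
        by (intro sum.cong) auto
      then show ?thesis
        using True C(1) by simp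
    next
      case False
      then have v0: "v = 0" using v C(3) by blast
      have "f 0 c = 0" if "c \<in> C" for c
        using that subspace_0[OF subspace_gen_eig[OF T]] by (intro unique) auto
      then show ?thesis by (simp add: v0)
    qed
  qed
qed

end


section \<open>Engel's theorem\<close>

locale lie_algebra = fd_space scl for scl :: "'f::field \<Rightarrow> 'v::ab_group_add \<Rightarrow> 'v" +
  fixes br :: "'v \<Rightarrow> 'v \<Rightarrow> 'v"
  assumes br_right: "Vector_Spaces.linear scl scl (br x)"
    and br_left: "Vector_Spaces.linear scl scl (\<lambda>x. br x y)"
    and br_self: "br x x = 0"
    and jacobi: "br x (br y z) = br (br x y) z + br y (br x z)"
begin

lemma br_anti: "br x y = - br y x"
proof -
  have "br (x + y) (x + y) = 0" by (rule br_self)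
  then have "br x y + br y x = 0"
    using br_self[of x] br_self[of y] by (simp add: endo_add[OF br_right] endo_add[OF br_left] add.commute)
  then show ?thesis by (simp add: eq_neg_iff_add_eq_0)
qed

definition lie_rep :: "('v \<Rightarrow> 'v \<Rightarrow> 'v) \<Rightarrow> bool" where
  "lie_rep act \<longleftrightarrow> (\<forall>x. endo (act x)) \<and> (\<forall>w. endo (\<lambda>x. act x w)) \<and>
     (\<forall>x y w. act x (act y w) = act (br x y) w + act y (act x w))"

lemma lie_rep_br: "lie_rep br"
  unfolding lie_rep_def using br_right br_left jacobi by blast

definition subalgebra :: "'v set \<Rightarrow> bool" where
  "subalgebra h \<longleftrightarrow> subspace h \<and> (\<forall>x\<in>h. \<forall>y\<in>h. br x y \<in> h)"

text \<open>Engel's theorem as a property of \<open>h\<close>, so that it can be inherited along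
  growing subalgebras. The pair \<open>U \<subset> W\<close> expresses a common null vector in
  \<open>W/U\<close> without quotient spaces. Representations act on the underlying space of the
  algebra itself, as \<open>br\<close> and \<open>mul\<close> do.\<close>

definition engel :: "'v set \<Rightarrow> bool" where
  "engel h \<longleftrightarrow> (\<forall>act U W. lie_rep act \<longrightarrow> subspace U \<longrightarrow> subspace W \<longrightarrow> U \<subset> W \<longrightarrow>
     (\<forall>y\<in>h. act y ` U \<subseteq> U \<and> act y ` W \<subseteq> W \<and> W \<subseteq> null_part (act y)) \<longrightarrow>
     (\<exists>w\<in>W - U. \<forall>y\<in>h. act y w \<in> U))"

lemma engelD:
  assumes "engel h" "lie_rep act" "subspace U" "subspace W" "U \<subset> W"
    and "\<And>y u. y \<in> h \<Longrightarrow> u \<in> U \<Longrightarrow> act y u \<in> U" "\<And>y w. y \<in> h \<Longrightarrow> w \<in> W \<Longrightarrow> act y w \<in> W"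
    and "\<And>y w. y \<in> h \<Longrightarrow> w \<in> W \<Longrightarrow> w \<in> null_part (act y)"
  shows "\<exists>w\<in>W - U. \<forall>y\<in>h. act y w \<in> U"
  using assms unfolding engel_def by (metis image_subsetI subsetI)

text \<open>The witness is the last vector outside \<open>U\<close> on the orbit of \<open>w\<close>
  under \<open>T\<close>.\<close>

lemma null_part_last:
  assumes "w \<in> null_part T" "w \<in> X" "w \<notin> U" "0 \<in> U" "\<And>x. x \<in> X \<Longrightarrow> T x \<in> X"
  shows "\<exists>w'\<in>X - U. T w' \<in> U"
  using assms(1-3)
proof (induction w rule: null_part_induct)
  case zero
  then show ?case using assms(4) by simp
next
  case (step w)
  then show ?case using assms(5) by (cases "T w \<in> U") auto
qed

text \<open>Inductive step of Engel's theorem. The vectors that \<open>m\<close> sends into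
  \<open>U\<close> are stable under \<open>z\<close> because \<open>br y z\<close> stays in
  \<open>m\<close>; \<open>z\<close> is nilpotent on them, so the last one outside \<open>U\<close>
  on a \<open>z\<close>-orbit is sent into \<open>U\<close> by \<open>z\<close> as well.\<close>

lemma engel_extend:
  assumes m: "subalgebra m" "engel m" and z: "\<And>y. y \<in> m \<Longrightarrow> br y z \<in> m"
  shows "subalgebra (span (insert z m)) \<and> engel (span (insert z m))"
proof
  let ?m = "span (insert z m)"
  have sm: "subspace m" "\<And>x y. x \<in> m \<Longrightarrow> y \<in> m \<Longrightarrow> br x y \<in> m"
    using m(1) by (auto simp: subalgebra_def)
  have split: "\<exists>k. x - scl k z \<in> m" if "x \<in> ?m" for x
    using that sm(1) span_breakdown_eq[of x z m] span_eq_iff[of m] by metis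
  show "subalgebra ?m"
    unfolding subalgebra_def
  proof (intro conjI ballI)
    fix x y assume "x \<in> ?m" "y \<in> ?m"
    then obtain k l where k: "x - scl k z \<in> m" and l: "y - scl l z \<in> m"
      using split by blast
    have "br x y = br (x - scl k z) (y - scl l z) + scl l (br (x - scl k z) z)
        - scl k (br (y - scl l z) z)"
      using br_anti[of z y]
      by (simp add: endo_diff[OF br_left] endo_diff[OF br_right] endo_scale[OF br_left]
          endo_scale[OF br_right] br_self scale_right_diff_distrib)
    also have "\<dots> \<in> m"
      using k l z sm by (intro subspace_add subspace_diff subspace_scale) auto
    also have "m \<subseteq> ?m"
      using span_superset[of "insert z m"] by auto
    finally show "br x y \<in> ?m" .
  qed simp
  show "engel ?m"
    unfolding engel_def
  proof (intro allI impI)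
    fix act U W
    assume rep: "lie_rep act" and UW: "subspace U" "subspace W" "U \<subset> W"
      and inv: "\<forall>y\<in>?m. act y ` U \<subseteq> U \<and> act y ` W \<subseteq> W \<and> W \<subseteq> null_part (act y)"
    have mm: "m \<subseteq> ?m" "z \<in> ?m"
      using span_superset[of "insert z m"] by auto
    have act: "endo (act x)" "endo (\<lambda>x. act x w)"
      "act x (act y w) = act (br x y) w + act y (act x w)" for x y w
      using rep unfolding lie_rep_def by blast+
    have invU: "act y u \<in> U" if "y \<in> ?m" "u \<in> U" for y u
      using inv that by blast
    have invW: "act y w \<in> W" "w \<in> null_part (act y)" if "y \<in> ?m" "w \<in> W" for y w
      using inv that by blast+
    define X where "X = {w \<in> W. \<forall>y\<in>m. act y w \<in> U}"
    have "\<exists>w\<in>W - U. \<forall>y\<in>m. act y w \<in> U"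
      using invU invW mm(1) by (intro engelD[OF m(2) rep UW]) (meson subsetD)+
    then obtain w where w: "w \<in> X" "w \<notin> U" by (auto simp: X_def)
    have X: "act z x \<in> X" if x: "x \<in> X" for x
      unfolding X_def
    proof (intro CollectI conjI ballI)
      show "act z x \<in> W" using x invW(1)[OF mm(2)] by (auto simp: X_def)
      fix y assume y: "y \<in> m"
      have "act (br y z) x \<in> U" "act z (act y x) \<in> U"
        using x y z[OF y] invU[OF mm(2)] by (auto simp: X_def)
      then show "act y (act z x) \<in> U"
        unfolding act(3)[of y z x] using UW(1) by (simp add: subspace_add)
    qed
    have "w \<in> null_part (act z)" using w invW(2)[OF mm(2)] by (auto simp: X_def)
    then obtain w' where w': "w' \<in> X" "w' \<notin> U" "act z w' \<in> U"
      using null_part_last[of w "act z" X U] w X subspace_0[OF UW(1)] by blast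
    have "act y w' \<in> U" if "y \<in> ?m" for y
    proof -
      obtain k where k: "y - scl k z \<in> m" using split \<open>y \<in> ?m\<close> by blast
      have "act y w' = act (y - scl k z) w' + scl k (act z w')"
        by (simp add: endo_diff[OF act(2)] endo_scale[OF act(2)])
      also have "\<dots> \<in> U"
        using k w' UW(1) by (intro subspace_add subspace_scale) (auto simp: X_def)
      finally show ?thesis .
    qed
    then show "\<exists>w\<in>W - U. \<forall>y\<in>?m. act y w \<in> U"
      using w' by (auto simp: X_def)
  qed
qed

theorem engel_theorem:
  assumes h: "subalgebra h" and nil: "\<And>x y. x \<in> h \<Longrightarrow> y \<in> h \<Longrightarrow> y \<in> null_part (br x)"
  shows "engel h"
proof -
  let ?P = "\<lambda>m. m \<subseteq> h \<and> subalgebra m \<and> engel m"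
  have sh: "subspace h" using h by (simp add: subalgebra_def)
  have "subalgebra {0}"
    by (auto simp: subalgebra_def subspace_single_0 br_self)
  moreover have "engel {0}"
    unfolding engel_def
  proof (intro allI impI)
    fix act U W
    assume "lie_rep act" and U: "subspace U" "U \<subset> W"
    then have "act 0 w = 0" for w
      using endo_0[of "\<lambda>x. act x w"] unfolding lie_rep_def by blast
    then show "\<exists>w\<in>W - U. \<forall>y\<in>{0}. act y w \<in> U"
      using U subspace_0[of U] by auto
  qed
  ultimately have "?P {0}"
    using sh by (simp add: subspace_0)
  then obtain m where m: "?P m" and max: "\<And>m'. ?P m' \<Longrightarrow> m \<subseteq> m' \<Longrightarrow> m' = m"
    using maximal_subspace[of ?P "{0}"] by (auto simp: subalgebra_def)
  have "m = h"
  proof (rule ccontr)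
    assume "m \<noteq> h"
    then have "m \<subset> h" using m by blast
    \<comment> \<open>Engel for \<open>m\<close>, in the adjoint representation on \<open>h\<close>
      modulo \<open>m\<close>, gives an element that normalizes \<open>m\<close>; adjoining it
      contradicts maximality.\<close>
    then obtain z where z: "z \<in> h" "z \<notin> m" "\<And>y. y \<in> m \<Longrightarrow> br y z \<in> m"
      using engelD[of m br m h] m h sh nil lie_rep_br unfolding subalgebra_def
      by (metis DiffE subsetD)
    have "?P (span (insert z m))"
      using engel_extend[of m z] m z span_minimal[of "insert z m" h] sh by auto
    then have "span (insert z m) = m"
      using max span_superset[of "insert z m"] by auto
    then show False
      using z(2) span_base[of z "insert z m"] by auto
  qed
  then show ?thesis using m by simp
qed

text \<open>\<open>K n\<close> consists of the vectors killed by all words of length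
  \<open>n\<close>. This increasing chain stabilizes, and Engel would enlarge a stable member other
  than \<open>W\<close>. The uniform length controls products of different operators, for the lower
  central series and for powers of sums in \<open>null_part_cx\<close>.\<close>

lemma engel_words:
  assumes h: "engel h" and rep: "lie_rep act" and W: "subspace W"
    and inv: "\<And>y w. y \<in> h \<Longrightarrow> w \<in> W \<Longrightarrow> act y w \<in> W"
    and nil: "\<And>y w. y \<in> h \<Longrightarrow> w \<in> W \<Longrightarrow> w \<in> null_part (act y)"
  shows "\<exists>N. \<forall>w\<in>W. \<forall>ys. length ys = N \<and> set ys \<subseteq> h \<longrightarrow> foldr act ys w = 0"
proof -
  define K where "K n = {w \<in> W. \<forall>ys. length ys = n \<and> set ys \<subseteq> h \<longrightarrow> foldr act ys w = 0}" for n
  have act: "endo (act x)" for x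
    using rep unfolding lie_rep_def by blast
  have word: "endo (foldr act ys)" for ys
    by (rule endoI; induction ys) (auto simp: endo_add[OF act] endo_scale[OF act])
  have sub: "subspace (K n)" for n
    unfolding K_def using W
    by (intro subspaceI)
      (auto simp: endo_0[OF word] endo_add[OF word] endo_scale[OF word] subspace_0 subspace_add subspace_scale)
  have mono: "K n \<subseteq> K (Suc n)" for n
    by (auto simp: K_def length_Suc_conv endo_0[OF act])
  have up: "w \<in> K (Suc n)" if "w \<in> W" "\<And>y. y \<in> h \<Longrightarrow> act y w \<in> K n" for w n
    unfolding K_def
  proof (intro CollectI conjI allI impI)
    fix ys assume "length ys = Suc n \<and> set ys \<subseteq> h"
    moreover then obtain zs y where "ys = zs @ [y]"
      by (metis append_butlast_last_id length_0_conv nat.distinct(1))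
    ultimately show "foldr act ys w = 0"
      using that(2)[of y] by (auto simp: K_def)
  qed fact
  have down: "act y w \<in> K n" if "w \<in> K n" "y \<in> h" for w y n
  proof -
    have "w \<in> K (Suc n)" using that mono by blast
    then have "foldr act (ys @ [y]) w = 0" if "length ys = n" "set ys \<subseteq> h" for ys
      using that \<open>y \<in> h\<close> unfolding K_def by (metis (mono_tags, lifting) CollectD length_append_singleton
          insert_subset list.simps(15) rotate1.simps(2) set_rotate1)
    then show ?thesis
      using that inv by (auto simp: K_def)
  qed
  obtain S where S: "\<exists>n. S = K n" "\<And>S'. \<exists>n. S' = K n \<Longrightarrow> S \<subseteq> S' \<Longrightarrow> S' = S"
    using maximal_subspace[of "\<lambda>S. \<exists>n. S = K n" "K 0"] sub by blast
  then obtain n where n: "S = K n" by blast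
  have stable: "K (Suc n) = K n"
    using S n mono by blast
  have "K n = W"
  proof (rule ccontr)
    assume "K n \<noteq> W"
    then have "K n \<subset> W" by (auto simp: K_def)
    then obtain w where "w \<in> W - K n" "\<forall>y\<in>h. act y w \<in> K n"
      using engelD[OF h rep sub W _ down inv nil] by blast
    then show False using up[of w n] stable by blast
  qed
  then show ?thesis unfolding K_def by blast
qed

lemma lower_central_trivial:
  assumes h: "subalgebra h" and nil: "\<And>x y. x \<in> h \<Longrightarrow> y \<in> h \<Longrightarrow> y \<in> null_part (br x)"
  shows "\<exists>n. lower_central scl br h n = {0}"
proof -
  have sh: "subspace h" and cl: "\<And>x y. x \<in> h \<Longrightarrow> y \<in> h \<Longrightarrow> br x y \<in> h"
    using h by (auto simp: subalgebra_def)
  obtain N where N: "\<And>w ys. w \<in> h \<Longrightarrow> length ys = N \<Longrightarrow> set ys \<subseteq> h \<Longrightarrow> foldr br ys w = 0"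
    using engel_words[OF engel_theorem[OF h nil] lie_rep_br sh cl nil] by blast
  have word: "endo (foldr br ys)" for ys
    by (rule endoI; induction ys) (auto simp: endo_add[OF br_right] endo_scale[OF br_right])
  \<comment> \<open>Word length and index in the series add up to \<open>N\<close>; at
    \<open>i = N\<close> only the empty word is left, and it kills nothing but 0.\<close>
  have "lower_central scl br h i \<subseteq> {w. \<forall>ys. length ys + i = N \<and> set ys \<subseteq> h \<longrightarrow> foldr br ys w = 0}" for i
  proof (induction i)
    case 0
    then show ?case using N by auto
  next
    case (Suc i)
    let ?R = "{w. \<forall>ys. length ys + Suc i = N \<and> set ys \<subseteq> h \<longrightarrow> foldr br ys w = 0}"
    have "subspace ?R"
      by (intro subspaceI) (auto simp: endo_0[OF word] endo_add[OF word] endo_scale[OF word])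
    moreover have "br x y \<in> ?R" if "x \<in> h" "y \<in> lower_central scl br h i" for x y
    proof (intro CollectI allI impI)
      fix ys assume ys: "length ys + Suc i = N \<and> set ys \<subseteq> h"
      have "\<forall>zs. length zs + i = N \<and> set zs \<subseteq> h \<longrightarrow> foldr br zs y = 0"
        using Suc.IH that(2) by blast
      then have "foldr br (ys @ [x]) y = 0"
        by (rule allE[of _ "ys @ [x]"]) (use ys that(1) in auto)
      then show "foldr br ys (br x y) = 0" by simp
    qed
    ultimately show ?case
      unfolding lower_central.simps by (intro span_minimal) blast+
  qed
  then have "\<forall>w\<in>lower_central scl br h N. foldr br [] w = 0"
    by fastforce
  then have "lower_central scl br h N \<subseteq> {0}"
    by auto
  moreover have "0 \<in> lower_central scl br h N"
    by (cases N) (auto simp: span_zero subspace_0[OF sh])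
  ultimately show ?thesis by blast
qed

lemma lower_central_null:
  assumes "lower_central scl br h n = {0}" "x \<in> h" "y \<in> h"
  shows "y \<in> null_part (br x)"
proof -
  have "(br x ^^ i) y \<in> lower_central scl br h i" for i
    by (induction i) (use assms in \<open>auto intro!: span_base\<close>)
  then show ?thesis using assms(1) null_partI by blast
qed

end


section \<open>Weight spaces of representations and Cartan subalgebras\<close>

context lie_algebra
begin

lemma lie_rep_endo:
  assumes "lie_rep act"
  shows "endo (act x)" "endo (\<lambda>x. act x w)"
  using assms unfolding lie_rep_def by blast+

text \<open>Leibniz rule: \<open>x - (a + b)\<close> acts on \<open>act u v\<close> as
  \<open>br x - a\<close> on \<open>u\<close> plus \<open>x - b\<close> on \<open>v\<close>. Every
  later claim that weights add comes from here.\<close>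

lemma lie_rep_gen_eig:
  assumes rep: "lie_rep act" and u: "u \<in> gen_eig (br x) a" and v: "v \<in> gen_eig (act x) b"
  shows "act u v \<in> gen_eig (act x) (a + b)"
  unfolding gen_eig_def
proof (rule null_part_leibniz[where \<beta> = act and A = "\<lambda>u. br x u - scl a u" and B = "\<lambda>v. act x v - scl b v"])
  note E = lie_rep_endo[OF rep]
  have jac: "act x (act u v) = act (br x u) v + act u (act x v)" for u v
    using rep unfolding lie_rep_def by blast
  show "act x (act u v) - scl (a + b) (act u v)
      = act (br x u - scl a u) v + act u (act x v - scl b v)" for u v
    unfolding jac[of u v]
    by (simp add: endo_diff[OF E(1)] endo_diff[OF E(2)] endo_scale[OF E(1)] endo_scale[OF E(2)]
        scale_left_distrib)
  show "act 0 v = 0" "act u 0 = 0" for u v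
    using endo_0[OF E(1)] endo_0[OF E(2)] by auto
  show "act x (v + w) - scl (a + b) (v + w) = act x v - scl (a + b) v + (act x w - scl (a + b) w)" for v w
    by (simp add: endo_add[OF E(1)] scale_right_distrib)
  show "u \<in> null_part (\<lambda>u. br x u - scl a u)" "v \<in> null_part (\<lambda>v. act x v - scl b v)"
    using u v by (simp_all add: gen_eig_def)
qed

lemma lie_rep_null_part:
  assumes "lie_rep act" "u \<in> null_part (br x)" "v \<in> null_part (act x)"
  shows "act u v \<in> null_part (act x)"
  using lie_rep_gen_eig[of act u x 0 v 0] assms by (simp add: gen_eig_0)

lemma cartanD:
  assumes "cartan_subalgebra scl br h"
  shows "subalgebra h" "subspace h" "\<And>x y. x \<in> h \<Longrightarrow> y \<in> h \<Longrightarrow> br x y \<in> h"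
    "\<And>x y. x \<in> h \<Longrightarrow> y \<in> h \<Longrightarrow> y \<in> null_part (br x)"
    "\<And>x. (\<And>y. y \<in> h \<Longrightarrow> br x y \<in> h) \<Longrightarrow> x \<in> h"
proof -
  obtain n where "lower_central scl br h n = {0}"
    using assms unfolding cartan_subalgebra_def by blast
  then show "\<And>x y. x \<in> h \<Longrightarrow> y \<in> h \<Longrightarrow> y \<in> null_part (br x)"
    using lower_central_null by blast
qed (use assms in \<open>auto simp: cartan_subalgebra_def subalgebra_def\<close>)

text \<open>Otherwise Engel, applied to the zero root space of \<open>h\<close> modulo
  \<open>h\<close>, gives an element outside \<open>h\<close> that normalizes
  \<open>h\<close>.\<close>

lemma cartan_null_part:
  assumes h: "cartan_subalgebra scl br h" and v: "\<And>x. x \<in> h \<Longrightarrow> v \<in> null_part (br x)"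
  shows "v \<in> h"
proof (rule ccontr)
  assume "v \<notin> h"
  note c = cartanD[OF h]
  let ?W = "\<Inter>x\<in>h. null_part (br x)"
  have W: "subspace ?W"
    by (intro subspace_Inter) (auto intro: subspace_null_part br_right)
  have sub: "h \<subset> ?W" using c(4) v \<open>v \<notin> h\<close> by blast
  have "\<exists>w\<in>?W - h. \<forall>y\<in>h. br y w \<in> h"
  proof (rule engelD[OF engel_theorem[OF c(1,4)] lie_rep_br c(2) W sub])
    fix y w assume yw: "y \<in> h" "w \<in> ?W"
    show "br y w \<in> ?W"
    proof
      fix x assume "x \<in> h"
      then show "br y w \<in> null_part (br x)"
        using lie_rep_null_part[OF lie_rep_br c(4)[of x y], of w] yw by blast
    qed
    show "w \<in> null_part (br y)" using yw by blast
  qed (use c(3) in auto)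
  then obtain w where w: "w \<notin> h" "\<And>y. y \<in> h \<Longrightarrow> br y w \<in> h" by blast
  have "br w y \<in> h" if "y \<in> h" for y
    using br_anti[of w y] subspace_neg[OF c(2) w(2)[OF that]] by simp
  then show False using c(5) w(1) by blast
qed

text \<open>Self-normalization: \<open>x\<close> itself lies in \<open>h\<close>, so if
  \<open>z\<close> normalizes \<open>h\<close>, then \<open>br x z\<close> is in the null part of
  \<open>br x\<close>, and hence so is \<open>z\<close>.\<close>

lemma cartan_null_partI:
  assumes h: "h = null_part (br x)" and nil: "\<And>y z. y \<in> h \<Longrightarrow> z \<in> h \<Longrightarrow> z \<in> null_part (br y)"
  shows "cartan_subalgebra scl br h"
proof -
  have sub: "subspace h"
    unfolding h by (intro subspace_null_part br_right)
  have cl: "br y z \<in> h" if "y \<in> h" "z \<in> h" for y z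
    using lie_rep_null_part[OF lie_rep_br] that unfolding h by blast
  have alg: "subalgebra h" using sub cl by (simp add: subalgebra_def)
  have "x \<in> h"
    unfolding h using null_partI[of 1 "br x" x] by (simp add: br_self)
  then have "z \<in> h" if "\<forall>y\<in>h. br z y \<in> h" for z
  proof -
    have "br x z \<in> h"
      unfolding br_anti[of x z] using that \<open>x \<in> h\<close> by (intro subspace_neg[OF sub]) blast
    then show ?thesis
      unfolding h by (rule null_part_back)
  qed
  then have "{z. \<forall>y\<in>h. br z y \<in> h} = h"
    using cl by blast
  then show ?thesis
    unfolding cartan_subalgebra_def using sub cl lower_central_trivial[OF alg nil]
    by (intro conjI ballI)
qed

end


section \<open>Left-symmetric algebras\<close>

sublocale left_symmetric_algebra \<subseteq> fd_space scl
  by unfold_locales (rule finite_dimensional)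

context left_symmetric_algebra
begin

abbreviation "br \<equiv> lie_bracket mul"

lemma mul_diff_left: "mul (x - y) z = mul x z - mul y z"
  using endo_diff[OF linear_left] .

lemma mul_add_left: "mul (x + y) z = mul x z + mul y z"
  using endo_add[OF linear_left] .

lemma mul_scale_left: "mul (scl c x) z = scl c (mul x z)"
  using endo_scale[OF linear_left] .

lemma mul_sum_left: "mul (sum f I) z = (\<Sum>i\<in>I. mul (f i) z)"
  using endo_sum[OF linear_left] .

lemmas mul_diff_right = endo_diff[OF linear_right]
  and mul_add_right = endo_add[OF linear_right]
  and mul_scale_right = endo_scale[OF linear_right]

lemma mul_commute_br: "mul x (mul y z) = mul (br x y) z + mul y (mul x z)"
  using left_symmetric[of x y z] by (simp add: lie_bracket_def mul_diff_left algebra_simps)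

lemma br_jacobi: "br x (br y z) = br (br x y) z + br y (br x z)"
proof -
  have e: "mul x (mul y z) = mul y (mul x z) + mul (mul x y) z - mul (mul y x) z"
    "mul y (mul z x) = mul z (mul y x) + mul (mul y z) x - mul (mul z y) x"
    "mul z (mul x y) = mul x (mul z y) + mul (mul z x) y - mul (mul x z) y"
    using left_symmetric[of x y z] left_symmetric[of y z x] left_symmetric[of z x y]
    by (simp_all add: algebra_simps)
  show ?thesis
    unfolding lie_bracket_def mul_diff_left mul_diff_right e by (simp add: algebra_simps)
qed

end

sublocale left_symmetric_algebra \<subseteq> lie_algebra scl "lie_bracket mul"
proof (intro lie_algebra.intro lie_algebra_axioms.intro)
  show "endo (br x)" for x
    by (auto intro!: endoI simp: lie_bracket_def mul_add_left mul_add_right mul_scale_left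
        mul_scale_right scale_right_diff_distrib)
  show "endo (\<lambda>x. br x y)" for y
    by (auto intro!: endoI simp: lie_bracket_def mul_add_left mul_add_right mul_scale_left
        mul_scale_right scale_right_diff_distrib)
  show "br x (br y z) = br (br x y) z + br y (br x z)" for x y z
    by (rule br_jacobi)
qed (simp_all add: lie_bracket_def fd_space_axioms)

context left_symmetric_algebra
begin

lemma lie_rep_mul: "lie_rep mul"
  unfolding lie_rep_def using linear_left linear_right mul_commute_br by blast

text \<open>In the affine representation \<open>x \<mapsto> F\<^sub>x\<close> the condition \<open>x \<in> null_part (mul x)\<close> says that the origin
  has generalized weight \<open>0\<close> under \<open>x\<close>.\<close>

lemma gen_eig_br_subset:
  assumes x: "x \<in> null_part (mul x)"
  shows "gen_eig (br x) c \<subseteq> gen_eig (mul x) c"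
proof
  fix u assume "u \<in> gen_eig (br x) c"
  with br_right show "u \<in> gen_eig (mul x) c"
  proof (induction u rule: gen_eig_induct)
    case zero
    show ?case by (intro subspace_0 subspace_gen_eig linear_right)
  next
    case (step u)
    \<comment> \<open>\<open>mul x u\<close> is \<open>br x u + mul u x\<close>, and the assumption
      on \<open>x\<close> gives the extra term the weight \<open>c + 0\<close>.\<close>
    have "mul u x \<in> gen_eig (mul x) (c + 0)"
      using step.hyps(1) x by (intro lie_rep_gen_eig[OF lie_rep_mul]) (auto simp: gen_eig_0)
    then have "(br x u - scl c u) + mul u x \<in> gen_eig (mul x) c"
      using step.IH by (intro subspace_add subspace_gen_eig linear_right) auto
    then have "mul x u - scl c u \<in> gen_eig (mul x) c"
      by (simp add: lie_bracket_def algebra_simps)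
    then show ?case
      unfolding gen_eig_def by (rule null_part_back)
  qed
qed

definition derivation :: "('v \<Rightarrow> 'v) \<Rightarrow> bool" where
  "derivation D \<longleftrightarrow> endo D \<and> (\<forall>u v. D (mul u v) = mul (D u) v + mul u (D v))"

end


section \<open>Uniqueness over the complex numbers\<close>

locale complex_lsa = left_symmetric_algebra scl mul
  for scl :: "complex \<Rightarrow> 'v::ab_group_add \<Rightarrow> 'v" and mul

sublocale complex_lsa \<subseteq> complex_space scl ..

context complex_lsa
begin

text \<open>Over the complex numbers the spaces for \<open>br x\<close> already add up to
  everything, while those for \<open>mul x\<close> are independent; this leaves no room in the
  inclusion.\<close>

lemma gen_eig_br_eq:
  assumes x: "x \<in> null_part (mul x)"
  shows "gen_eig (br x) c = gen_eig (mul x) c"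
proof
  show "gen_eig (br x) c \<subseteq> gen_eig (mul x) c"
    using x by (rule gen_eig_br_subset)
  show "gen_eig (mul x) c \<subseteq> gen_eig (br x) c"
  proof
    fix v assume v: "v \<in> gen_eig (mul x) c"
    obtain C where C: "finite C" "\<And>v. \<exists>f. (\<forall>c\<in>C. f c \<in> gen_eig (br x) c) \<and> v = (\<Sum>c\<in>C. f c)"
        "\<And>c. c \<notin> C \<Longrightarrow> gen_eig (br x) c = {0}"
      using eigenvalues[OF br_right[of x]] by blast
    obtain f where f: "\<forall>c\<in>C. f c \<in> gen_eig (br x) c" "v = (\<Sum>c\<in>C. f c)"
      using C(2) by blast
    define g where "g d = (if d \<in> C then f d else 0) - (if d = c then v else 0)" for d
    have "g d \<in> gen_eig (mul x) d" for d
      using f(1) v gen_eig_br_subset[OF x, of d] subspace_0[OF subspace_gen_eig[OF linear_right]]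
      unfolding g_def by (intro subspace_diff subspace_gen_eig linear_right) auto
    moreover have "(\<Sum>d\<in>insert c C. g d) = 0"
      using C(1) f(2) by (auto simp: g_def sum_subtractf sum.insert_if insert_absorb intro!: sum.cong)
    ultimately have "\<forall>d\<in>insert c C. g d = 0"
      using C(1) by (intro gen_eig_independent[OF linear_right]) auto
    then have "v = (if c \<in> C then f c else 0)" by (simp add: g_def)
    then show "v \<in> gen_eig (br x) c"
      using f(1) subspace_0[OF subspace_gen_eig[OF br_right]] by auto
  qed
qed

text \<open>The commutator of \<open>mul x\<close> with \<open>D\<close> is multiplication by
  \<open>- D x\<close>, so the point is to show that \<open>D x\<close> has weight 0 under
  \<open>br x\<close>.\<close>

lemma derivation_weights:
  assumes D: "derivation D" and x: "x \<in> null_part (mul x)"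
  shows "v \<in> gen_eig (mul x) c \<Longrightarrow> D v \<in> gen_eig (mul x) c"
proof -
  have eD: "endo D" and leib: "D (mul u v) = mul (D u) v + mul u (D v)" for u v
    using D by (auto simp: derivation_def)
  \<comment> \<open>An operator whose commutator with \<open>mul x\<close> is multiplication by an
    element of weight 0, up to sign, preserves the weight spaces.\<close>
  have perturb: "E v \<in> gen_eig (mul x) c"
    if E: "endo E" and z: "z \<in> null_part (br x)" "\<And>v. mul x (E v) = E (mul x v) - mul z v"
      and v: "v \<in> gen_eig (mul x) c" for E z v c
    using linear_right v
  proof (induction v rule: gen_eig_induct)
    case zero
    then show ?case using endo_0[OF E] subspace_0[OF subspace_gen_eig[OF linear_right]] by simp
  next
    case (step v)
    have "mul z v \<in> gen_eig (mul x) (0 + c)"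
      using step.hyps(1) z(1) by (intro lie_rep_gen_eig[OF lie_rep_mul]) (auto simp: gen_eig_0)
    then have "E (mul x v - scl c v) - mul z v \<in> gen_eig (mul x) c"
      using step.IH by (intro subspace_diff subspace_gen_eig linear_right) auto
    then have "mul x (E v) - scl c (E v) \<in> gen_eig (mul x) c"
      by (simp add: z(2) endo_diff[OF E] endo_scale[OF E] algebra_simps)
    then show ?case
      unfolding gen_eig_def by (rule null_part_back)
  qed
  \<comment> \<open>\<open>D x\<close> is split into a part \<open>z\<close> of weight 0 and parts
    of nonzero weight. The latter lie in the range of \<open>br x\<close>; \<open>w\<close> is a
    preimage, again built from nonzero weights.\<close>
  have "D x \<in> span (\<Union>c. UNIV \<inter> gen_eig (br x) c)"
    by (rule gen_eig_span[OF br_right]) auto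
  then obtain I f where I: "finite I" "\<forall>c\<in>I. f c \<in> gen_eig (br x) c" "D x = (\<Sum>c\<in>I. f c)"
    using span_UN_sum[of "D x" "gen_eig (br x)" UNIV] subspace_gen_eig[OF br_right] by auto
  have "\<forall>c\<in>I - {0}. \<exists>w\<in>UNIV \<inter> gen_eig (br x) c. br x w - scl 0 w = f c"
    using I(2) gen_eig_solve[OF br_right subspace_UNIV, of x "f _" _ 0] by auto
  then obtain g where g: "\<And>c. c \<in> I - {0} \<Longrightarrow> g c \<in> gen_eig (br x) c \<and> br x (g c) = f c"
    by (metis IntE scale_zero_left diff_zero)
  define w where "w = (\<Sum>c\<in>I - {0}. g c)"
  define z where "z = (if 0 \<in> I then f 0 else 0)"
  have z: "z \<in> null_part (br x)"
    using I(2) subspace_0[OF subspace_gen_eig[OF br_right]] by (auto simp: z_def simp flip: gen_eig_0)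
  have brw: "br x w = (\<Sum>c\<in>I - {0}. f c)"
    unfolding w_def endo_sum[OF br_right] using g by (intro sum.cong) auto
  then have Dx: "D x = z + br x w"
    using I(1,3) by (simp add: z_def sum_diff1)
  text \<open>The correction \<open>D + L(w)\<close> commutes with \<open>L(x)\<close> up to an operator of weight \<open>0\<close>, so it
    preserves \<open>null_part (mul x)\<close>; this forces \<open>w = 0\<close>.\<close>
  let ?E = "\<lambda>v. D v + mul w v"
  have E: "endo ?E"
    by (rule endoI) (auto simp: endo_add[OF eD] endo_scale[OF eD] mul_add_right mul_scale_right
        scale_right_distrib)
  have "mul x (?E v) = ?E (mul x v) - mul z v" for v
    using mul_commute_br[of x w v]
    by (simp add: leib Dx mul_add_left mul_add_right algebra_simps)
  then have "?E x \<in> gen_eig (mul x) 0"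
    using perturb[OF E z, of x 0] x by (simp add: gen_eig_0)
  moreover have "?E x = z + mul x w"
    by (simp add: Dx lie_bracket_def)
  moreover have "z \<in> gen_eig (mul x) 0"
    using z gen_eig_br_subset[OF x, of 0] by (auto simp: gen_eig_0)
  ultimately have "(z + mul x w) - z \<in> gen_eig (mul x) 0"
    by (metis subspace_diff subspace_gen_eig linear_right)
  then have w0: "w \<in> gen_eig (mul x) 0"
    unfolding gen_eig_0 by (auto intro: null_part_back)
  \<comment> \<open>\<open>w\<close> has weight 0 but is also a sum of vectors of nonzero weight;
    \<open>g'\<close> writes this as one vanishing sum.\<close>
  define g' where "g' c = (if c = 0 then - w else g c)" for c
  have "\<forall>c\<in>insert 0 (I - {0}). g' c = 0"
  proof (rule gen_eig_independent[OF linear_right])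
    show "g' c \<in> gen_eig (mul x) c" if "c \<in> insert 0 (I - {0})" for c
      using that g w0 gen_eig_br_subset[OF x, of c] subspace_neg[OF subspace_gen_eig[OF linear_right]]
      by (auto simp: g'_def)
    have "(\<Sum>c\<in>I - {0}. g' c) = w"
      unfolding w_def by (intro sum.cong) (auto simp: g'_def)
    then show "(\<Sum>c\<in>insert 0 (I - {0}). g' c) = 0"
      using I(1) by (subst sum.insert) (auto simp: g'_def)
  qed (use I(1) in simp)
  then have "w = 0" by (simp add: g'_def)
  then have "D x = z" using Dx endo_0[OF br_right] by simp
  then have "mul x (D v) = D (mul x v) - mul z v" for v
    by (simp add: leib)
  then show "v \<in> gen_eig (mul x) c \<Longrightarrow> D v \<in> gen_eig (mul x) c"
    using perturb[OF eD z] by blast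
qed

text \<open>On weight vectors the Leibniz rule for \<open>D\<close> says that weights add under the
  product. They do because \<open>br y\<close>, which governs the left factor, has the same weight
  spaces as \<open>mul y\<close>.\<close>

lemma semisimple_part_derivation:
  assumes y: "y \<in> null_part (mul y)" and D: "endo D"
    "\<And>c v. v \<in> gen_eig (mul y) c \<Longrightarrow> D v = scl c v"
  shows "derivation D"
proof -
  let ?V = "\<lambda>u. {v. D (mul u v) = mul (D u) v + mul u (D v)}"
  have V: "subspace (?V u)" for u
    by (rule subspaceI) (auto simp: endo_0[OF D(1)] endo_add[OF D(1)] endo_scale[OF D(1)]
        endo_0[OF linear_right] mul_add_right mul_scale_right scale_right_distrib)
  have U: "subspace {u. ?V u = UNIV}"
    by (rule subspaceI) (auto simp: set_eq_iff endo_0[OF D(1)] endo_add[OF D(1)] endo_scale[OF D(1)]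
        endo_0[OF linear_left] mul_add_left mul_scale_left scale_right_distrib)
  have "UNIV = span (\<Union>c. UNIV \<inter> gen_eig (mul y) c)"
    using gen_eig_span[OF linear_right[of y] subspace_UNIV] by auto
  then have all: "S = UNIV" if "subspace S" "\<And>c. gen_eig (mul y) c \<subseteq> S" for S
    using span_minimal[of "\<Union>c. UNIV \<inter> gen_eig (mul y) c" S] that by auto
  have uv: "v \<in> ?V u" if "u \<in> gen_eig (mul y) a" "v \<in> gen_eig (mul y) b" for u v a b
  proof -
    have "mul u v \<in> gen_eig (mul y) (a + b)"
      using that gen_eig_br_eq[OF y] by (intro lie_rep_gen_eig[OF lie_rep_mul]) auto
    then show ?thesis
      using that by (simp add: D(2) mul_scale_left mul_scale_right scale_left_distrib)
  qed
  have "?V u = UNIV" if "u \<in> gen_eig (mul y) a" for u a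
    by (rule all[OF V]) (use uv[OF that] in blast)
  then have "{u. ?V u = UNIV} = UNIV"
    by (intro all[OF U]) blast
  then show ?thesis
    unfolding derivation_def using D(1) by blast
qed

text \<open>Multiplication by \<open>z\<close> shifts the weights of \<open>mul y\<close> by
  \<open>b\<close>, and only finitely many weights are available.\<close>

lemma gen_eig_shift_nilpotent:
  assumes y: "y \<in> null_part (mul y)" and z: "z \<in> gen_eig (mul y) b" and b: "b \<noteq> 0"
  shows "v \<in> null_part (mul z)"
proof -
  obtain C where C: "finite C" "\<And>c. c \<notin> C \<Longrightarrow> gen_eig (mul y) c = {0}"
    using eigenvalues[OF linear_right[of y]] by metis
  have "gen_eig (mul y) a \<subseteq> null_part (mul z)" for a
  proof
    fix u assume u: "u \<in> gen_eig (mul y) a"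
    have pow: "(mul z ^^ j) u \<in> gen_eig (mul y) (a + of_nat j * b)" for j
    proof (induction j)
      case (Suc j)
      then have "mul z ((mul z ^^ j) u) \<in> gen_eig (mul y) (b + (a + of_nat j * b))"
        using z gen_eig_br_eq[OF y] by (intro lie_rep_gen_eig[OF lie_rep_mul]) auto
      then show ?case by (simp add: algebra_simps)
    qed (use u in simp)
    have "infinite (range (\<lambda>j::nat. a + of_nat j * b))"
      using b by (intro range_inj_infinite injI) simp
    then obtain j :: nat where "a + of_nat j * b \<notin> C"
      using C(1) by (metis finite_subset image_subsetI)
    then show "u \<in> null_part (mul z)"
      using pow[of j] C(2) null_partI by blast
  qed
  then have "span (\<Union>c. UNIV \<inter> gen_eig (mul y) c) \<subseteq> null_part (mul z)"
    by (intro span_minimal subspace_null_part linear_right) blast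
  then show ?thesis
    using gen_eig_span[OF linear_right[of y] subspace_UNIV, of v] by blast
qed

section \<open>Simultaneous root subspaces of left multiplications\<close>

lemma root_subspace_iff: "v \<in> root_subspace scl mul h l \<longleftrightarrow> (\<forall>x\<in>h. v \<in> gen_eig (mul x) (l x))"
  by (simp add: root_subspace_def gen_eig_def null_part_def)

lemma subspace_root: "subspace (root_subspace scl mul h l)"
proof -
  have "root_subspace scl mul h l = (\<Inter>x\<in>h. gen_eig (mul x) (l x))"
    by (auto simp: root_subspace_iff)
  then show ?thesis
    by (auto intro!: subspace_Inter subspace_gen_eig linear_right)
qed

text \<open>Only the values of a functional on \<open>h\<close> matter; fixing the others to be \<open>0\<close> makes distinct indices
  give independent root subspaces.\<close>

definition supported :: "'v set \<Rightarrow> ('v \<Rightarrow> complex) set" where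
  "supported h = {l. \<forall>x. x \<notin> h \<longrightarrow> l x = 0}"

text \<open>Induction on invariant subspaces \<open>U\<close>. If for some \<open>x\<close> in
  \<open>h\<close> no single generalized eigenspace contains \<open>U\<close>, these eigenspaces cut
  \<open>U\<close> into smaller pieces, invariant because \<open>h\<close> has weight 0 under
  \<open>br x\<close>. Otherwise the eigenvalues form the index \<open>l\<close>. It is found as a
  mere function; \<open>common_eigenvector\<close> later supplies its additivity.\<close>

lemma root_span:
  assumes nil: "\<And>x y. x \<in> h \<Longrightarrow> y \<in> h \<Longrightarrow> y \<in> null_part (br x)"
  shows "v \<in> span (\<Union>l\<in>supported h. root_subspace scl mul h l)"
proof -
  let ?R = "span (\<Union>l\<in>supported h. root_subspace scl mul h l)"
  have "(\<forall>x\<in>h. \<forall>u\<in>U. mul x u \<in> U) \<longrightarrow> U \<subseteq> ?R" if "subspace U" for U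
    using that
  proof (induction U rule: subspace_induct)
    case (less U)
    show ?case
    proof
      assume inv: "\<forall>x\<in>h. \<forall>u\<in>U. mul x u \<in> U"
      show "U \<subseteq> ?R"
      proof (cases "\<forall>x\<in>h. \<exists>c. U \<subseteq> gen_eig (mul x) c")
        case True
        then obtain l where l: "\<And>x. x \<in> h \<Longrightarrow> U \<subseteq> gen_eig (mul x) (l x)" by metis
        let ?l = "\<lambda>x. if x \<in> h then l x else 0"
        have "U \<subseteq> root_subspace scl mul h ?l"
          using l by (auto simp: root_subspace_iff subset_iff)
        moreover have "?l \<in> supported h" by (simp add: supported_def)
        ultimately show ?thesis
          using span_superset[of "\<Union>l\<in>supported h. root_subspace scl mul h l"] by blast
      next
        case False
        then obtain x where x: "x \<in> h" "\<And>c. \<not> U \<subseteq> gen_eig (mul x) c" by blast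
        have "U \<inter> gen_eig (mul x) c \<subseteq> ?R" for c
        proof -
          have "mul y u \<in> gen_eig (mul x) c" if "y \<in> h" "u \<in> gen_eig (mul x) c" for y u
            using lie_rep_gen_eig[OF lie_rep_mul, of y x 0 u c] that nil[OF x(1)]
            by (simp add: gen_eig_0)
          moreover have "U \<inter> gen_eig (mul x) c \<subset> U" using x(2) by blast
          ultimately show ?thesis
            using less.IH[of "U \<inter> gen_eig (mul x) c"] less.hyps inv
            by (simp add: subspace_inter subspace_gen_eig linear_right)
        qed
        then have "span (\<Union>c. U \<inter> gen_eig (mul x) c) \<subseteq> ?R"
          by (intro span_minimal) auto
        then show ?thesis
          using gen_eig_span[OF linear_right[of x] less.hyps] inv x(1) by blast
      qed
    qed
  qed
  then show ?thesis using subspace_UNIV by blast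
qed

lemma root_sum:
  assumes "\<And>x y. x \<in> h \<Longrightarrow> y \<in> h \<Longrightarrow> y \<in> null_part (br x)"
  obtains S f where "finite S" "S \<subseteq> supported h" "\<And>l. l \<in> S \<Longrightarrow> f l \<in> root_subspace scl mul h l"
    "v = (\<Sum>l\<in>S. f l)"
  using span_UN_sum[OF root_span[of h v, OF assms] subspace_root] by blast

text \<open>An \<open>x\<close> on which two indices differ groups the sum by eigenvalues of
  \<open>mul x\<close>; each group vanishes and has fewer terms.\<close>

lemma root_independent:
  assumes "finite S" "S \<subseteq> supported h" "\<And>l. l \<in> S \<Longrightarrow> f l \<in> root_subspace scl mul h l"
    and "(\<Sum>l\<in>S. f l) = 0"
  shows "\<forall>l\<in>S. f l = 0"
  using assms
proof (induction S rule: finite_psubset_induct)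
  case (psubset S)
  show ?case
  proof (cases "\<exists>l\<^sub>1\<in>S. \<exists>l\<^sub>2\<in>S. l\<^sub>1 \<noteq> l\<^sub>2")
    case False
    then show ?thesis
      using psubset.prems(3) psubset.hyps
      by (metis (no_types, lifting) is_singletonI' is_singleton_the_elem empty_iff singletonD sum.empty
          sum.insert finite.emptyI add.right_neutral)
  next
    case True
    then obtain l\<^sub>1 l\<^sub>2 x where l: "l\<^sub>1 \<in> S" "l\<^sub>2 \<in> S" "l\<^sub>1 x \<noteq> l\<^sub>2 x" by (metis ext)
    then have "l\<^sub>1 \<in> supported h" "l\<^sub>2 \<in> supported h"
      using psubset.prems(1) by blast+
    then have x: "x \<in> h"
      using l(3) by (cases "x \<in> h") (auto simp: supported_def)
    let ?F = "\<lambda>c. \<Sum>l\<in>{l\<in>S. l x = c}. f l"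
    have "\<forall>c\<in>(\<lambda>l. l x) ` S. ?F c = 0"
    proof (rule gen_eig_independent[OF linear_right])
      show "?F c \<in> gen_eig (mul x) c" for c
        using psubset.prems(2) x
        by (intro subspace_sum subspace_gen_eig linear_right) (auto simp: root_subspace_iff)
      show "(\<Sum>c\<in>(\<lambda>l. l x) ` S. ?F c) = 0"
        using psubset.prems(3) sum.image_gen[OF psubset.hyps, of f "\<lambda>l. l x"] by simp
    qed (use psubset.hyps in simp)
    then have F: "?F (k x) = 0" if "k \<in> S" for k using that by blast
    show ?thesis
    proof
      fix k assume k: "k \<in> S"
      have "{l\<in>S. l x = k x} \<noteq> S" using l by (metis (mono_tags, lifting) mem_Collect_eq)
      then have "\<forall>l\<in>{l\<in>S. l x = k x}. f l = 0"
        using F[OF k] psubset.prems by (intro psubset.IH) auto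
      then show "f k = 0" using k by simp
    qed
  qed
qed

text \<open>\<open>Z X = X Z - k\<close> and \<open>Z v = 0\<close> give
  \<open>Z (X^(j+1) v) = - (j + 1) k X^j v\<close>. With \<open>X^j v\<close> the last nonzero power
  this leaves \<open>(j + 1) k = 0\<close>, and the characteristic is 0.\<close>

lemma weyl_relation:
  assumes X: "endo X" "\<And>u. u \<in> U \<Longrightarrow> X u \<in> U" and Z: "endo Z"
    and rel: "\<And>u. u \<in> U \<Longrightarrow> Z (X u) = X (Z u) - scl k u"
    and v: "v \<in> U" "v \<noteq> 0" "v \<in> null_part X" "Z v = 0"
  shows "k = 0"
proof -
  have XU: "(X ^^ j) v \<in> U" for j
    by (induction j) (use X(2) v(1) in auto)
  have Zpow: "Z ((X ^^ Suc j) v) = - scl (of_nat (Suc j) * k) ((X ^^ j) v)" for j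
  proof (induction j)
    case 0
    show ?case using rel[OF v(1)] v(4) endo_0[OF X(1)] by simp
  next
    case (Suc j)
    have "Z ((X ^^ Suc (Suc j)) v) = X (Z ((X ^^ Suc j) v)) - scl k ((X ^^ Suc j) v)"
      using rel[OF XU[of "Suc j"]] by simp
    also have "\<dots> = - scl (of_nat (Suc j) * k) ((X ^^ Suc j) v) - scl k ((X ^^ Suc j) v)"
      unfolding Suc.IH by (simp only: endo_neg[OF X(1)] endo_scale[OF X(1)] funpow.simps o_apply)
    also have "\<dots> = - scl (of_nat (Suc (Suc j)) * k) ((X ^^ Suc j) v)"
      unfolding of_nat_Suc[of "Suc j"]
      by (simp add: scale_left_distrib distrib_right del: funpow.simps of_nat_Suc)
    finally show ?case .
  qed
  obtain n where "(X ^^ n) v = 0" "\<And>m. m < n \<Longrightarrow> (X ^^ m) v \<noteq> 0"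
    using v(3) exists_least_iff[of "\<lambda>n. (X ^^ n) v = 0"] by (auto simp: null_part_def)
  moreover then obtain j where "n = Suc j"
    using v(2) by (cases n) auto
  ultimately have "(X ^^ Suc j) v = 0" "(X ^^ j) v \<noteq> 0" by auto
  then show ?thesis
    using Zpow[of j] endo_0[OF Z] by (simp del: funpow.simps of_nat_Suc)
qed

text \<open>On a minimal invariant subspace, all terms of the lower central series act as scalars,
  starting from the trivial one; a commutator that is scalar vanishes by the Weyl relation.\<close>

lemma common_eigenvector:
  assumes h: "cartan_subalgebra scl br h" and nz: "root_subspace scl mul h l \<noteq> {0}"
  shows "\<exists>u. u \<noteq> 0 \<and> (\<forall>x\<in>h. mul x u = scl (l x) u)"
proof -
  let ?R = "root_subspace scl mul h l"
  note c = cartanD[OF h]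
  let ?P = "\<lambda>U. subspace U \<and> U \<noteq> {0} \<and> U \<subseteq> ?R \<and> (\<forall>x\<in>h. \<forall>u\<in>U. mul x u \<in> U)"
  have "mul y u \<in> ?R" if "y \<in> h" "u \<in> ?R" for y u
    unfolding root_subspace_iff
  proof
    fix x assume "x \<in> h"
    then show "mul y u \<in> gen_eig (mul x) (l x)"
      using lie_rep_gen_eig[OF lie_rep_mul, of y x 0 u "l x"] that c(4)
      by (simp add: gen_eig_0 root_subspace_iff)
  qed
  then have PR: "?P ?R" using nz subspace_root by blast
  obtain U where U: "?P U" and min: "\<And>U'. ?P U' \<Longrightarrow> U' \<subseteq> U \<Longrightarrow> U' = U"
    by (rule minimal_subspace[of ?P ?R, OF PR]) (erule conjunct1, rule that)
  from U obtain u\<^sub>0 where u0: "u\<^sub>0 \<in> U" "u\<^sub>0 \<noteq> 0"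
    using subspace_0 by blast
  have UR: "u \<in> gen_eig (mul x) (l x)" if "x \<in> h" "u \<in> U" for x u
    using U that by (auto simp: root_subspace_iff)
  obtain n where n: "lower_central scl br h n = {0}"
    using h unfolding cartan_subalgebra_def by blast
  have lc: "lower_central scl br h i \<subseteq> h" for i
  proof (induction i)
    case (Suc i)
    then show ?case
      unfolding lower_central.simps using c(2,3) by (intro span_minimal) blast+
  qed simp
  have step: "mul z u = scl (l z) u"
    if IH: "\<And>z u. z \<in> lower_central scl br h (Suc i) \<Longrightarrow> u \<in> U \<Longrightarrow> mul z u = scl (l z) u"
      and z: "z \<in> lower_central scl br h i" and u: "u \<in> U" for i z u
  proof -
    let ?Z = "\<lambda>u. mul z u - scl (l z) u"
    have zh: "z \<in> h" using z lc by blast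
    have eZ: "endo ?Z" by (intro endo_shift linear_right)
    have "u\<^sub>0 \<in> null_part ?Z"
      using UR[OF zh u0(1)] by (simp add: gen_eig_def)
    then obtain v where v: "v \<in> U" "v \<noteq> 0" "?Z v = 0"
      using null_part_last[of u\<^sub>0 ?Z U "{0}"] u0 U zh
      by (auto simp: subspace_diff subspace_scale)
    have comm: "mul z (mul x u) = mul x (mul z u)" if x: "x \<in> h" and u: "u \<in> U" for x u
    proof -
      have br: "br x z \<in> lower_central scl br h (Suc i)"
        using x z by (auto intro!: span_base)
      \<comment> \<open>Here \<open>X = x - l x\<close> is locally nilpotent,
        \<open>Z = z - l z\<close> kills \<open>v\<close>, and their commutator is given by
        \<open>br x z\<close>, a scalar by \<open>IH\<close>.\<close>
      have "l (br x z) = 0"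
      proof (rule weyl_relation[of "\<lambda>u. mul x u - scl (l x) u" U ?Z])
        show "v \<in> null_part (\<lambda>u. mul x u - scl (l x) u)"
          using UR[OF x v(1)] by (simp add: gen_eig_def)
        show "?Z (mul x u - scl (l x) u) = mul x (?Z u) - scl (l x) (?Z u) - scl (l (br x z)) u"
          if "u \<in> U" for u
          using mul_commute_br[of x z u] IH[OF br that]
          by (simp add: mul_diff_right mul_scale_right algebra_simps)
      qed (use x v U eZ in \<open>auto intro!: endo_shift linear_right subspace_diff subspace_scale\<close>)
      then show ?thesis
        using mul_commute_br[of x z u] IH[OF br u] by simp
    qed
    let ?U = "{u \<in> U. mul z u = scl (l z) u}"
    have "?P ?U"
    proof (intro conjI)
      show "subspace ?U"
        using U by (intro subspaceI) (auto simp: subspace_0 subspace_add subspace_scale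
            endo_0[OF linear_right] mul_add_right mul_scale_right scale_right_distrib mult.commute)
      show "?U \<noteq> {0}" using v by auto
      show "\<forall>x\<in>h. \<forall>u\<in>?U. mul x u \<in> ?U"
        using U comm by (auto simp: mul_scale_right)
    qed (use U in auto)
    then have "?U = U" using min by blast
    then show ?thesis using u by blast
  qed
  \<comment> \<open>The downward induction starts where the series has reached \<open>{0}\<close>,
    and the function \<open>l\<close> is not known to be linear, so this value needs its own
    argument.\<close>
  have l0: "l 0 = 0"
  proof (rule ccontr)
    assume "l 0 \<noteq> 0"
    moreover have "u\<^sub>0 \<in> gen_eig (mul 0) 0"
      unfolding gen_eig_0 using endo_0[OF linear_left] by (intro null_partI[of 1]) simp
    ultimately show False
      using gen_eig_disjoint[OF linear_right UR[of 0 u\<^sub>0]] u0 subspace_0[OF c(2)] by blast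
  qed
  have "\<forall>z\<in>lower_central scl br h (n - j). \<forall>u\<in>U. mul z u = scl (l z) u" if "j \<le> n" for j
    using that
  proof (induction j)
    case 0
    show ?case using n l0 endo_0[OF linear_left] by auto
  next
    case (Suc j)
    then have idx: "Suc (n - Suc j) = n - j" by simp
    have *: "\<forall>z\<in>lower_central scl br h (Suc (n - Suc j)). \<forall>u\<in>U. mul z u = scl (l z) u"
      unfolding idx using Suc by simp
    show ?case
      by (intro ballI, rule step[of "n - Suc j"]) (use * in blast)+
  qed
  from this[of n] show ?thesis using u0 by auto
qed

text \<open>\<open>D y\<close> multiplies the component \<open>f l\<close> by \<open>l y\<close>. If
  two indices differ at \<open>y\<close>, then \<open>D y - l\<^sub>2 y\<close> removes the
  components whose index agrees with \<open>l\<^sub>2\<close> at \<open>y\<close> and rescales the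
  others; both groups are smaller than \<open>S\<close>.\<close>

lemma component_in_invariant:
  assumes H: "subspace H" "\<And>y v. y \<in> k \<Longrightarrow> v \<in> H \<Longrightarrow> D y v \<in> H"
    and D: "\<And>y. endo (D y)" "\<And>y c v. v \<in> gen_eig (mul y) c \<Longrightarrow> D y v = scl c v"
    and "finite S" "S \<subseteq> supported k" "\<And>l. l \<in> S \<Longrightarrow> f l \<in> root_subspace scl mul k l"
    and "(\<Sum>l\<in>S. f l) \<in> H"
  shows "\<forall>l\<in>S. f l \<in> H"
  using assms(5-)
proof (induction S arbitrary: f rule: finite_psubset_induct)
  case (psubset S)
  show ?case
  proof (cases "\<exists>l\<^sub>1\<in>S. \<exists>l\<^sub>2\<in>S. l\<^sub>1 \<noteq> l\<^sub>2")
    case False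
    then show ?thesis
      using psubset.prems(3) psubset.hyps
      by (metis (no_types, lifting) is_singletonI' is_singleton_the_elem empty_iff singletonD sum.empty
          sum.insert finite.emptyI add.right_neutral)
  next
    case True
    then obtain l\<^sub>1 l\<^sub>2 y where l: "l\<^sub>1 \<in> S" "l\<^sub>2 \<in> S" "l\<^sub>1 y \<noteq> l\<^sub>2 y" by (metis ext)
    then have "l\<^sub>1 \<in> supported k" "l\<^sub>2 \<in> supported k"
      using psubset.prems(1) by blast+
    then have y: "y \<in> k"
      using l(3) by (cases "y \<in> k") (auto simp: supported_def)
    have Df: "D y (f l) = scl (l y) (f l)" if "l \<in> S" for l
      using psubset.prems(2)[OF that] y by (intro D(2)) (auto simp: root_subspace_iff)
    let ?v = "\<Sum>l\<in>S. f l"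
    let ?S' = "{l\<in>S. l y \<noteq> l\<^sub>2 y}"
    have "D y ?v - scl (l\<^sub>2 y) ?v = (\<Sum>l\<in>S. scl (l y - l\<^sub>2 y) (f l))"
      using Df by (simp add: endo_sum[OF D(1)] scale_sum_right scale_left_diff_distrib sum_subtractf)
    also have "\<dots> = (\<Sum>l\<in>?S'. scl (l y - l\<^sub>2 y) (f l))"
      using psubset.hyps by (intro sum.mono_neutral_right) auto
    finally have sum': "(\<Sum>l\<in>?S'. scl (l y - l\<^sub>2 y) (f l)) \<in> H"
      using H psubset.prems(3) y by (metis (no_types, lifting) subspace_diff subspace_scale)
    have "\<forall>l\<in>?S'. scl (l y - l\<^sub>2 y) (f l) \<in> H"
      using l psubset.prems(1,2) sum'
      by (intro psubset.IH) (auto intro!: subspace_scale subspace_root)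
    then have in1: "\<forall>l\<in>?S'. f l \<in> H"
    proof (intro ballI)
      fix l assume *: "\<forall>l\<in>?S'. scl (l y - l\<^sub>2 y) (f l) \<in> H" "l \<in> ?S'"
      then have "scl (inverse (l y - l\<^sub>2 y)) (scl (l y - l\<^sub>2 y) (f l)) \<in> H"
        using subspace_scale[OF H(1)] by blast
      moreover have "inverse (l y - l\<^sub>2 y) * (l y - l\<^sub>2 y) = 1" using * by simp
      ultimately show "f l \<in> H" by (simp only: scale_scale scale_one)
    qed
    have split: "?v = (\<Sum>l\<in>S - ?S'. f l) + (\<Sum>l\<in>?S'. f l)"
      by (rule sum.subset_diff) (use psubset.hyps in auto)
    have "(\<Sum>l\<in>?S'. f l) \<in> H"
      using in1 by (intro subspace_sum H(1)) auto
    with psubset.prems(3) have "?v - (\<Sum>l\<in>?S'. f l) \<in> H"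
      by (rule subspace_diff[OF H(1)])
    then have "(\<Sum>l\<in>S - ?S'. f l) \<in> H"
      unfolding split by (simp only: add_diff_cancel_right')
    then have "\<forall>l\<in>S - ?S'. f l \<in> H"
      using l psubset.prems(1,2) by (intro psubset.IH) auto
    then show ?thesis using in1 by blast
  qed
qed

text \<open>An element \<open>v\<close> of \<open>k\<close> is decomposed into root components of
  \<open>h\<close>. The roots that occur turn out to vanish on \<open>h\<close>, so the components
  have weight 0 and lie in \<open>h\<close>.\<close>

lemma cartan_subset:
  assumes h: "cartan_subalgebra scl br h" "\<And>x. x \<in> h \<Longrightarrow> x \<in> null_part (mul x)"
    and k: "cartan_subalgebra scl br k" "\<And>x. x \<in> k \<Longrightarrow> x \<in> null_part (mul x)"
  shows "k \<subseteq> h"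
proof
  note ch = cartanD[OF h(1)] and ck = cartanD[OF k(1)]
  have null_h: "v \<in> null_part (mul x) \<longleftrightarrow> v \<in> null_part (br x)" if "x \<in> h" for x v
    using gen_eig_br_eq[OF h(2)[OF that], of 0] by (simp add: gen_eig_0)
  have null_k: "v \<in> null_part (mul x) \<longleftrightarrow> v \<in> null_part (br x)" if "x \<in> k" for x v
    using gen_eig_br_eq[OF k(2)[OF that], of 0] by (simp add: gen_eig_0)
  have mem_h: "v \<in> h" if "\<And>x. x \<in> h \<Longrightarrow> v \<in> null_part (mul x)" for v
    using cartan_null_part[OF h(1)] that null_h by blast
  have mem_k: "v \<in> k" if "\<And>x. x \<in> k \<Longrightarrow> v \<in> null_part (mul x)" for v
    using cartan_null_part[OF k(1)] that null_k by blast
  obtain D where D: "\<And>y. endo (D y)" "\<And>y c v. v \<in> gen_eig (mul y) c \<Longrightarrow> D y v = scl c v"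
  proof -
    have "\<exists>D. endo D \<and> (\<forall>c v. v \<in> gen_eig (mul y) c \<longrightarrow> D v = scl c v)" for y
      using semisimple_part[OF linear_right[of y]] by blast
    then show ?thesis using that by metis
  qed
  have Dh: "D y v \<in> h" if "y \<in> k" "v \<in> h" for y v
  proof (rule mem_h)
    fix x assume x: "x \<in> h"
    have "derivation (D y)"
      using semisimple_part_derivation[OF k(2)[OF that(1)]] D by blast
    then show "D y v \<in> null_part (mul x)"
      using derivation_weights[OF _ h(2)[OF x], of "D y" v 0] null_h[OF x] ch(4)[OF x that(2)]
      by (simp add: gen_eig_0)
  qed
  fix v assume v: "v \<in> k"
  obtain S f where S: "finite S" "S \<subseteq> supported h" "\<And>l. l \<in> S \<Longrightarrow> f l \<in> root_subspace scl mul h l"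
      "v = (\<Sum>l\<in>S. f l)"
    using root_sum[OF ch(4)] by blast
  have trivial: "l x = 0" if l: "l \<in> S" "f l \<noteq> 0" and x: "x \<in> h" for l x
  proof -
    obtain M g where M: "finite M" "M \<subseteq> supported k" "\<And>m. m \<in> M \<Longrightarrow> g m \<in> root_subspace scl mul k m"
        "x = (\<Sum>m\<in>M. g m)"
      using root_sum[OF ck(4)] by blast
    have gh: "g m \<in> h" if "m \<in> M" for m
      using component_in_invariant[of h k D M g] ch(2) Dh D M x that by blast
    define x\<^sub>0 where "x\<^sub>0 = (if (\<lambda>_. 0) \<in> M then g (\<lambda>_. 0) else 0)"
    have x0h: "x\<^sub>0 \<in> h"
      using gh subspace_0[OF ch(2)] by (simp add: x\<^sub>0_def)
    have x0k: "x\<^sub>0 \<in> k"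
    proof (rule mem_k)
      fix y assume "y \<in> k"
      then show "x\<^sub>0 \<in> null_part (mul y)"
        using M(3)[of "\<lambda>_. 0"] by (auto simp: x\<^sub>0_def zero_in_null_part root_subspace_iff gen_eig_0)
    qed
    \<comment> \<open>\<open>D x\<^sub>0\<close> multiplies \<open>f l\<close> by
      \<open>l x\<^sub>0\<close>, but kills \<open>v\<close>, because \<open>x\<^sub>0\<close> and
      \<open>v\<close> both lie in the Cartan subalgebra \<open>k\<close>.\<close>
    have "D x\<^sub>0 v = scl 0 v"
      using null_k[OF x0k] ck(4)[OF x0k v] by (intro D(2)) (simp add: gen_eig_0)
    moreover have "D x\<^sub>0 v = (\<Sum>l\<in>S. scl (l x\<^sub>0) (f l))"
      unfolding S(4) endo_sum[OF D(1)]
      using S(3) x0h by (intro sum.cong D(2)) (auto simp: root_subspace_iff)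
    ultimately have "\<forall>l\<in>S. scl (l x\<^sub>0) (f l) = 0"
      using S(1-3) by (intro root_independent[of S h]) (auto intro!: subspace_scale subspace_root)
    then have lx0: "l x\<^sub>0 = 0" using l by auto
    \<comment> \<open>A common eigenvector makes \<open>l\<close> additive on \<open>h\<close>, so
      that it can be evaluated on the components of \<open>x\<close> one at a time.\<close>
    have "root_subspace scl mul h l \<noteq> {0}" using S(3) l by blast
    then obtain u where u: "u \<noteq> 0" "\<And>x. x \<in> h \<Longrightarrow> mul x u = scl (l x) u"
      using common_eigenvector[OF h(1)] by blast
    have "l (g m) = 0" if m: "m \<in> M" for m
    proof (cases "m = (\<lambda>_. 0)")
      case True
      then show ?thesis using m lx0 by (simp add: x\<^sub>0_def)
    next
      case False
      then obtain y where y: "m y \<noteq> 0" by blast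
      then have yk: "y \<in> k" using m M(2) by (auto simp: supported_def)
      have "u \<in> gen_eig (mul (g m)) 0"
        using gen_eig_shift_nilpotent[OF k(2)[OF yk] _ y] M(3)[OF m] yk
        by (simp add: gen_eig_0 root_subspace_iff)
      moreover have "u \<in> gen_eig (mul (g m)) (l (g m))"
        unfolding gen_eig_def using u(2)[OF gh[OF m]] by (intro null_partI[of 1]) simp
      ultimately show ?thesis
        using gen_eig_disjoint[OF linear_right] u(1) by blast
    qed
    then have "mul x u = 0"
      unfolding M(4) mul_sum_left using u(2) gh by (intro sum.neutral) simp
    then show "l x = 0" using u x by simp
  qed
  have "f l \<in> h" if l: "l \<in> S" for l
  proof (cases "f l = 0")
    case True
    then show ?thesis using subspace_0[OF ch(2)] by simp
  next
    case False
    show ?thesis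
    proof (rule mem_h)
      fix x assume "x \<in> h"
      then have "f l \<in> gen_eig (mul x) (l x)" "l x = 0"
        using S(3)[OF l] trivial[OF l False] by (auto simp: root_subspace_iff)
      then show "f l \<in> null_part (mul x)" by (simp add: gen_eig_0)
    qed
  qed
  then show "v \<in> h"
    unfolding S(4) by (intro subspace_sum ch(2))
qed

lemma cartan_unique:
  assumes "cartan_subalgebra scl br h" "\<And>x. x \<in> h \<Longrightarrow> x \<in> null_part (mul x)"
    and "cartan_subalgebra scl br k" "\<And>x. x \<in> k \<Longrightarrow> x \<in> null_part (mul x)"
  shows "h = k"
  using cartan_subset[of h k] cartan_subset[of k h] assms by blast

lemma root_subspace_eq:
  assumes "\<And>x. x \<in> h \<Longrightarrow> x \<in> null_part (mul x)"
  shows "root_subspace scl br h l = root_subspace scl mul h l"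
  using gen_eig_br_eq[OF assms] unfolding root_subspace_def gen_eig_def null_part_def by blast

text \<open>One direction tests only the zero functional, whose root subspace for the bracket
  contains \<open>h\<close>; the converse reaches all functionals through
  \<open>gen_eig_br_eq\<close>.\<close>

lemma canonical_iff:
  assumes h: "cartan_subalgebra scl br h"
  shows "canonical_complex scl mul h \<longleftrightarrow> (\<forall>x\<in>h. x \<in> null_part (mul x))"
proof
  assume can: "canonical_complex scl mul h"
  have "linear_functional_on scl h (\<lambda>_. 0)" by (simp add: linear_functional_on_def)
  then have eq: "root_subspace scl br h (\<lambda>_. 0) = root_subspace scl mul h (\<lambda>_. 0)"
    using can unfolding canonical_complex_def by blast
  show "\<forall>x\<in>h. x \<in> null_part (mul x)"
  proof
    fix x assume x: "x \<in> h"
    then have "x \<in> root_subspace scl br h (\<lambda>_. 0)"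
      using cartanD(4)[OF h] by (auto simp: root_subspace_def null_part_def)
    then show "x \<in> null_part (mul x)"
      unfolding eq using x by (simp add: root_subspace_iff gen_eig_0)
  qed
next
  assume nil: "\<forall>x\<in>h. x \<in> null_part (mul x)"
  then have "root_subspace scl br h l = root_subspace scl mul h l" for l
    by (intro root_subspace_eq) blast
  then show "canonical_complex scl mul h" by (simp add: canonical_complex_def)
qed

end


section \<open>Pencils of operators\<close>

context fd_space
begin

text \<open>Eigenvectors of the pencil modulo \<open>null_part A\<close> for distinct parameters are independent.\<close>

lemma pencil_finite:
  assumes A: "endo A" and B: "endo B" and inv: "\<And>w. w \<in> null_part A \<Longrightarrow> B w \<in> null_part A"
  shows "finite {t. \<not> null_part (\<lambda>w. A w + scl t (B w)) \<subseteq> null_part A}"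
proof -
  let ?W = "null_part A"
  let ?X = "{t. \<not> null_part (\<lambda>w. A w + scl t (B w)) \<subseteq> ?W}"
  have W: "subspace ?W" by (rule subspace_null_part[OF A])
  have AW: "A w \<in> ?W" if "w \<in> ?W" for w
    using that by (intro null_part_image endo_0 A)
  \<comment> \<open>The last iterate of the pencil outside \<open>?W\<close> is a null vector of the
    pencil modulo \<open>?W\<close>.\<close>
  have "\<exists>w. w \<notin> ?W \<and> A w + scl t (B w) \<in> ?W" if t: "t \<in> ?X" for t
  proof -
    obtain w where "w \<in> null_part (\<lambda>w. A w + scl t (B w))" "w \<notin> ?W" using t by blast
    then have "\<exists>w'\<in>UNIV - ?W. A w' + scl t (B w') \<in> ?W"
    proof (induction w rule: null_part_induct)
      case zero
      then show ?case by (simp add: zero_in_null_part)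
    next
      case (step w)
      then show ?case by (cases "A w + scl t (B w) \<in> ?W") auto
    qed
    then show ?thesis by blast
  qed
  then have "\<exists>w. \<forall>t\<in>?X. w t \<notin> ?W \<and> A (w t) + scl t (B (w t)) \<in> ?W"
    by (intro bchoice ballI)
  then obtain w where w: "\<And>t. t \<in> ?X \<Longrightarrow> w t \<notin> ?W"
      "\<And>t. t \<in> ?X \<Longrightarrow> A (w t) + scl t (B (w t)) \<in> ?W" by blast
  have indep: "\<forall>t\<in>S. c t = 0"
    if "finite S" "S \<subseteq> ?X" "(\<Sum>t\<in>S. scl (c t) (w t)) \<in> ?W" for S c
    using that
  proof (induction S arbitrary: c rule: finite_induct)
    case empty
    then show ?case by simp
  next
    case (insert s S)
    let ?r = "\<lambda>t. A (w t) + scl t (B (w t))"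
    let ?v = "\<Sum>t\<in>insert s S. scl (c t) (w t)"
    have nz: "t \<noteq> 0" if "t \<in> insert s S" for t
    proof
      assume "t = 0"
      then have "A (w t) \<in> ?W" using w(2)[of t] that insert.prems(1) by auto
      then show False using null_part_back w(1) that insert.prems(1) by blast
    qed
    \<comment> \<open>The relation at \<open>t\<close> is taken \<open>c t * (s / t)\<close> times,
      and \<open>A + s B\<close> applied to \<open>?v\<close> is subtracted: the \<open>B\<close>
      terms cancel, \<open>A (w t)\<close> keeps the coefficient \<open>d t\<close>, and the term at
      \<open>s\<close> drops out.\<close>
    define d where "d t = c t * (s - t) / t" for t
    have "A ?v + scl s (B ?v) \<in> ?W"
      using insert.prems(2) AW inv by (intro subspace_add subspace_scale W)
    moreover have "(\<Sum>t\<in>insert s S. scl (c t * (s / t)) (?r t)) \<in> ?W"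
      using insert.prems(1) w(2) by (intro subspace_sum subspace_scale W) blast
    ultimately have "(\<Sum>t\<in>insert s S. scl (c t * (s / t)) (?r t)) - (A ?v + scl s (B ?v)) \<in> ?W"
      using subspace_diff[OF W] by blast
    also have "(\<Sum>t\<in>insert s S. scl (c t * (s / t)) (?r t)) - (A ?v + scl s (B ?v))
        = (\<Sum>t\<in>insert s S. scl (d t) (A (w t)))"
      unfolding endo_sum[OF A] endo_sum[OF B] scale_sum_right sum.distrib[symmetric] sum_subtractf[symmetric]
    proof (rule sum.cong)
      fix t assume t: "t \<in> insert s S"
      have "c t * (s / t) * t = s * c t" "d t = c t * (s / t) - c t"
        using nz[OF t] by (simp_all add: d_def field_simps)
      then show "scl (c t * (s / t)) (?r t) - (A (scl (c t) (w t)) + scl s (B (scl (c t) (w t))))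
          = scl (d t) (A (w t))"
        by (simp add: endo_scale[OF A] endo_scale[OF B] scale_right_distrib scale_left_diff_distrib)
    qed simp
    also have "\<dots> = A (\<Sum>t\<in>S. scl (d t) (w t))"
      using insert.hyps by (simp add: d_def endo_sum[OF A] endo_scale[OF A])
    finally have "\<forall>t\<in>S. d t = 0"
      using insert.prems(1) by (intro insert.IH) (auto intro: null_part_back)
    then have c0: "c t = 0" if "t \<in> S" for t
      using that nz[of t] insert.hyps(2) by (auto simp: d_def)
    then have v: "scl (c s) (w s) \<in> ?W"
      using insert.prems(2) insert.hyps by simp
    have "c s = 0"
    proof (rule ccontr)
      assume "c s \<noteq> 0"
      then have "w s = scl (inverse (c s)) (scl (c s) (w s))" by simp
      also have "\<dots> \<in> ?W" using v by (rule subspace_scale[OF W])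
      finally show False using w(1)[of s] insert.prems(1) by simp
    qed
    then show ?case using c0 by blast
  qed
  have inj: "inj_on w ?X"
  proof (rule inj_onI, rule ccontr)
    fix s t assume st: "s \<in> ?X" "t \<in> ?X" "w s = w t" "s \<noteq> t"
    have "\<forall>r\<in>{s, t}. (if r = s then 1 else - 1 :: 'f) = 0"
      using st by (intro indep) (auto simp: zero_in_null_part)
    then show False by simp
  qed
  have "independent (w ` ?X)"
    unfolding independent_explicit_finite_subsets
  proof (intro allI impI ballI)
    fix S u v assume S: "S \<subseteq> w ` ?X" "finite S" "(\<Sum>v\<in>S. scl (u v) v) = 0" "v \<in> S"
    then obtain S' where S': "S' \<subseteq> ?X" "S = w ` S'" using S(1) unfolding subset_image_iff by blast
    then have inj': "inj_on w S'" using inj inj_on_subset by blast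
    then have fin: "finite S'" using S(2) S'(2) finite_image_iff by blast
    have "(\<Sum>t\<in>S'. scl (u (w t)) (w t)) = 0"
      using S(3) unfolding S'(2) by (simp add: sum.reindex[OF inj'])
    then have "\<forall>t\<in>S'. u (w t) = 0"
      by (intro indep fin S'(1)) (simp add: zero_in_null_part)
    then show "u v = 0" using S(4) S'(2) by blast
  qed
  then have "finite (w ` ?X)" by (rule finite_independent)
  then show ?thesis by (rule finite_imageD[OF _ inj])
qed

lemma pencil_power:
  assumes A: "endo A" and B: "endo B"
  shows "\<exists>p. \<forall>t. ((\<lambda>w. A w + scl t (B w)) ^^ n) w = (\<Sum>i\<le>n. scl (t ^ i) (p i))"
proof (induction n)
  case 0
  show ?case by (auto intro!: exI[of _ "\<lambda>_. w"])
next
  case (Suc n)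
  then obtain p where p: "\<And>t. ((\<lambda>w. A w + scl t (B w)) ^^ n) w = (\<Sum>i\<le>n. scl (t ^ i) (p i))"
    by blast
  let ?q = "\<lambda>i. (if i \<le> n then A (p i) else 0) + (case i of 0 \<Rightarrow> 0 | Suc j \<Rightarrow> B (p j))"
  have "((\<lambda>w. A w + scl t (B w)) ^^ Suc n) w = (\<Sum>i\<le>Suc n. scl (t ^ i) (?q i))" for t
  proof -
    have "((\<lambda>w. A w + scl t (B w)) ^^ Suc n) w
        = (\<Sum>i\<le>n. scl (t ^ i) (A (p i))) + (\<Sum>i\<le>n. scl (t ^ Suc i) (B (p i)))"
      by (simp add: p endo_sum[OF A] endo_sum[OF B] endo_scale[OF A] endo_scale[OF B] scale_sum_right)
    also have "(\<Sum>i\<le>n. scl (t ^ i) (A (p i))) = (\<Sum>i\<le>Suc n. scl (t ^ i) (if i \<le> n then A (p i) else 0))"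
      by (auto intro: sum.cong)
    also have "(\<Sum>i\<le>n. scl (t ^ Suc i) (B (p i)))
        = (\<Sum>i\<le>Suc n. scl (t ^ i) (case i of 0 \<Rightarrow> 0 | Suc j \<Rightarrow> B (p j)))"
      by (subst sum.atMost_Suc_shift) simp
    finally show ?thesis
      by (simp only: sum.distrib[symmetric] scale_right_distrib)
  qed
  then show ?case by (intro exI[of _ ?q] allI)
qed

end

locale real_space = fd_space scl for scl :: "real \<Rightarrow> 'v::ab_group_add \<Rightarrow> 'v"
begin

text \<open>Each coordinate is a real polynomial in \<open>t\<close> with infinitely many
  roots.\<close>

lemma vector_poly_zero:
  assumes inf: "infinite {t. (\<Sum>i\<le>n. scl (t ^ i) (p i)) = 0}" and i: "i \<le> n"
  shows "p i = 0"
proof -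
  obtain B where "finite_dimensional_vector_space scl B" by (rule finite_basis)
  then interpret B: finite_dimensional_vector_space scl B .
  have rep: "representation B (p i) b = 0" for b
  proof (rule ccontr)
    assume "representation B (p i) b \<noteq> 0"
    then have "finite {t. (\<Sum>i\<le>n. representation B (p i) b * t ^ i) = 0}"
      using i polyfun_finite_roots[of "\<lambda>i. representation B (p i) b" n] by blast
    moreover have "{t. (\<Sum>i\<le>n. scl (t ^ i) (p i)) = 0}
        \<subseteq> {t. (\<Sum>i\<le>n. representation B (p i) b * t ^ i) = 0}"
    proof
      fix t assume "t \<in> {t. (\<Sum>i\<le>n. scl (t ^ i) (p i)) = 0}"
      then have "representation B (\<Sum>i\<le>n. scl (t ^ i) (p i)) b = 0"
        by (simp add: representation_zero)
      then show "t \<in> {t. (\<Sum>i\<le>n. representation B (p i) b * t ^ i) = 0}"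
        using B.independent_Basis B.span_Basis
        by (simp add: representation_sum representation_scale mult.commute)
    qed
    ultimately show False using inf finite_subset by blast
  qed
  have "(\<Sum>b | representation B (p i) b \<noteq> 0. scl (representation B (p i) b) b) = p i"
    using B.independent_Basis B.span_Basis by (intro sum_nonzero_representation_eq) auto
  then show ?thesis using rep by simp
qed

text \<open>The real line is uncountable, so some power of the pencil kills \<open>w\<close> for infinitely many parameters,
  hence for all of them.\<close>

lemma pencil_null_part:
  assumes A: "endo A" and B: "endo B"
    and fin: "finite {t. w \<notin> null_part (\<lambda>w. A w + scl t (B w))}"
  shows "w \<in> null_part (\<lambda>w. A w + scl t (B w))"
proof -
  let ?Z = "\<lambda>n. {t. ((\<lambda>w. A w + scl t (B w)) ^^ n) w = 0}"
  have all: "UNIV = {t. w \<notin> null_part (\<lambda>w. A w + scl t (B w))} \<union> (\<Union>n. ?Z n)"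
    by (auto simp: null_part_def)
  have "\<not> countable (\<Union>n. ?Z n)"
  proof
    assume "countable (\<Union>n. ?Z n)"
    then have "countable (UNIV :: real set)"
      unfolding all by (intro countable_Un countable_finite[OF fin])
    then show False using uncountable_UNIV_real by blast
  qed
  moreover have "countable (\<Union>n. ?Z n)" if "\<And>n. finite (?Z n)"
    using that by (intro countable_UN) (auto intro: countable_finite)
  ultimately obtain n where n: "infinite (?Z n)" by blast
  obtain p where p: "\<And>t. ((\<lambda>w. A w + scl t (B w)) ^^ n) w = (\<Sum>i\<le>n. scl (t ^ i) (p i))"
    using pencil_power[OF A B] by blast
  have "p i = 0" if "i \<le> n" for i
    using n vector_poly_zero[OF _ that] unfolding p by blast
  then have "((\<lambda>w. A w + scl t (B w)) ^^ n) w = 0"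
    unfolding p by simp
  then show ?thesis by (rule null_partI)
qed

end


section \<open>Linear differential equations\<close>

definition linear_flow :: "('v::real_normed_vector \<Rightarrow> 'v) \<Rightarrow> (real \<Rightarrow> 'v \<Rightarrow> 'v) \<Rightarrow> bool" where
  "linear_flow T E \<longleftrightarrow> (\<forall>w. E 0 w = w \<and> (\<forall>t. ((\<lambda>s. E s w) has_vector_derivative T (E t w)) (at t)))"

text \<open>The exponential series, summed at each vector separately. \<open>D\<close> holds the
  derivatives of its terms, shifted by one index; the summable \<open>M\<close> dominates them on a
  ball around 0 containing \<open>t\<close>.\<close>

lemma linear_flow_exists:
  fixes T :: "'v::banach \<Rightarrow> 'v"
  assumes T: "bounded_linear T"
  shows "\<exists>E. linear_flow T E"
proof -
  interpret T: bounded_linear T by fact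
  obtain K where K: "K \<ge> 0" "\<And>w. norm (T w) \<le> norm w * K"
    using T.nonneg_bounded by blast
  define f where "f w n t = (t ^ n / fact n) *\<^sub>R (T ^^ n) w" for w n and t :: real
  define D where "D w n t = (case n of 0 \<Rightarrow> 0 | Suc m \<Rightarrow> T (f w m t))" for w n t
  define E where "E t w = (\<Sum>n. f w n t)" for t w
  have pow: "norm ((T ^^ n) w) \<le> K ^ n * norm w" for n w
  proof (induction n)
    case (Suc n)
    have "norm (T ((T ^^ n) w)) \<le> norm ((T ^^ n) w) * K" by (rule K(2))
    also have "\<dots> \<le> (K ^ n * norm w) * K" using Suc K(1) by (intro mult_right_mono) auto
    finally show ?case by (simp add: algebra_simps)
  qed simp
  have fb: "norm (f w n t) \<le> (K * R) ^ n / fact n * norm w" if "\<bar>t\<bar> \<le> R" for w n t R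
  proof -
    have "norm (f w n t) = \<bar>t\<bar> ^ n / fact n * norm ((T ^^ n) w)"
      by (simp add: f_def power_abs)
    also have "\<dots> \<le> R ^ n / fact n * (K ^ n * norm w)"
      using that pow by (intro mult_mono divide_right_mono power_mono) auto
    finally show ?thesis by (simp add: power_mult_distrib algebra_simps)
  qed
  have summ: "summable (\<lambda>n. (K * R) ^ n / fact n * c)" for R c :: real
    using summable_exp_generic[of "K * R"] by (intro summable_mult2) (simp add: divide_inverse mult.commute)
  have sumsE: "(\<lambda>n. f w n t) sums E t w" for w t
  proof -
    have "summable (\<lambda>n. f w n t)"
      by (rule summable_comparison_test'[OF summ[of "\<bar>t\<bar>" "norm w"]]) (rule fb, simp)
    then show ?thesis by (simp add: E_def summable_sums)
  qed
  have sumsD: "(\<lambda>n. D w n t) sums T (E t w)" for w t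
  proof -
    have "(\<lambda>n. D w (Suc n) t) sums T (E t w)"
      unfolding D_def using T.sums[OF sumsE] by simp
    then show ?thesis using sums_Suc[of "\<lambda>n. D w n t"] by (simp add: D_def)
  qed
  have der: "((\<lambda>t. f w n t) has_vector_derivative D w n t) (at t within S)" for w n t S
  proof (cases n)
    case 0
    then show ?thesis by (simp add: f_def D_def)
  next
    case (Suc m)
    have "((\<lambda>t. t ^ Suc m / fact (Suc m)) has_real_derivative real (Suc m) * t ^ m / fact (Suc m))
        (at t within S)"
      using DERIV_cdivide[OF DERIV_pow[of "Suc m" t S], of "fact (Suc m)"] by simp
    moreover have "real (Suc m) * t ^ m / fact (Suc m) = t ^ m / fact m"
      by (simp only: fact_Suc) (simp del: of_nat_Suc)
    ultimately have "((\<lambda>t. t ^ Suc m / fact (Suc m)) has_real_derivative t ^ m / fact m) (at t within S)"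
      by (simp only:)
    then have "((\<lambda>t. (t ^ Suc m / fact (Suc m)) *\<^sub>R (T ^^ Suc m) w) has_vector_derivative
        (t ^ m / fact m) *\<^sub>R (T ^^ Suc m) w) (at t within S)"
      using has_vector_derivative_scaleR[OF _ has_vector_derivative_const] by fastforce
    then show ?thesis by (simp add: Suc f_def D_def T.scaleR)
  qed
  have "((\<lambda>s. E s w) has_vector_derivative T (E t w)) (at t)" for w t
  proof -
    define R where "R = \<bar>t\<bar> + 1"
    let ?S = "ball (0::real) R"
    define M where "M n = (case n of 0 \<Rightarrow> 0 | Suc m \<Rightarrow> ((K * R) ^ m / fact m * norm w) * K)" for n
    have "uniform_limit ?S (\<lambda>n x. \<Sum>i<n. D w i x) (\<lambda>x. \<Sum>i. D w i x) sequentially"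
    proof (rule Weierstrass_m_test)
      show "norm (D w n x) \<le> M n" if "x \<in> ?S" for n x
      proof (cases n)
        case (Suc m)
        have "norm (T (f w m x)) \<le> norm (f w m x) * K" by (rule K(2))
        also have "\<dots> \<le> ((K * R) ^ m / fact m * norm w) * K"
          using that K(1) by (intro mult_right_mono fb) auto
        finally show ?thesis by (simp add: Suc D_def M_def)
      qed (simp add: D_def M_def)
      have "summable (\<lambda>n. M (Suc n))"
        using summable_mult2[OF summ[of R "norm w"], of K] by (simp add: M_def)
      then show "summable M" by (simp add: summable_Suc_iff)
    qed
    then have ul: "uniform_limit ?S (\<lambda>n x. \<Sum>i<n. D w i x) (\<lambda>x. T (E x w)) sequentially"
      using sumsD by (simp add: sums_iff)
    have "\<exists>g. \<forall>x\<in>?S. (\<lambda>n. f w n x) sums g x \<and> (g has_derivative (\<lambda>h. h *\<^sub>R T (E x w))) (at x within ?S)"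
    proof (rule has_derivative_series[where f' = "\<lambda>n x h. h *\<^sub>R D w n x"])
      show "(f w n has_derivative (\<lambda>h. h *\<^sub>R D w n x)) (at x within ?S)" for n x
        using der unfolding has_vector_derivative_def by blast
      fix e :: real assume "e > 0"
      with ul have "\<forall>\<^sub>F n in sequentially. \<forall>x\<in>?S. dist (\<Sum>i<n. D w i x) (T (E x w)) < e"
        by (rule uniform_limitD)
      then show "\<forall>\<^sub>F n in sequentially. \<forall>x\<in>?S. \<forall>h.
          norm ((\<Sum>i<n. h *\<^sub>R D w i x) - h *\<^sub>R T (E x w)) \<le> e * norm h"
      proof (rule eventually_mono, intro ballI allI)
        fix n x h assume *: "\<forall>x\<in>?S. dist (\<Sum>i<n. D w i x) (T (E x w)) < e" and x: "x \<in> ?S"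
        have "norm ((\<Sum>i<n. h *\<^sub>R D w i x) - h *\<^sub>R T (E x w))
            = \<bar>h\<bar> * dist (\<Sum>i<n. D w i x) (T (E x w))"
          by (simp add: dist_norm scaleR_sum_right[symmetric] scaleR_diff_right[symmetric])
        also have "\<dots> \<le> \<bar>h\<bar> * e"
          using * x by (intro mult_left_mono) (auto intro: less_imp_le)
        finally show "norm ((\<Sum>i<n. h *\<^sub>R D w i x) - h *\<^sub>R T (E x w)) \<le> e * norm h"
          by (simp only: mult.commute[of e] real_norm_def)
      qed
    next
      show "0 \<in> ?S" by (simp add: R_def)
      show "(\<lambda>n. f w n 0) sums E 0 w" by (rule sumsE)
    qed simp
    then obtain g where g: "\<And>x. x \<in> ?S \<Longrightarrow> (\<lambda>n. f w n x) sums g x"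
      "\<And>x. x \<in> ?S \<Longrightarrow> (g has_derivative (\<lambda>h. h *\<^sub>R T (E x w))) (at x within ?S)" by blast
    have t: "t \<in> ?S" by (simp add: R_def)
    have "(g has_derivative (\<lambda>h. h *\<^sub>R T (E t w))) (at t)"
      using g(2)[OF t] unfolding at_within_open[OF t open_ball] .
    then have "((\<lambda>s. E s w) has_derivative (\<lambda>h. h *\<^sub>R T (E t w))) (at t)"
      by (rule has_derivative_transform_within_open[OF _ open_ball t])
        (rule sums_unique2[OF g(1) sumsE])
    then show ?thesis by (simp add: has_vector_derivative_def)
  qed
  moreover have "E 0 w = w" for w
  proof -
    have "(\<lambda>n. f w n 0) = (\<lambda>n. if n = 0 then w else 0)"
      by (auto simp: f_def zero_power)
    then have "(\<lambda>n. f w n 0) sums w"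
      using sums_single[of 0 "\<lambda>_. w"] by simp
    then show ?thesis using sumsE sums_unique2 by blast
  qed
  ultimately show ?thesis unfolding linear_flow_def by blast
qed

text \<open>On an interval of radius \<open>r\<close> around a zero, the maximum of
  \<open>norm (u x)\<close> is at most \<open>r * K < 1\<close> times itself, hence 0; finitely many
  such steps reach any \<open>t\<close>.\<close>

lemma linear_ode_zero:
  fixes T :: "'v::real_normed_vector \<Rightarrow> 'v"
  assumes T: "bounded_linear T" and u: "\<And>t. (u has_vector_derivative T (u t)) (at t)" "u 0 = 0"
  shows "u t = 0"
proof -
  interpret T: bounded_linear T by fact
  obtain K where K: "K \<ge> 0" "\<And>w. norm (T w) \<le> norm w * K"
    using T.nonneg_bounded by blast
  have cont: "continuous_on S u" for S
    using u(1) by (meson continuous_at_imp_continuous_on has_vector_derivative_continuous)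
  \<comment> \<open>This choice gives \<open>r * K < 1\<close> and stays positive and finite for
    \<open>K = 0\<close>.\<close>
  define r where "r = 1 / (2 * K + 2)"
  have r: "r > 0" "r * K < 1" using K(1) by (auto simp: r_def field_simps)
  have loc: "u b = 0" if a: "u a = 0" and b: "\<bar>b - a\<bar> \<le> r" for a b
  proof -
    let ?S = "{a - r..a + r}"
    have "\<exists>x\<in>?S. \<forall>y\<in>?S. norm (u y) \<le> norm (u x)"
      using r(1) by (intro continuous_attains_sup continuous_on_norm cont) auto
    then obtain x where x: "x \<in> ?S" "\<And>y. y \<in> ?S \<Longrightarrow> norm (u y) \<le> norm (u x)" by blast
    have "norm (u x - u a - (x - a) *\<^sub>R T (u a)) \<le> norm (x - a) * (norm (u x) * K)"
    proof (rule vector_differentiable_bound_linearization[of ?S])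
      show "(u has_vector_derivative T (u y)) (at y within ?S)" for y
        using u(1) has_vector_derivative_at_within by blast
      show "closed_segment a x \<subseteq> ?S"
        using x(1) r(1) by (auto simp: closed_segment_eq_real_ivl)
      show "norm (T (u y) - T (u a)) \<le> norm (u x) * K" if "y \<in> ?S" for y
        using K x(2)[OF that] by (simp add: a T.zero) (meson mult_right_mono order_trans)
    qed (use r(1) in auto)
    also have "\<dots> \<le> r * (norm (u x) * K)"
      using x(1) K(1) by (intro mult_right_mono) (auto simp: abs_le_iff)
    finally have "norm (u x) \<le> (r * K) * norm (u x)"
      by (simp add: a T.zero algebra_simps)
    then have "norm (u x) = 0"
      using r(2) mult_less_cancel_right2[of "r * K" "norm (u x)"] by (metis linorder_not_less norm_ge_zero order_le_less)
    moreover have "b \<in> ?S" using b by (auto simp: abs_le_iff)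
    ultimately show ?thesis using x(2) by fastforce
  qed
  have "\<bar>t\<bar> \<le> real n * r \<Longrightarrow> u t = 0" for n t
  proof (induction n arbitrary: t)
    case 0
    then show ?case using u(2) by simp
  next
    case (Suc n)
    \<comment> \<open>\<open>s\<close> is \<open>t\<close> if the induction hypothesis covers it,
      and otherwise the end of the covered interval on the side of \<open>t\<close>.\<close>
    define s where "s = (if \<bar>t\<bar> \<le> real n * r then t else sgn t * (real n * r))"
    have "\<bar>s\<bar> \<le> real n * r" using r(1) by (auto simp: s_def abs_mult abs_sgn_eq)
    then have "u s = 0" by (rule Suc.IH)
    moreover have "\<bar>t - s\<bar> \<le> r"
      using Suc.prems r(1) by (auto simp: s_def sgn_if algebra_simps split: if_splits)
    ultimately show ?case by (rule loc)
  qed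
  moreover obtain n where "\<bar>t\<bar> \<le> real n * r"
    using reals_Archimedean3[OF r(1)] by (metis less_imp_le)
  ultimately show ?thesis by blast
qed

lemma linear_flow_unique:
  assumes T: "bounded_linear T" and E: "linear_flow T E"
    and u: "\<And>t. (u has_vector_derivative T (u t)) (at t)"
  shows "u t = E t (u 0)"
proof -
  interpret T: bounded_linear T by fact
  note D = E[unfolded linear_flow_def, rule_format]
  have "((\<lambda>t. u t - E t (u 0)) has_vector_derivative T (u t - E t (u 0))) (at t)" for t
    unfolding T.diff using u D by (intro has_vector_derivative_diff) blast+
  moreover have "u 0 - E 0 (u 0) = 0" using D[of "u 0"] by simp
  ultimately have "u t - E t (u 0) = 0" by (rule linear_ode_zero[OF T])
  then show ?thesis by simp
qed

lemma linear_flow_linear: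
  assumes T: "bounded_linear T" and E: "linear_flow T E"
  shows "linear (E t)"
proof -
  interpret T: bounded_linear T by fact
  note D = E[unfolded linear_flow_def, rule_format]
  show ?thesis
  proof (rule linearI)
    fix v w and c :: real
    show "E t (v + w) = E t v + E t w"
    proof -
      have "((\<lambda>t. E t v + E t w) has_vector_derivative T (E t v + E t w)) (at t)" for t
        unfolding T.add using D by (intro has_vector_derivative_add) blast+
      then have "E t v + E t w = E t (E 0 v + E 0 w)" by (rule linear_flow_unique[OF T E])
      then show ?thesis using D[of v] D[of w] by simp
    qed
    show "E t (c *\<^sub>R v) = c *\<^sub>R E t v"
    proof -
      have "((\<lambda>t. c *\<^sub>R E t v) has_vector_derivative T (c *\<^sub>R E t v)) (at t)" for t
        unfolding T.scaleR using D
        by (intro bounded_linear.has_vector_derivative[OF bounded_linear_scaleR_right]) blast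
      then have "c *\<^sub>R E t v = E t (c *\<^sub>R E 0 v)" by (rule linear_flow_unique[OF T E])
      then show ?thesis using D[of v] by simp
    qed
  qed
qed

lemma linear_flow_inverse:
  assumes T: "bounded_linear T" and E: "linear_flow T E"
  shows "E t (E (- t) w) = w"
proof -
  note D = E[unfolded linear_flow_def, rule_format]
  have "((\<lambda>s. E (s - t) w) has_vector_derivative T (E (s - t) w)) (at s)" for s
  proof -
    have "((\<lambda>s. s - t) has_vector_derivative 1) (at s)"
      using has_vector_derivative_diff[OF has_vector_derivative_id has_vector_derivative_const] by simp
    then show ?thesis
      using vector_diff_chain_at[of "\<lambda>s. s - t" 1 s "\<lambda>s. E s w" "T (E (s - t) w)"] D[of w]
      by (simp add: o_def)
  qed
  then have "E (t - t) w = E t (E (0 - t) w)"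
    by (rule linear_flow_unique[OF T E])
  then show ?thesis using D[of w] by simp
qed

text \<open>Both sides solve the equation of \<open>T\<close> with the same initial value. For
  \<open>\<beta> = br\<close> this makes the flow of \<open>br x\<close> act by automorphisms; for
  \<open>\<beta> = aff\<close> it says that the affine flow carries the operator of \<open>y\<close>
  to that of \<open>e t y\<close>.\<close>

lemma linear_flow_equivariant:
  assumes b: "bounded_bilinear \<beta>" and T: "bounded_linear A" "bounded_linear T"
    and leib: "\<And>y w. T (\<beta> y w) = \<beta> (A y) w + \<beta> y (T w)"
    and e: "linear_flow A e" and E: "linear_flow T E"
  shows "E t (\<beta> y w) = \<beta> (e t y) (E t w)"
proof -
  note D = e[unfolded linear_flow_def, rule_format] E[unfolded linear_flow_def, rule_format]
  have "((\<lambda>s. \<beta> (e s y) (E s w)) has_vector_derivative T (\<beta> (e s y) (E s w))) (at s)" for s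
  proof -
    have "((\<lambda>s. e s y) has_vector_derivative A (e s y)) (at s)"
      "((\<lambda>s. E s w) has_vector_derivative T (E s w)) (at s)"
      using D by blast+
    from bounded_bilinear.has_vector_derivative[OF b this] show ?thesis
      by (simp add: leib add.commute)
  qed
  then have "\<beta> (e t y) (E t w) = E t (\<beta> (e 0 y) (E 0 w))"
    by (rule linear_flow_unique[OF T(2) E])
  then show ?thesis using D by simp
qed


section \<open>Boundedness of linear maps on finite-dimensional normed spaces\<close>

text \<open>Equivalence of norms in finite dimension, for arbitrary normed spaces. By induction,
  Cauchy sequences in \<open>span B\<close> have Cauchy coefficients, so \<open>a\<close> has
  positive distance \<open>d\<close> from \<open>span B\<close>, which bounds its own
  coefficient.\<close>

lemma coefficients_bounded:
  fixes B :: "'a::real_normed_vector set"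
  assumes "finite B" "independent B"
  shows "\<exists>K>0. \<forall>c. \<forall>b\<in>B. \<bar>c b\<bar> \<le> K * norm (\<Sum>b\<in>B. c b *\<^sub>R b)"
  using assms
proof (induction B rule: finite_induct)
  case empty
  show ?case by (intro exI[of _ 1]) simp
next
  case (insert a B)
  have indep: "independent B" and a: "a \<notin> span B"
    using insert.prems insert.hyps(2) by (auto simp: independent_insert)
  obtain K where K: "K > 0" "\<And>c b. b \<in> B \<Longrightarrow> \<bar>c b\<bar> \<le> K * norm (\<Sum>b\<in>B. c b *\<^sub>R b)"
    using insert.IH[OF indep] by blast
  have "\<exists>d>0. \<forall>c. d \<le> norm (a + (\<Sum>b\<in>B. c b *\<^sub>R b))"
  proof (rule ccontr)
    assume "\<not> ?thesis"
    then have "\<exists>c. norm (a + (\<Sum>b\<in>B. c b *\<^sub>R b)) < inverse (real (Suc n))" for n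
      by (metis inverse_positive_iff_positive linorder_not_le of_nat_0_less_iff zero_less_Suc)
    then obtain c where c: "\<And>n. norm (a + (\<Sum>b\<in>B. c n b *\<^sub>R b)) < inverse (real (Suc n))"
      by metis
    let ?s = "\<lambda>n. \<Sum>b\<in>B. c n b *\<^sub>R b"
    have lim0: "(\<lambda>n. a + ?s n) \<longlonglongrightarrow> 0"
      using c LIMSEQ_inverse_real_of_nat
      by (intro Lim_null_comparison[of "\<lambda>n. a + ?s n" "\<lambda>n. inverse (real (Suc n))"])
        (auto intro!: always_eventually less_imp_le)
    then have "Cauchy (\<lambda>n. a + ?s n)" by (rule LIMSEQ_imp_Cauchy)
    then have Cs: "Cauchy ?s" by (simp add: Cauchy_def)
    have "convergent (\<lambda>n. c n b)" if b: "b \<in> B" for b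
    proof -
      have "Cauchy (\<lambda>n. c n b)"
        unfolding Cauchy_def
      proof (intro allI impI)
        fix e :: real assume "e > 0"
        then have "e / K > 0" using K(1) by simp
        then obtain N where N: "\<And>m n. m \<ge> N \<Longrightarrow> n \<ge> N \<Longrightarrow> dist (?s m) (?s n) < e / K"
          using Cs unfolding Cauchy_def by blast
        have "dist (c m b) (c n b) < e" if "m \<ge> N" "n \<ge> N" for m n
        proof -
          have "\<bar>c m b - c n b\<bar> \<le> K * norm (\<Sum>b\<in>B. (c m b - c n b) *\<^sub>R b)"
            by (rule K(2)[OF b])
          also have "\<dots> = K * dist (?s m) (?s n)"
            by (simp add: dist_norm scaleR_left_diff_distrib sum_subtractf)
          also have "\<dots> < K * (e / K)"
            using N[OF that] K(1) by (intro mult_strict_left_mono) auto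
          finally show ?thesis using K(1) by (simp add: dist_real_def)
        qed
        then show "\<exists>N. \<forall>m\<ge>N. \<forall>n\<ge>N. dist (c m b) (c n b) < e" by blast
      qed
      then show ?thesis by (rule Cauchy_convergent)
    qed
    then have "\<forall>b\<in>B. \<exists>l. (\<lambda>n. c n b) \<longlonglongrightarrow> l" by (simp add: convergent_def)
    then obtain l where l: "\<And>b. b \<in> B \<Longrightarrow> (\<lambda>n. c n b) \<longlonglongrightarrow> l b" by metis
    have "(\<lambda>n. a + ?s n) \<longlonglongrightarrow> a + (\<Sum>b\<in>B. l b *\<^sub>R b)"
      using l by (intro tendsto_add tendsto_const tendsto_sum tendsto_scaleR)
    then have "a + (\<Sum>b\<in>B. l b *\<^sub>R b) = 0"
      using lim0 LIMSEQ_unique by blast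
    then have "a = - (\<Sum>b\<in>B. l b *\<^sub>R b)" by (simp add: eq_neg_iff_add_eq_0)
    also have "\<dots> \<in> span B"
      by (intro span_neg span_sum span_scale span_base)
    finally show False using a by simp
  qed
  then obtain d where d: "d > 0" "\<And>c. d \<le> norm (a + (\<Sum>b\<in>B. c b *\<^sub>R b))" by blast
  have ca: "\<bar>c a\<bar> \<le> (1 / d) * norm (\<Sum>b\<in>insert a B. c b *\<^sub>R b)" for c
  proof (cases "c a = 0")
    case False
    have "\<bar>c a\<bar> * d \<le> \<bar>c a\<bar> * norm (a + (\<Sum>b\<in>B. (c b / c a) *\<^sub>R b))"
      by (intro mult_left_mono d) simp
    also have "\<dots> = norm (c a *\<^sub>R (a + (\<Sum>b\<in>B. (c b / c a) *\<^sub>R b)))" by simp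
    also have "c a *\<^sub>R (a + (\<Sum>b\<in>B. (c b / c a) *\<^sub>R b)) = (\<Sum>b\<in>insert a B. c b *\<^sub>R b)"
      using False insert.hyps by (simp add: scaleR_right_distrib scaleR_sum_right)
    finally show ?thesis using d(1) by (simp add: field_simps)
  qed (use d(1) in simp)
  \<comment> \<open>\<open>1 / d\<close> serves the coefficient of \<open>a\<close>. The others
    belong to the vector minus its \<open>a\<close> term, whose norm grows at most by the factor
    \<open>1 + norm a / d\<close>.\<close>
  let ?K = "max (1 / d) (K * (1 + norm a / d))"
  have "\<bar>c b\<bar> \<le> ?K * norm (\<Sum>b\<in>insert a B. c b *\<^sub>R b)" if "b \<in> insert a B" for c b
  proof -
    let ?v = "\<Sum>b\<in>insert a B. c b *\<^sub>R b"
    show ?thesis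
    proof (cases "b = a")
      case True
      have "(1 / d) * norm ?v \<le> ?K * norm ?v" by (intro mult_right_mono) auto
      with ca[of c] show ?thesis unfolding True by (rule order_trans)
    next
      case False
      have "(\<Sum>b\<in>B. c b *\<^sub>R b) = ?v - c a *\<^sub>R a" using insert.hyps by simp
      then have "norm (\<Sum>b\<in>B. c b *\<^sub>R b) \<le> norm ?v + \<bar>c a\<bar> * norm a"
        using norm_triangle_ineq4[of ?v "c a *\<^sub>R a"] by simp
      also have "\<dots> \<le> norm ?v + ((1 / d) * norm ?v) * norm a"
        using mult_right_mono[OF ca[of c] norm_ge_zero[of a]] by simp
      finally have "norm (\<Sum>b\<in>B. c b *\<^sub>R b) \<le> (1 + norm a / d) * norm ?v"
        by (simp add: algebra_simps)
      then have "K * norm (\<Sum>b\<in>B. c b *\<^sub>R b) \<le> (K * (1 + norm a / d)) * norm ?v"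
        using K(1) by (simp add: mult_left_mono mult.assoc)
      also have "\<dots> \<le> ?K * norm ?v" by (intro mult_right_mono) auto
      finally have "K * norm (\<Sum>b\<in>B. c b *\<^sub>R b) \<le> ?K * norm ?v" .
      moreover have "\<bar>c b\<bar> \<le> K * norm (\<Sum>b\<in>B. c b *\<^sub>R b)"
        using that False by (intro K(2)) auto
      ultimately show ?thesis by (rule order_trans[rotated])
    qed
  qed
  moreover have "?K > 0" using d(1) by (simp add: less_max_iff_disj)
  ultimately show ?case by blast
qed

lemma finite_basis_coordinates:
  assumes "\<exists>B. finite B \<and> span B = (UNIV :: 'a::real_normed_vector set)"
  obtains B :: "'a::real_normed_vector set" and K where "finite B" "K \<ge> 0"
    "\<And>v. v = (\<Sum>b\<in>B. representation B v b *\<^sub>R b)"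
    "\<And>v b. b \<in> B \<Longrightarrow> \<bar>representation B v b\<bar> \<le> K * norm v"
proof -
  obtain A where A: "finite A" "span A = (UNIV :: 'a set)" using assms by blast
  obtain B where B: "B \<subseteq> A" "independent B" "A \<subseteq> span B"
    using maximal_independent_subset[of A] by blast
  have fin: "finite B" using A B finite_subset by blast
  have "span B = UNIV" using A(2) B(3) span_minimal[of A "span B"] by auto
  then have sum: "(\<Sum>b\<in>B. representation B v b *\<^sub>R b) = v" for v
    using B(2) fin by (intro sum_representation_eq) auto
  obtain K where K: "K > 0" "\<And>c b. b \<in> B \<Longrightarrow> \<bar>c b\<bar> \<le> K * norm (\<Sum>b\<in>B. c b *\<^sub>R b)"
    using coefficients_bounded[OF fin B(2)] by blast
  show ?thesis
  proof (rule that[OF fin less_imp_le[OF K(1)]])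
    show "v = (\<Sum>b\<in>B. representation B v b *\<^sub>R b)" for v using sum by simp
    show "\<bar>representation B v b\<bar> \<le> K * norm v" if "b \<in> B" for v b
      using K(2)[OF that, of "representation B v"] sum by simp
  qed
qed

lemma finite_span_bounded_linear:
  fixes f :: "'a::real_normed_vector \<Rightarrow> 'b::real_normed_vector"
  assumes fd: "\<exists>B. finite B \<and> span B = (UNIV :: 'a set)" and f: "linear f"
  shows "bounded_linear f"
proof -
  obtain B :: "'a set" and K where B: "finite B" "K \<ge> 0"
    "\<And>v. v = (\<Sum>b\<in>B. representation B v b *\<^sub>R b)"
    "\<And>v b. b \<in> B \<Longrightarrow> \<bar>representation B v b\<bar> \<le> K * norm v"
    using finite_basis_coordinates[OF fd] by blast
  have "norm (f v) \<le> norm v * (\<Sum>b\<in>B. K * norm (f b))" for v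
  proof -
    have "norm (f v) = norm (\<Sum>b\<in>B. representation B v b *\<^sub>R f b)"
      by (subst B(3)) (simp add: linear_sum[OF f] linear_scale[OF f])
    also have "\<dots> \<le> (\<Sum>b\<in>B. norm (representation B v b *\<^sub>R f b))" by (rule norm_sum)
    also have "\<dots> \<le> (\<Sum>b\<in>B. (K * norm v) * norm (f b))"
      using B(4) by (intro sum_mono) (simp add: mult_right_mono)
    finally show ?thesis by (simp add: sum_distrib_left algebra_simps)
  qed
  then show ?thesis
    using linear_add[OF f] linear_scale[OF f] by (intro bounded_linear_intro) auto
qed

lemma finite_span_bounded_bilinear:
  fixes m :: "'a::real_normed_vector \<Rightarrow> 'a \<Rightarrow> 'a"
  assumes fd: "\<exists>B. finite B \<and> span B = (UNIV :: 'a set)"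
    and m: "\<And>x. linear (m x)" "\<And>y. linear (\<lambda>x. m x y)"
  shows "bounded_bilinear m"
proof -
  obtain B :: "'a set" and K where B: "finite B" "K \<ge> 0"
    "\<And>v. v = (\<Sum>b\<in>B. representation B v b *\<^sub>R b)"
    "\<And>v b. b \<in> B \<Longrightarrow> \<bar>representation B v b\<bar> \<le> K * norm v"
    using finite_basis_coordinates[OF fd] by blast
  have "\<exists>k\<ge>0. \<forall>y. norm (m b y) \<le> norm y * k" for b
    using bounded_linear.nonneg_bounded[OF finite_span_bounded_linear[OF fd m(1)[of b]]] by blast
  then obtain k where k: "\<And>b. k b \<ge> 0" "\<And>b y. norm (m b y) \<le> norm y * k b" by metis
  have "norm (m x y) \<le> norm x * norm y * (\<Sum>b\<in>B. K * k b)" for x y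
  proof -
    have "norm (m x y) = norm (\<Sum>b\<in>B. representation B x b *\<^sub>R m b y)"
      by (subst B(3)) (simp add: linear_sum[OF m(2)] linear_scale[OF m(2)])
    also have "\<dots> \<le> (\<Sum>b\<in>B. norm (representation B x b *\<^sub>R m b y))" by (rule norm_sum)
    also have "\<dots> \<le> (\<Sum>b\<in>B. (K * norm x) * (norm y * k b))"
      using B(2,4) k by (intro sum_mono) (auto intro!: mult_mono)
    finally show ?thesis by (simp add: sum_distrib_left algebra_simps)
  qed
  then show ?thesis
    using linear_add[OF m(1)] linear_add[OF m(2)] linear_scale[OF m(1)] linear_scale[OF m(2)]
    by (intro bounded_bilinear.intro) auto
qed


section \<open>Existence over the real numbers\<close>

lemma fd_spaceI:
  assumes "vector_space scl" "finite B"
    and "\<And>S. module.subspace scl S \<Longrightarrow> B \<subseteq> S \<Longrightarrow> S = UNIV"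
  shows "fd_space scl"
proof -
  interpret linear_space scl by (rule linear_space.intro) fact
  have "span B = UNIV" by (rule assms(3)) (auto simp: span_superset)
  then show ?thesis using assms(2) by unfold_locales blast
qed

lemma null_part_transfer:
  assumes "\<And>w. E (T w) = T' (E w)" and "\<And>w. E w = 0 \<longleftrightarrow> w = 0"
  shows "E w \<in> null_part T' \<longleftrightarrow> w \<in> null_part T"
proof -
  have "(T' ^^ n) (E w) = E ((T ^^ n) w)" for n
    by (induction n) (simp_all add: assms(1))
  then show ?thesis by (simp add: null_part_def assms(2))
qed

locale real_lsa = left_symmetric_algebra scaleR mul for mul :: "'a::banach \<Rightarrow> 'a \<Rightarrow> 'a"

sublocale real_lsa \<subseteq> real_space "scaleR :: real \<Rightarrow> 'a \<Rightarrow> 'a" ..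

context real_lsa
begin

text \<open>The affine vector field \<open>F\<^sub>x\<close> as a linear operator; the point \<open>v\<close> is \<open>(v, 1)\<close>.\<close>

definition aff :: "'a \<Rightarrow> 'a \<times> real \<Rightarrow> 'a \<times> real" where
  "aff x w = (mul x (fst w) + snd w *\<^sub>R x, 0)"

lemma real_space_affine: "real_space (scaleR :: real \<Rightarrow> 'a \<times> real \<Rightarrow> 'a \<times> real)"
proof (rule real_space.intro)
  obtain B where B: "finite B" "span B = UNIV" using finite_span by blast
  show "fd_space (scaleR :: real \<Rightarrow> 'a \<times> real \<Rightarrow> 'a \<times> real)"
  proof (rule fd_spaceI)
    show "vector_space (scaleR :: real \<Rightarrow> 'a \<times> real \<Rightarrow> 'a \<times> real)"
      by (rule real_vector.vector_space_axioms)
    show "finite (insert (0, 1) ((\<lambda>b. (b, 0 :: real)) ` B))" using B(1) by simp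
    fix S :: "('a \<times> real) set"
    assume "module.subspace scaleR S" and SB: "insert (0, 1) ((\<lambda>b. (b, 0)) ` B) \<subseteq> S"
    then have S: "Real_Vector_Spaces.subspace S" unfolding subspace_raw_def by blast
    have "subspace {v. (v, 0) \<in> S}"
    proof (rule subspaceI)
      show "0 \<in> {v. (v, 0) \<in> S}" using real_vector.subspace_0[OF S] by (simp add: zero_prod_def)
      show "x + y \<in> {v. (v, 0) \<in> S}" if "x \<in> {v. (v, 0) \<in> S}" "y \<in> {v. (v, 0) \<in> S}" for x y
        using real_vector.subspace_add[OF S, of "(x, 0)" "(y, 0)"] that by simp
      show "c *\<^sub>R x \<in> {v. (v, 0) \<in> S}" if "x \<in> {v. (v, 0) \<in> S}" for c x
        using real_vector.subspace_scale[OF S, of "(x, 0)" c] that by simp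
    qed
    then have "UNIV \<subseteq> {v. (v, 0) \<in> S}"
      unfolding B(2)[symmetric] using SB by (intro span_minimal) auto
    then have v0: "(v, 0) \<in> S" for v by blast
    have "(v, s) \<in> S" for v s
      using real_vector.subspace_add[OF S v0[of v] real_vector.subspace_scale[OF S, of "(0, 1)" s]] SB by simp
    then show "S = UNIV" by auto
  qed
qed

interpretation V: real_space "scaleR :: real \<Rightarrow> 'a \<times> real \<Rightarrow> 'a \<times> real"
  by (rule real_space_affine)

lemma endo_aff: "V.endo (aff x)"
  by (rule V.endoI) (auto simp: aff_def mul_add_right mul_scale_right algebra_simps)

lemma aff_add_left: "aff (x + y) w = aff x w + aff y w"
  by (simp add: aff_def mul_add_left algebra_simps)

lemma aff_scale_left: "aff (c *\<^sub>R x) w = c *\<^sub>R aff x w"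
  by (simp add: aff_def mul_scale_left algebra_simps)

lemma aff_commute: "aff x (aff y w) = aff (br x y) w + aff y (aff x w)"
  using mul_commute_br[of x y "fst w"]
  by (simp add: aff_def mul_add_right mul_scale_right lie_bracket_def algebra_simps)

lemma aff_null_part:
  assumes "u \<in> null_part (br x)" "w \<in> null_part (aff x)"
  shows "aff u w \<in> null_part (aff x)"
  using aff_scale_left[of 0 0]
  by (intro null_part_leibniz[where \<beta> = aff, OF V.endo_add[OF endo_aff] aff_commute _ V.endo_0[OF endo_aff] assms])
    simp

text \<open>Minimality is meant for inclusion, not dimension: in this form any bijections that
  transport null parts carry it over, as in \<open>weight_point_flow\<close>.\<close>

definition regular :: "'a \<Rightarrow> bool" where
  "regular x \<longleftrightarrow> (\<forall>z. null_part (aff z) \<subseteq> null_part (aff x) \<and> null_part (br z) \<subseteq> null_part (br x) \<longrightarrow>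
     null_part (aff z) = null_part (aff x) \<and> null_part (br z) = null_part (br x))"

lemma regular_exists: "\<exists>x. regular x"
proof -
  let ?dV = "vector_space.dim (scaleR :: real \<Rightarrow> 'a \<times> real \<Rightarrow> 'a \<times> real)"
  let ?d = "\<lambda>x. ?dV (null_part (aff x)) + dim (null_part (br x))"
  obtain x where x: "\<And>z. ?d x \<le> ?d z"
    using ex_has_least_nat[of "\<lambda>_. True" _ ?d] by auto
  note sub = V.subspace_null_part[OF endo_aff] subspace_null_part[OF br_right]
  have "regular x"
    unfolding regular_def
  proof (intro allI impI, rule ccontr)
    fix z
    assume z: "null_part (aff z) \<subseteq> null_part (aff x) \<and> null_part (br z) \<subseteq> null_part (br x)"
      and ne: "\<not> (null_part (aff z) = null_part (aff x) \<and> null_part (br z) = null_part (br x))"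
    have "?dV (null_part (aff z)) \<le> ?dV (null_part (aff x))"
      "dim (null_part (br z)) \<le> dim (null_part (br x))"
      using z V.dim_less[OF sub(1) sub(1), of z x] dim_less[OF sub(2) sub(2), of z x]
      by (metis less_imp_le order_refl psubsetI)+
    moreover have "?dV (null_part (aff z)) < ?dV (null_part (aff x)) \<or>
        dim (null_part (br z)) < dim (null_part (br x))"
      using z ne V.dim_less[OF sub(1) sub(1), of z x] dim_less[OF sub(2) sub(2), of z x]
      by (metis psubsetI)
    ultimately show False using x[of z] by linarith
  qed
  then show ?thesis by blast
qed

text \<open>On the line \<open>x + t (y - x)\<close> the direction has weight 0, so for all but
  finitely many \<open>t\<close> both null parts are contained in those of \<open>x\<close>, hence
  equal to them by regularity. Nilpotency at a fixed vector for almost all \<open>t\<close> then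
  extends to \<open>t = 1\<close>.\<close>

lemma regular_null_part:
  assumes x: "regular x" and y: "y \<in> null_part (br x)"
  shows "null_part (aff x) \<subseteq> null_part (aff y)" "null_part (br x) \<subseteq> null_part (br y)"
proof -
  have "br x x = 0" by (rule br_self)
  then have xx: "x \<in> null_part (br x)" by (intro null_partI[of 1]) simp
  then have d: "y - x \<in> null_part (br x)"
    using y by (intro subspace_diff subspace_null_part br_right)
  have aff_pencil: "(\<lambda>w. aff x w + t *\<^sub>R aff (y - x) w) = aff (x + t *\<^sub>R (y - x))" for t
    by (rule ext) (simp add: aff_add_left aff_scale_left)
  have br_pencil: "(\<lambda>w. br x w + t *\<^sub>R br (y - x) w) = br (x + t *\<^sub>R (y - x))" for t
    by (rule ext) (simp only: endo_add[OF br_left] endo_scale[OF br_left])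
  have fa: "finite {t. \<not> null_part (\<lambda>w. aff x w + t *\<^sub>R aff (y - x) w) \<subseteq> null_part (aff x)}" (is "finite ?A")
    by (rule V.pencil_finite[OF endo_aff endo_aff]) (rule aff_null_part[OF d])
  have fb: "finite {t. \<not> null_part (\<lambda>w. br x w + t *\<^sub>R br (y - x) w) \<subseteq> null_part (br x)}" (is "finite ?B")
    by (rule pencil_finite[OF br_right br_right]) (rule lie_rep_null_part[OF lie_rep_br d])
  have good: "null_part (aff (x + t *\<^sub>R (y - x))) = null_part (aff x) \<and>
      null_part (br (x + t *\<^sub>R (y - x))) = null_part (br x)" if "t \<notin> ?A \<union> ?B" for t
    using x that unfolding regular_def aff_pencil br_pencil by blast
  show "null_part (aff x) \<subseteq> null_part (aff y)"
  proof
    fix w assume w: "w \<in> null_part (aff x)"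
    have "{t. w \<notin> null_part (\<lambda>w. aff x w + t *\<^sub>R aff (y - x) w)} \<subseteq> ?A \<union> ?B"
      using good w unfolding aff_pencil br_pencil by blast
    then have "finite {t. w \<notin> null_part (\<lambda>w. aff x w + t *\<^sub>R aff (y - x) w)}"
      using fa fb finite_subset by blast
    from V.pencil_null_part[OF endo_aff endo_aff this, of 1]
    show "w \<in> null_part (aff y)" unfolding aff_pencil by simp
  qed
  show "null_part (br x) \<subseteq> null_part (br y)"
  proof
    fix w assume w: "w \<in> null_part (br x)"
    have "{t. w \<notin> null_part (\<lambda>w. br x w + t *\<^sub>R br (y - x) w)} \<subseteq> ?A \<union> ?B"
      using good w unfolding aff_pencil br_pencil by blast
    then have "finite {t. w \<notin> null_part (\<lambda>w. br x w + t *\<^sub>R br (y - x) w)}"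
      using fa fb finite_subset by blast
    from pencil_null_part[OF br_right br_right this, of 1]
    show "w \<in> null_part (br y)" unfolding br_pencil by simp
  qed
qed

lemma bounded_bilinear_mul: "bounded_bilinear mul"
  using finite_span linear_right linear_left unfolding span_raw_def[symmetric] linear_def[symmetric]
  by (intro finite_span_bounded_bilinear) blast+

lemma bounded_bilinear_br: "bounded_bilinear br"
  using finite_span br_right br_left unfolding span_raw_def[symmetric] linear_def[symmetric]
  by (intro finite_span_bounded_bilinear) blast+

lemma bounded_bilinear_aff: "bounded_bilinear aff"
proof -
  obtain K where K: "K \<ge> 0" "\<And>x y. norm (mul x y) \<le> norm x * norm y * K"
    using bounded_bilinear.nonneg_bounded[OF bounded_bilinear_mul] by blast
  have "norm (aff x w) \<le> norm x * norm w * (K + 1)" for x w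
  proof -
    have "norm (aff x w) \<le> norm (mul x (fst w)) + \<bar>snd w\<bar> * norm x"
      using norm_triangle_ineq[of "mul x (fst w)" "snd w *\<^sub>R x"] by (simp add: aff_def norm_Pair)
    also have "\<dots> \<le> norm x * norm w * K + norm w * norm x"
    proof (rule add_mono)
      have "norm (mul x (fst w)) \<le> norm x * norm (fst w) * K" by (rule K(2))
      also have "\<dots> \<le> norm x * norm w * K"
        using K(1) norm_fst_le[of "fst w" "snd w"] by (intro mult_right_mono mult_left_mono) auto
      finally show "norm (mul x (fst w)) \<le> norm x * norm w * K" .
      show "\<bar>snd w\<bar> * norm x \<le> norm w * norm x"
        using norm_snd_le[of "snd w" "fst w"] by (intro mult_right_mono) auto
    qed
    finally show ?thesis by (simp add: algebra_simps)
  qed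
  then show ?thesis
    by (intro bounded_bilinear.intro)
      (auto simp: aff_add_left aff_scale_left V.endo_add[OF endo_aff] V.endo_scale[OF endo_aff])
qed

section \<open>Points of weight 0 under regular elements and their motion under the affine
  group\<close>

definition weight_point :: "'a \<Rightarrow> bool" where
  "weight_point v \<longleftrightarrow> (\<exists>x. regular x \<and> (v, 1) \<in> null_part (aff x))"

text \<open>Fitting's decomposition of \<open>(0, 1)\<close>: as \<open>aff x u\<close> has last
  coordinate 0, the component in the null part still has last coordinate 1 and so is a
  point.\<close>

lemma weight_point_exists: "\<exists>v. weight_point v"
proof -
  obtain x where x: "regular x" using regular_exists by blast
  obtain u where "(0, 1) - aff x u \<in> null_part (aff x)"
    using V.fitting[OF endo_aff] by blast
  then have "(- fst (aff x u), 1) \<in> null_part (aff x)"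
    by (simp add: aff_def minus_prod_def)
  then show ?thesis using x unfolding weight_point_def by blast
qed

text \<open>The flow of \<open>F\<^sub>x\<close> is intertwined with the one-parameter group of automorphisms generated by \<open>ad x\<close>.\<close>

lemma weight_point_flow:
  assumes \<phi>: "is_flow (affine_field mul x) \<phi>"
  shows "bij (\<phi> t) \<and> (\<forall>v. weight_point (\<phi> t v) \<longleftrightarrow> weight_point v)"
proof -
  have bA: "bounded_linear (aff x)" and bB: "bounded_linear (br x)"
    using bounded_bilinear.bounded_linear_right bounded_bilinear_aff bounded_bilinear_br by blast+
  obtain E where E: "linear_flow (aff x) E" using linear_flow_exists[OF bA] by blast
  obtain e where e: "linear_flow (br x) e" using linear_flow_exists[OF bB] by blast
  \<comment> \<open>Uniqueness of solutions identifies the given flow with the linear flow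
    \<open>E\<close> on the hyperplane of points.\<close>
  have E\<phi>: "E t (v, 1) = (\<phi> t v, 1)" for t v
  proof -
    have d: "((\<lambda>s. \<phi> s v) has_vector_derivative affine_field mul x (\<phi> t v)) (at t)" for t
      using \<phi> unfolding is_flow_def by blast
    have "((\<lambda>s. (\<phi> s v, 1)) has_vector_derivative aff x (\<phi> t v, 1)) (at t)" for t
      using has_vector_derivative_Pair[OF d has_vector_derivative_const]
      by (simp add: aff_def affine_field_def)
    then have "(\<phi> t v, 1) = E t (\<phi> 0 v, 1)" by (rule linear_flow_unique[OF bA E])
    then show ?thesis using \<phi> by (simp add: is_flow_def)
  qed
  have linE: "Real_Vector_Spaces.linear (E t)" and line: "Real_Vector_Spaces.linear (e t)" for t
    using linear_flow_linear[OF bA E] linear_flow_linear[OF bB e] by auto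
  have invE: "E t (E (- t) w) = w" "E (- t) (E t w) = w" for t w
    using linear_flow_inverse[OF bA E, of t w] linear_flow_inverse[OF bA E, of "- t" w] by auto
  have inve: "e t (e (- t) w) = w" "e (- t) (e t w) = w" for t w
    using linear_flow_inverse[OF bB e, of t w] linear_flow_inverse[OF bB e, of "- t" w] by auto
  have E0: "E t w = 0 \<longleftrightarrow> w = 0" for t w
    using invE(2)[of t w] linear_0[OF linE] by metis
  have e0: "e t w = 0 \<longleftrightarrow> w = 0" for t w
    using inve(2)[of t w] linear_0[OF line] by metis
  have nullE: "E t w \<in> null_part (aff (e t y)) \<longleftrightarrow> w \<in> null_part (aff y)" for t w y
    by (rule null_part_transfer[where E = "E t" and T = "aff y" and T' = "aff (e t y)"])
      (rule linear_flow_equivariant[where \<beta> = aff and A = "br x" and T = "aff x", OF bounded_bilinear_aff bB bA aff_commute e E], rule E0)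
  have nulle: "e t w \<in> null_part (br (e t y)) \<longleftrightarrow> w \<in> null_part (br y)" for t w y
    by (rule null_part_transfer[where E = "e t" and T = "br y" and T' = "br (e t y)"])
      (rule linear_flow_equivariant[where \<beta> = br and A = "br x" and T = "br x", OF bounded_bilinear_br bB bB jacobi e e], rule e0)
  \<comment> \<open>A competitor of \<open>e t y\<close> is pulled back by \<open>e (- t)\<close> to
    a competitor of \<open>y\<close>.\<close>
  have regular_e: "regular (e t y)" if y: "regular y" for t y
    unfolding regular_def
  proof (intro allI impI)
    fix z assume z: "null_part (aff z) \<subseteq> null_part (aff (e t y)) \<and> null_part (br z) \<subseteq> null_part (br (e t y))"
    define z' where "z' = e (- t) z"
    have z': "z = e t z'" by (simp add: z'_def inve)
    have "null_part (aff z') \<subseteq> null_part (aff y)" "null_part (br z') \<subseteq> null_part (br y)"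
      using z nullE[of t _ z'] nullE[of t _ y] nulle[of t _ z'] nulle[of t _ y] unfolding z' by blast+
    then have eq: "null_part (aff z') = null_part (aff y)" "null_part (br z') = null_part (br y)"
      using y unfolding regular_def by blast+
    have "null_part (aff (e t y)) \<subseteq> null_part (aff z)"
    proof
      fix w assume "w \<in> null_part (aff (e t y))"
      then have "E t (E (- t) w) \<in> null_part (aff (e t y))" by (simp add: invE)
      then have "E t (E (- t) w) \<in> null_part (aff z)" unfolding nullE z' eq .
      then show "w \<in> null_part (aff z)" by (simp add: invE)
    qed
    moreover have "null_part (br (e t y)) \<subseteq> null_part (br z)"
    proof
      fix w assume "w \<in> null_part (br (e t y))"
      then have "e t (e (- t) w) \<in> null_part (br (e t y))" by (simp add: inve)
      then have "e t (e (- t) w) \<in> null_part (br z)" unfolding nulle z' eq .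
      then show "w \<in> null_part (br z)" by (simp add: inve)
    qed
    ultimately show "null_part (aff z) = null_part (aff (e t y)) \<and> null_part (br z) = null_part (br (e t y))"
      using z by blast
  qed
  have fwd: "weight_point (\<phi> t v)" if "weight_point v" for t v
  proof -
    obtain y where y: "regular y" "(v, 1) \<in> null_part (aff y)"
      using \<open>weight_point v\<close> unfolding weight_point_def by blast
    have "(\<phi> t v, 1) \<in> null_part (aff (e t y))"
      using nullE[of t "(v, 1)" y] y(2) unfolding E\<phi> by blast
    then show ?thesis using regular_e[OF y(1)] unfolding weight_point_def by blast
  qed
  have inv\<phi>: "\<phi> t (\<phi> (- t) v) = v" "\<phi> (- t) (\<phi> t v) = v" for v t
    using invE[of t "(v, 1)"] by (simp_all add: E\<phi>)
  have "bij (\<phi> t)"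
    by (rule bij_betw_byWitness[of _ "\<phi> (- t)"]) (auto simp: inv\<phi>)
  moreover have "weight_point (\<phi> t v) \<longleftrightarrow> weight_point v" for v
    using fwd[of v t] fwd[of "\<phi> t v" "- t"] inv\<phi>(2)[of t v] by auto
  ultimately show ?thesis by blast
qed

text \<open>Bijectivity is part of the induction because \<open>inv g\<close> is a true inverse only
  for bijective \<open>g\<close>.\<close>

lemma weight_point_group:
  assumes "g \<in> affine_group mul"
  shows "bij g \<and> (\<forall>v. weight_point (g v) \<longleftrightarrow> weight_point v)"
  using assms
proof (induction g rule: affine_group.induct)
  case one
  show ?case by (intro conjI bij_id allI) simp
next
  case (flow x \<phi> t)
  then show ?case by (rule weight_point_flow)
next
  case (comp g k)
  then have "bij (g \<circ> k)" by (intro bij_comp) auto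
  moreover have "weight_point ((g \<circ> k) v) \<longleftrightarrow> weight_point v" for v
    using comp.IH by simp
  ultimately show ?case by blast
next
  case (inverse g)
  then have "g (inv g v) = v" for v by (simp add: bij_is_surj surj_f_inv_f)
  then show ?case using inverse.IH bij_imp_bij_inv by metis
qed

theorem nilpotent_subalgebra_exists:
  assumes "complete_algebra mul"
  shows "\<exists>x. \<forall>y\<in>null_part (br x). \<forall>z\<in>null_part (br x). z \<in> null_part (br y) \<and> z \<in> null_part (mul y)"
proof -
  obtain v where v: "weight_point v" using weight_point_exists by blast
  obtain g where g: "g \<in> affine_group mul" "g v = 0"
    using assms unfolding complete_algebra_def by blast
  have "weight_point (g v)" using weight_point_group[OF g(1)] v by blast
  then have "weight_point 0" by (simp only: g(2))
  then obtain x where x: "regular x" "(0, 1) \<in> null_part (aff x)"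
    unfolding weight_point_def by blast
  have "z \<in> null_part (mul y)" if y: "y \<in> null_part (br x)" and z: "z \<in> null_part (br x)" for y z
  proof -
    \<comment> \<open>\<open>aff z\<close> sends the origin \<open>(0, 1)\<close> to
      \<open>(z, 0)\<close>, and on vectors with last coordinate 0 \<open>aff y\<close> is
      \<open>mul y\<close>.\<close>
    have "aff z (0, 1) \<in> null_part (aff x)" by (rule aff_null_part[OF z x(2)])
    then have "(z, 0) \<in> null_part (aff x)"
      using endo_0[OF linear_right] by (simp add: aff_def)
    then have "(z, 0) \<in> null_part (aff y)" using regular_null_part(1)[OF x(1) y] by blast
    then obtain n where n: "(aff y ^^ n) (z, 0) = 0" by (auto simp: null_part_def)
    have "(aff y ^^ n) (z, 0) = ((mul y ^^ n) z, 0)"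
      by (induction n) (simp_all add: aff_def)
    then show ?thesis using n by (intro null_partI[of n]) (simp add: zero_prod_def)
  qed
  then show ?thesis using regular_null_part(2)[OF x(1)] by blast
qed


section \<open>Complexification\<close>

lemma complex_lsa_cx: "complex_lsa scale_cx (mul_cx mul)"
proof -
  have vs: "vector_space (scale_cx :: complex \<Rightarrow> 'a \<times> 'a \<Rightarrow> 'a \<times> 'a)"
    by unfold_locales (auto simp: scale_cx_def prod_eq_iff algebra_simps)
  obtain B where B: "finite B" "span B = UNIV" using finite_span by blast
  interpret V: vector_space "scale_cx :: complex \<Rightarrow> 'a \<times> 'a \<Rightarrow> 'a \<times> 'a" by (rule vs)
  have "fd_space (scale_cx :: complex \<Rightarrow> 'a \<times> 'a \<Rightarrow> 'a \<times> 'a)"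
  proof (rule fd_spaceI[OF vs])
    show "finite ((\<lambda>b. (b, 0 :: 'a)) ` B)" using B(1) by simp
    fix S assume S: "V.subspace S" "(\<lambda>b. (b, 0)) ` B \<subseteq> S"
    have "subspace {v. (v, 0) \<in> S}"
    proof (rule subspaceI)
      show "0 \<in> {v. (v, 0) \<in> S}" using V.subspace_0[OF S(1)] by (simp add: zero_prod_def)
      show "x + y \<in> {v. (v, 0) \<in> S}" if "x \<in> {v. (v, 0) \<in> S}" "y \<in> {v. (v, 0) \<in> S}" for x y
        using V.subspace_add[OF S(1), of "(x, 0)" "(y, 0)"] that by simp
      show "c *\<^sub>R x \<in> {v. (v, 0) \<in> S}" if "x \<in> {v. (v, 0) \<in> S}" for c x
        using V.subspace_scale[OF S(1), of "(x, 0)" "of_real c"] that by (simp add: scale_cx_def)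
    qed
    then have "UNIV \<subseteq> {v. (v, 0) \<in> S}"
      unfolding B(2)[symmetric] using S(2) by (intro span_minimal) auto
    then have v0: "(v, 0) \<in> S" for v by blast
    have "(u, v) \<in> S" for u v
      using V.subspace_add[OF S(1) v0[of u] V.subspace_scale[OF S(1) v0[of v], of \<i>]]
      by (simp add: scale_cx_def)
    then show "S = UNIV" by auto
  qed
  then interpret F: fd_space "scale_cx :: complex \<Rightarrow> 'a \<times> 'a \<Rightarrow> 'a \<times> 'a" .
  show ?thesis
  proof unfold_locales
    show "\<exists>B. finite B \<and> V.span B = UNIV" by (rule F.finite_span)
    fix x y z :: "'a \<times> 'a"
    have "mul u (mul v w) = mul (mul u v) w + mul v (mul u w) - mul (mul v u) w" for u v w
      using left_symmetric[of u v w] by (simp add: algebra_simps)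
    note e = this[of "fst x" "fst y"] this[of "fst x" "snd y"] this[of "snd x" "fst y"]
      this[of "snd x" "snd y"]
    show "mul_cx mul x (mul_cx mul y z) - mul_cx mul (mul_cx mul x y) z =
        mul_cx mul y (mul_cx mul x z) - mul_cx mul (mul_cx mul y x) z"
      unfolding mul_cx_def fst_conv snd_conv mul_add_left mul_add_right mul_diff_left mul_diff_right e
      by (simp add: algebra_simps)
  qed (auto simp: mul_cx_def scale_cx_def prod_eq_iff mul_add_left mul_add_right mul_diff_left
      mul_diff_right mul_scale_left mul_scale_right algebra_simps)
qed

interpretation C: complex_lsa scale_cx "mul_cx mul"
  by (rule complex_lsa_cx)

lemma br_cx: "C.br p q = (br (fst p) (fst q) - br (snd p) (snd q), br (fst p) (snd q) + br (snd p) (fst q))"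
  by (simp add: lie_bracket_def mul_cx_def algebra_simps)

lemma subspace_cx: "subspace S \<Longrightarrow> C.subspace (S \<times> S)"
  by (rule C.subspaceI)
    (auto simp: scale_cx_def zero_prod_def subspace_0 subspace_add subspace_diff subspace_scale)

lemma cartan_cx:
  assumes h: "cartan_subalgebra scaleR br h"
  shows "cartan_subalgebra scale_cx C.br (h \<times> h)"
proof -
  note c = cartanD[OF h]
  obtain n where n: "lower_central scaleR br h n = {0}"
    using h unfolding cartan_subalgebra_def by blast
  have sub_lc: "subspace (lower_central scaleR br h i)" for i
    by (cases i) (use c(2) in simp_all)
  have lc: "lower_central scale_cx C.br (h \<times> h) i
      \<subseteq> lower_central scaleR br h i \<times> lower_central scaleR br h i" for i
  proof (induction i)
    case (Suc i)
    let ?S = "lower_central scaleR br h (Suc i)"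
    have gen: "br x y \<in> ?S" if "x \<in> h" "y \<in> lower_central scaleR br h i" for x y
      using that by (auto intro!: span_base)
    have "C.br p q \<in> ?S \<times> ?S" if "p \<in> h \<times> h" "q \<in> lower_central scale_cx C.br (h \<times> h) i" for p q
    proof -
      have "fst p \<in> h" "snd p \<in> h" "fst q \<in> lower_central scaleR br h i" "snd q \<in> lower_central scaleR br h i"
        using that Suc.IH by auto
      then show ?thesis
        unfolding br_cx using gen by (auto intro!: subspace_add subspace_diff sub_lc simp del: lower_central.simps)
    qed
    then show ?case
      unfolding lower_central.simps(2)[of scale_cx]
      by (intro C.span_minimal subspace_cx sub_lc) blast
  qed simp
  have "C.subspace (lower_central scale_cx C.br (h \<times> h) n)"
    by (cases n) (simp_all add: subspace_cx c(2))
  then have "0 \<in> lower_central scale_cx C.br (h \<times> h) n" by (rule C.subspace_0)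
  then have triv: "lower_central scale_cx C.br (h \<times> h) n = {0}"
    using lc[of n] unfolding n by (auto simp: zero_prod_def)
  have self: "p \<in> h \<times> h" if p: "\<forall>q\<in>h \<times> h. C.br p q \<in> h \<times> h" for p
  proof -
    have "br (fst p) y \<in> h \<and> br (snd p) y \<in> h" if "y \<in> h" for y
      using bspec[OF p, of "(y, 0)"] that subspace_0[OF c(2)] endo_0[OF br_right] by (simp add: br_cx)
    then show ?thesis using c(5) by (simp add: mem_Times_iff)
  qed
  have closed: "C.br p q \<in> h \<times> h" if "p \<in> h \<times> h" "q \<in> h \<times> h" for p q
    unfolding br_cx using that
    by (intro SigmaI subspace_add[OF c(2)] subspace_diff[OF c(2)] c(3)) auto
  have "{p. \<forall>q\<in>h \<times> h. C.br p q \<in> h \<times> h} = h \<times> h"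
  proof (intro equalityI subsetI)
    fix p assume "p \<in> {p. \<forall>q\<in>h \<times> h. C.br p q \<in> h \<times> h}"
    then show "p \<in> h \<times> h" by (intro self) (rule CollectD)
  next
    fix p assume "p \<in> h \<times> h"
    then show "p \<in> {p. \<forall>q\<in>h \<times> h. C.br p q \<in> h \<times> h}" by (intro CollectI ballI closed)
  qed
  then show ?thesis
    unfolding cartan_subalgebra_def using subspace_cx[OF c(2)] triv
    by (intro conjI exI[of _ n] ballI closed)
qed

text \<open>Only real parts of root subspaces are compared, so \<open>a\<close> in \<open>h\<close>
  gives a null vector \<open>(a, b)\<close> with unknown \<open>b\<close>. The zero root subspace is
  stable under conjugation, and averaging with \<open>(a, - b)\<close> gives \<open>(a, 0)\<close>;
  complex combinations give the rest.\<close>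

lemma canonical_real_null_part:
  assumes h: "cartan_subalgebra scaleR br h" and can: "canonical_real mul h" and p: "p \<in> h \<times> h"
  shows "p \<in> null_part (mul_cx mul p)"
proof -
  let ?R = "root_subspace scale_cx (mul_cx mul) (h \<times> h) (\<lambda>_. 0)"
  note c = cartanD[OF h]
  have sub: "C.subspace ?R" by (rule C.subspace_root)
  have conj: "(u, - v) \<in> ?R" if uv: "(u, v) \<in> ?R" for u v
    unfolding C.root_subspace_iff C.gen_eig_0
  proof
    fix q assume q: "q \<in> h \<times> h"
    let ?q = "(fst q, - snd q)"
    have "?q \<in> h \<times> h" using q subspace_neg[OF c(2)] by auto
    then obtain n where n: "(mul_cx mul ?q ^^ n) (u, v) = 0"
      using uv unfolding C.root_subspace_iff C.gen_eig_0 null_part_def by blast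
    let ?w = "\<lambda>n. (mul_cx mul ?q ^^ n) (u, v)"
    have "(mul_cx mul q ^^ n) (u, - v) = (fst (?w n), - snd (?w n))" for n
      by (induction n) (simp_all add: mul_cx_def endo_neg[OF linear_left] endo_neg[OF linear_right])
    then show "(u, - v) \<in> null_part (mul_cx mul q)"
      using n by (intro null_partI[of n]) (simp add: zero_prod_def)
  qed
  have real: "(a, 0) \<in> ?R" if a: "a \<in> h" for a
  proof -
    have "linear_functional_on scale_cx (h \<times> h) (\<lambda>_. 0)" by (simp add: linear_functional_on_def)
    then have eq: "real_root_subspace C.br h (\<lambda>_. 0) = real_root_subspace (mul_cx mul) h (\<lambda>_. 0)"
      using can unfolding canonical_real_def by blast
    have "(a, 0) \<in> root_subspace scale_cx C.br (h \<times> h) (\<lambda>_. 0)"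
      using C.cartanD(4)[OF cartan_cx[OF h], of _ "(a, 0)"] a subspace_0[OF c(2)]
      by (simp add: root_subspace_def null_part_def)
    then have "a \<in> real_root_subspace C.br h (\<lambda>_. 0)"
      unfolding real_root_subspace_def by force
    then have "a \<in> fst ` ?R" unfolding eq by (simp only: real_root_subspace_def)
    then obtain b where b: "(a, b) \<in> ?R" by force
    have "scale_cx (1 / 2) ((a, b) + (a, - b)) \<in> ?R"
      by (intro C.subspace_scale C.subspace_add sub b conj)
    moreover have "scale_cx (1 / 2) ((a, b) + (a, - b)) = (a, 0)"
      by (simp add: scale_cx_def flip: scaleR_add_left)
    ultimately show ?thesis by simp
  qed
  have "(fst p, 0) + scale_cx \<i> (snd p, 0) \<in> ?R"
    using p by (intro C.subspace_scale C.subspace_add sub real) auto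
  moreover have "(fst p, 0) + scale_cx \<i> (snd p, 0) = p"
    by (simp add: scale_cx_def)
  ultimately have "p \<in> ?R" by (simp only:)
  then show ?thesis
    using p unfolding C.root_subspace_iff C.gen_eig_0 by blast
qed

text \<open>Multiplication by \<open>p\<close> combines multiplications by two elements of
  \<open>h\<close> that need not commute, so their separate nilpotency is not enough. Words of
  Engel's uniform length \<open>N\<close> kill every term in the expansion of the
  \<open>N\<close>-th power.\<close>

lemma null_part_cx:
  assumes h: "cartan_subalgebra scaleR br h"
    and nil: "\<And>y z. y \<in> h \<Longrightarrow> z \<in> h \<Longrightarrow> z \<in> null_part (mul y)" and p: "p \<in> h \<times> h"
  shows "p \<in> null_part (mul_cx mul p)"
proof -
  note c = cartanD[OF h]
  \<comment> \<open>The zero root subspace of \<open>h\<close> under \<open>mul\<close>: it contains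
    \<open>h\<close> by \<open>nil\<close>, and \<open>h\<close> acts on it nilpotently.\<close>
  let ?W = "\<Inter>y\<in>h. null_part (mul y)"
  have W: "subspace ?W"
    by (intro subspace_Inter) (auto intro: subspace_null_part linear_right)
  have inv: "mul y w \<in> ?W" if "y \<in> h" "w \<in> ?W" for y w
    using that lie_rep_null_part[OF lie_rep_mul c(4)] by blast
  obtain N where N: "\<And>w ys. w \<in> ?W \<Longrightarrow> length ys = N \<Longrightarrow> set ys \<subseteq> h \<Longrightarrow> foldr mul ys w = 0"
    using engel_words[OF engel_theorem[OF c(1,4)] lie_rep_mul W inv] by blast
  have word: "endo (foldr mul ys)" for ys
    by (rule endoI; induction ys) (auto simp: mul_add_right mul_scale_right)
  let ?P = "\<lambda>j w. \<forall>ys. length ys = j \<and> set ys \<subseteq> h \<longrightarrow> foldr mul ys (fst w) = 0 \<and> foldr mul ys (snd w) = 0"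
  have step: "?P j (mul_cx mul p w)" if w: "?P (Suc j) w" for j w
  proof (intro allI impI)
    fix ys assume ys: "length ys = j \<and> set ys \<subseteq> h"
    have "foldr mul (ys @ [a]) (fst w) = 0 \<and> foldr mul (ys @ [a]) (snd w) = 0" if "a \<in> h" for a
      by (rule w[rule_format]) (use ys that in auto)
    then have "foldr mul ys (mul a (fst w)) = 0 \<and> foldr mul ys (mul a (snd w)) = 0" if "a \<in> h" for a
      using that by simp
    then show "foldr mul ys (fst (mul_cx mul p w)) = 0 \<and> foldr mul ys (snd (mul_cx mul p w)) = 0"
      using p by (auto simp: mul_cx_def endo_add[OF word] endo_diff[OF word])
  qed
  have "?P (N - j) ((mul_cx mul p ^^ j) p)" if "j \<le> N" for j
    using that
  proof (induction j)
    case 0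
    show ?case using N nil p by auto
  next
    case (Suc j)
    then have "?P (Suc (N - Suc j)) ((mul_cx mul p ^^ j) p)" by (simp add: Suc_diff_Suc)
    then show ?case using step by simp
  qed
  from this[of N] have "(mul_cx mul p ^^ N) p = 0"
    by (simp add: prod_eq_iff)
  then show ?thesis by (rule null_partI)
qed

theorem canonical_real_unique:
  assumes complete: "complete_algebra mul"
  shows "\<exists>!h. cartan_subalgebra scaleR br h \<and> canonical_real mul h"
proof -
  obtain x where x: "\<And>y z. y \<in> null_part (br x) \<Longrightarrow> z \<in> null_part (br x) \<Longrightarrow>
      z \<in> null_part (br y) \<and> z \<in> null_part (mul y)"
    using nilpotent_subalgebra_exists[OF complete] by blast
  let ?h = "null_part (br x)"
  have cartan: "cartan_subalgebra scaleR br ?h"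
    using x by (intro cartan_null_partI) auto
  have "root_subspace scale_cx C.br (?h \<times> ?h) l = root_subspace scale_cx (mul_cx mul) (?h \<times> ?h) l" for l
    using null_part_cx[OF cartan] x by (intro C.root_subspace_eq) blast
  then have canonical: "canonical_real mul ?h"
    by (simp add: canonical_real_def real_root_subspace_def)
  show ?thesis
  proof (rule ex1I[of _ ?h])
    fix k assume k: "cartan_subalgebra scaleR br k \<and> canonical_real mul k"
    have "k \<times> k = ?h \<times> ?h"
      using k cartan canonical canonical_real_null_part
      by (intro C.cartan_unique cartan_cx) blast+
    then have "(z, z) \<in> k \<times> k \<longleftrightarrow> (z, z) \<in> ?h \<times> ?h" for z by simp
    then show "k = ?h" by auto
  qed (use cartan canonical in blast)
qed

end


section \<open>The real algebra underlying a complex one, and the theorem\<close>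

lemma real_lsa_of_complex:
  fixes scaleC :: "complex \<Rightarrow> 'b::banach \<Rightarrow> 'b"
  assumes ext: "extends_scaleR scaleC" and lsa: "left_symmetric_algebra scaleC mul"
  shows "real_lsa mul"
proof -
  interpret C: left_symmetric_algebra scaleC mul by fact
  have r: "c *\<^sub>R v = scaleC (of_real c) v" for c v
    using ext by (simp add: extends_scaleR_def)
  obtain B where B: "finite B" "C.span B = UNIV" using C.finite_span by blast
  have "fd_space (scaleR :: real \<Rightarrow> 'b \<Rightarrow> 'b)"
  proof (rule fd_spaceI[OF real_vector.vector_space_axioms])
    show "finite (B \<union> scaleC \<i> ` B)" using B(1) by simp
    fix S assume "module.subspace scaleR S" and SB: "B \<union> scaleC \<i> ` B \<subseteq> S"
    then have S: "Real_Vector_Spaces.subspace S" unfolding subspace_raw_def by blast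
    \<comment> \<open>This is the largest complex subspace inside \<open>S\<close>, and it contains
      the complex spanning set \<open>B\<close>.\<close>
    have "C.subspace {v. v \<in> S \<and> scaleC \<i> v \<in> S}"
    proof (rule C.subspaceI)
      show "0 \<in> {v. v \<in> S \<and> scaleC \<i> v \<in> S}" using real_vector.subspace_0[OF S] by simp
      show "x + y \<in> {v. v \<in> S \<and> scaleC \<i> v \<in> S}"
        if "x \<in> {v. v \<in> S \<and> scaleC \<i> v \<in> S}" "y \<in> {v. v \<in> S \<and> scaleC \<i> v \<in> S}" for x y
        using that real_vector.subspace_add[OF S] by (simp add: C.scale_right_distrib)
      show "scaleC c x \<in> {v. v \<in> S \<and> scaleC \<i> v \<in> S}" if x: "x \<in> {v. v \<in> S \<and> scaleC \<i> v \<in> S}" for c x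
      proof -
        have "scaleC c x = Re c *\<^sub>R x + Im c *\<^sub>R scaleC \<i> x"
          unfolding r C.scale_scale C.scale_left_distrib[symmetric]
          by (rule arg_cong[where f = "\<lambda>c. scaleC c x"]) (simp add: complex_eq_iff)
        moreover have "scaleC \<i> (scaleC c x) = (- Im c) *\<^sub>R x + Re c *\<^sub>R scaleC \<i> x"
          unfolding r C.scale_scale C.scale_left_distrib[symmetric]
          by (rule arg_cong[where f = "\<lambda>c. scaleC c x"]) (simp add: complex_eq_iff)
        ultimately show ?thesis
          using x real_vector.subspace_add[OF S] real_vector.subspace_diff[OF S]
            real_vector.subspace_scale[OF S] by simp
      qed
    qed
    then have "UNIV \<subseteq> {v. v \<in> S \<and> scaleC \<i> v \<in> S}"
      unfolding B(2)[symmetric] using SB by (intro C.span_minimal) auto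
    then show "S = UNIV" by blast
  qed
  then interpret F: fd_space "scaleR :: real \<Rightarrow> 'b \<Rightarrow> 'b" .
  show ?thesis
  proof unfold_locales
    show "\<exists>B. finite B \<and> module.span (scaleR :: real \<Rightarrow> 'b \<Rightarrow> 'b) B = UNIV" by (rule F.finite_span)
    show "mul x (mul y z) - mul (mul x y) z = mul y (mul x z) - mul (mul y x) z" for x y z
      by (rule C.left_symmetric)
  qed (auto simp: r C.mul_add_left C.mul_add_right C.mul_scale_left C.mul_scale_right)
qed

theorem theorem1:
  "(\<forall>mul :: 'a::banach \<Rightarrow> 'a \<Rightarrow> 'a.
      left_symmetric_algebra scaleR mul \<and> complete_algebra mul \<longrightarrow>
      (\<exists>!h. cartan_subalgebra scaleR (lie_bracket mul) h \<and> canonical_real mul h)) \<and>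
   (\<forall>(scaleC :: complex \<Rightarrow> 'b::banach \<Rightarrow> 'b) (mul :: 'b \<Rightarrow> 'b \<Rightarrow> 'b).
      extends_scaleR scaleC \<and> left_symmetric_algebra scaleC mul \<and> complete_algebra mul \<longrightarrow>
      (\<exists>!h. cartan_subalgebra scaleC (lie_bracket mul) h \<and> canonical_complex scaleC mul h))"
proof (intro conjI allI impI)
  fix mul :: "'a \<Rightarrow> 'a \<Rightarrow> 'a"
  assume a: "left_symmetric_algebra scaleR mul \<and> complete_algebra mul"
  then interpret real_lsa mul by (intro real_lsa.intro) simp
  show "\<exists>!h. cartan_subalgebra scaleR (lie_bracket mul) h \<and> canonical_real mul h"
    using a by (intro canonical_real_unique) simp
next
  fix scaleC :: "complex \<Rightarrow> 'b \<Rightarrow> 'b" and mul :: "'b \<Rightarrow> 'b \<Rightarrow> 'b"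
  assume a: "extends_scaleR scaleC \<and> left_symmetric_algebra scaleC mul \<and> complete_algebra mul"
  interpret C: complex_lsa scaleC mul
    using a by (intro complex_lsa.intro) simp
  \<comment> \<open>Existence is read off from the underlying real algebra:
    \<open>complete_algebra\<close> speaks of real time, and the null parts of \<open>br\<close> and
    \<open>mul\<close> do not depend on the scalars.\<close>
  obtain x where x: "\<And>y z. y \<in> null_part (C.br x) \<Longrightarrow> z \<in> null_part (C.br x) \<Longrightarrow>
      z \<in> null_part (C.br y) \<and> z \<in> null_part (mul y)"
    using real_lsa.nilpotent_subalgebra_exists[OF real_lsa_of_complex] a by blast
  have cartan: "cartan_subalgebra scaleC C.br (null_part (C.br x))"
    using x by (intro C.cartan_null_partI) auto
  show "\<exists>!h. cartan_subalgebra scaleC C.br h \<and> canonical_complex scaleC mul h"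
  proof (rule ex1I[of _ "null_part (C.br x)"])
    show "cartan_subalgebra scaleC C.br (null_part (C.br x)) \<and>
        canonical_complex scaleC mul (null_part (C.br x))"
      using cartan x C.canonical_iff[OF cartan] by blast
  next
    fix k assume k: "cartan_subalgebra scaleC C.br k \<and> canonical_complex scaleC mul k"
    then show "k = null_part (C.br x)"
      using C.canonical_iff[of k] x cartan by (intro C.cartan_unique) blast+
  qed
qed

end
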